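(* Let $-1<\alpha<\beta<1$ and let $C_{\alpha,\beta}:=[-1,\alpha]\cup[\beta,1]$. Let $k\in(0,1)$ be given by $$k^2=\frac{2(\beta-\alpha)}{(1-\alpha)(1+\beta)},$$ let $k'=\sqrt{1-k^2}$, $K=K(k)$, $E=E(k)$, and let $\lambda\in(0,1)$ be such that $\operatorname{sn}^2(\lambda K,k)=\frac{1-\alpha}{2}$. Then $$\operatorname{cap}(C_{\alpha,\beta})\leq\frac{1}{2}\,\operatorname{dn}^2(\lambda K,k)\,\exp\Bigl(2\bigl(E/K-{k'}^2\bigr)\,\log^2\frac{1+\operatorname{sn}(\lambda K,k)}{\operatorname{cn}(\lambda K,k)}\Bigr).$$ Moreover, equality is attained in the limiting case $\lambda\to0$: for fixed $k\in(0,1)$, with $\alpha=\alpha(k,\lambda)$ and $\beta=\beta(k,\lambda)$ the values corresponding to $(k,\lambda)$, both sides of the inequality have the same limit as $\lambda\to0^+$.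
   Context: For a compact set $C\subset\mathbb{C}$, let $L_n(C):=\inf_{p\in\mathbb{P}_{n-1}}\sup_{z\in C}|z^n-p(z)|$, where $\mathbb{P}_{n-1}$ is the set of polynomials of degree at most $n-1$; the logarithmic capacity is $\operatorname{cap}(C):=\lim_{n\to\infty}\sqrt[n]{L_n(C)}$. $K(k)=\int_0^{\pi/2}\frac{d\theta}{\sqrt{1-k^2\sin^2\theta}}$ and $E(k)=\int_0^{\pi/2}\sqrt{1-k^2\sin^2\theta}\,d\theta$ are the complete elliptic integrals of the first and second kind with modulus $k$, and $\operatorname{sn}(u,k),\operatorname{cn}(u,k),\operatorname{dn}(u,k)$ are Jacobi's elliptic functions with modulus $k$. $\log^2 x$ means $(\log x)^2$. The two defining relations give a one-to-one correspondence between pairs $(\alpha,\beta)$ with $-1<\alpha<\beta<1$ and pairs $(k,\lambda)\in(0,1)^2$, with inverse $\alpha(k,\lambda)=1-2\operatorname{sn}^2(\lambda K,k)$ and $\beta(k,\lambda)=\frac{2\operatorname{cn}^2(\lambda K,k)}{\operatorname{dn}^2(\lambda K,k)}-1$. *)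

theory Defs
  imports "HOL-Analysis.Analysis" "HOL-Computational_Algebra.Polynomial"
begin

text \<open>
  The minimum over all monic complex polynomials of degree \<open>n\<close> of the sup norm on \<open>C\<close>.
  For compact nonempty \<open>C\<close> and \<open>n \<ge> 1\<close> the infimum and supremum are over nonempty sets that
  are bounded below and above, respectively; the value at \<open>n = 0\<close> is unspecified and does not
  affect the capacity.
\<close>

definition min_dev :: "nat \<Rightarrow> complex set \<Rightarrow> real" where
  "min_dev n C =
     (INF p\<in>{p :: complex poly. degree p < n}. SUP z\<in>C. norm (z ^ n - poly p z))"

definition log_cap :: "complex set \<Rightarrow> real" where
  "log_cap C = lim (\<lambda>n. root n (min_dev n C))"

definition two_intervals :: "real \<Rightarrow> real \<Rightarrow> complex set" where
  "two_intervals \<alpha> \<beta> = complex_of_real ` ({-1..\<alpha>} \<union> {\<beta>..1})"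

definition ellK :: "real \<Rightarrow> real" where
  "ellK k = integral {0..pi/2} (\<lambda>\<theta>. 1 / sqrt (1 - k\<^sup>2 * (sin \<theta>)\<^sup>2))"

definition ellE :: "real \<Rightarrow> real" where
  "ellE k = integral {0..pi/2} (\<lambda>\<theta>. sqrt (1 - k\<^sup>2 * (sin \<theta>)\<^sup>2))"

text \<open>
  The case distinction gives the oriented integral from \<open>0\<close> to \<open>\<phi>\<close>. For \<open>0 < k < 1\<close> it is a
  strictly increasing bijection of the real line, whose inverse is the amplitude. The Jacobi
  functions are needed for real arguments and moduli in \<open>(0,1)\<close> only; there \<open>dn\<close> is positive,
  so the positive square root is the correct branch.
\<close>

definition ellF :: "real \<Rightarrow> real \<Rightarrow> real" where
  "ellF \<phi> k =
     (if 0 \<le> \<phi> then integral {0..\<phi>} (\<lambda>\<theta>. 1 / sqrt (1 - k\<^sup>2 * (sin \<theta>)\<^sup>2))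
      else - integral {\<phi>..0} (\<lambda>\<theta>. 1 / sqrt (1 - k\<^sup>2 * (sin \<theta>)\<^sup>2)))"

definition jacobi_am :: "real \<Rightarrow> real \<Rightarrow> real" where
  "jacobi_am u k = (THE \<phi>. ellF \<phi> k = u)"

definition jacobi_sn :: "real \<Rightarrow> real \<Rightarrow> real" where
  "jacobi_sn u k = sin (jacobi_am u k)"

definition jacobi_cn :: "real \<Rightarrow> real \<Rightarrow> real" where
  "jacobi_cn u k = cos (jacobi_am u k)"

definition jacobi_dn :: "real \<Rightarrow> real \<Rightarrow> real" where
  "jacobi_dn u k = sqrt (1 - k\<^sup>2 * (jacobi_sn u k)\<^sup>2)"

text \<open>
  The endpoints in terms of the parameters: solving \<open>sn\<^sup>2(\<lambda>K,k) = (1 - \<alpha>)/2\<close> and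
  \<open>k\<^sup>2 = 2(\<beta> - \<alpha>)/((1 - \<alpha>)(1 + \<beta>))\<close> for \<open>\<alpha>\<close> and \<open>\<beta>\<close>.
\<close>

definition alpha_of :: "real \<Rightarrow> real \<Rightarrow> real" where
  "alpha_of k l = 1 - 2 * (jacobi_sn (l * ellK k) k)\<^sup>2"

definition beta_of :: "real \<Rightarrow> real \<Rightarrow> real" where
  "beta_of k l = 2 * (jacobi_cn (l * ellK k) k)\<^sup>2 / (jacobi_dn (l * ellK k) k)\<^sup>2 - 1"

definition cap_bound :: "real \<Rightarrow> real \<Rightarrow> real" where
  "cap_bound k l =
     (let K = ellK k; E = ellE k; k' = sqrt (1 - k\<^sup>2)
      in 1 / 2 * (jacobi_dn (l * K) k)\<^sup>2 *
         exp (2 * (E / K - k'\<^sup>2) *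
              (ln ((1 + jacobi_sn (l * K) k) / jacobi_cn (l * K) k))\<^sup>2))"

end

theory Submission
  imports Defs
begin

text \<open>
  The capacity of \<open>C = [-1,\<alpha>] \<union> [\<beta>,1]\<close> is bounded from above by the maximum over \<open>C\<close> of the
  logarithmic potential of any probability measure. For \<open>\<alpha> \<le> c \<le> \<beta>\<close> take the two-point law of mean
  \<open>c\<close> on \<open>{t, s}\<close> and average it over \<open>t\<close> and \<open>s\<close>, independent and with arcsine distributions on
  \<open>[-1,\<alpha>]\<close> and \<open>[\<beta>,1]\<close>. Because
  \<open>((c - t) / (z - t) + (s - c) / (z - s)) / (s - t) = (z - c) / ((z - t) (z - s))\<close>,
  the complex force of this measure is \<open>(z - c) / sqrt ((z + 1) (z - \<alpha>) (z - \<beta>) (z - 1))\<close>. Its real part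
  vanishes on \<open>C\<close>, and \<open>c\<close> is chosen such that its integral over the gap vanishes; so the potential is constant
  on \<open>C\<close>, and the constant is found by integrating the force from \<open>-\<infinity>\<close> to \<open>-1\<close>.

  With \<open>\<alpha> = 1 - 2 sin\<^sup>2 \<phi>\<close>, \<open>\<phi>\<close> the amplitude of \<open>u = \<lambda>K\<close>, trigonometric substitutions turn these
  integrals into elliptic ones, and the constant becomes
  \<open>ln (1/2) - 2 u (E(u) - u E / K) + Q(\<phi>)\<close> where \<open>Q\<close> is elementary to differentiate in \<open>\<phi>\<close>.
  The bound follows from \<open>Q(\<phi>) \<le> 2 u E(u) + 2 ln dn(u) - 2 k'\<^sup>2 u\<^sup>2\<close>,
  \<open>u \<le> ln ((1 + sn u) / cn u)\<close> and \<open>k'\<^sup>2 K \<le> E\<close>. As \<open>\<lambda> \<rightarrow> 0\<close>, the capacity of \<open>[-1,\<alpha>]\<close>,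
  which is at least \<open>(1 + \<alpha>) / 4\<close>, gives the matching lower bound \<open>1/2\<close>.
\<close>

section \<open>Capacity as a limit\<close>

text \<open>The potential must be bounded on all of \<open>C\<close> at once, while dominated
  convergence gives no uniformity. Hence limits are taken for the force, the derivative of the
  potential along the real line: convergence of the forces in L1 implies uniform convergence of the
  potentials. The lost constant of integration is restored at \<open>-Z\<close>, where the potential
  of a measure on [-1,1] is at most ln (Z + 1). This is sharp only for Z to infinity, so the
  divergence of ln (Z + 1) has to cancel exactly against the integral of the force.

  Two limits are kept apart. Finitely many atoms give a force with nonintegrable poles on the real
  line, so the number of atoms goes to infinity at a fixed height \<epsilon> > 0, where everything
  is bounded. Only afterwards does \<epsilon> tend to 0, when just inverse square roots remain.

  The elliptic side stays real: incomplete integrals are functions of the amplitude \<phi>, and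
  identities between them, including the interchange of argument and parameter, are verified by
  differentiation in \<phi>.\<close>

lemma subadditive_limit:
  fixes a :: "nat \<Rightarrow> real"
  assumes sub: "\<And>m n. m \<ge> 1 \<Longrightarrow> n \<ge> 1 \<Longrightarrow> a (m + n) \<le> a m + a n"
    and low: "\<And>n. n \<ge> 1 \<Longrightarrow> L * real n \<le> a n"
  obtains l where "(\<lambda>n. a n / real n) \<longlonglongrightarrow> l" "\<And>m. m \<ge> 1 \<Longrightarrow> l \<le> a m / real m" "L \<le> l"
proof -
  define l where "l = (INF m\<in>{1..}. a m / real m)"
  have low': "L \<le> a n / real n" if "n \<ge> 1" for n
    using low[OF that] that by (simp add: field_simps)
  have bdd: "bdd_below ((\<lambda>m. a m / real m) ` {1..})"
    using low' by (intro bdd_belowI[where m = L]) auto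
  have l_le: "l \<le> a m / real m" if "m \<ge> 1" for m
    unfolding l_def using that by (intro cINF_lower bdd) auto
  have "L \<le> l"
    unfolding l_def using low' by (intro cINF_greatest) auto
  have mult: "a (q * m + r) \<le> real q * a m + a r" if "m \<ge> 1" "r \<ge> 1" for q m r
  proof (induction q)
    case (Suc q)
    have "a (Suc q * m + r) = a (m + (q * m + r))" by (simp add: add_ac)
    also have "\<dots> \<le> a m + a (q * m + r)" using that by (intro sub) auto
    finally show ?case using Suc by (simp add: algebra_simps)
  qed auto
  have "(\<lambda>n. a n / real n) \<longlonglongrightarrow> l"
  proof (rule LIMSEQ_I)
    fix e :: real assume "e > 0"
    have "\<exists>m\<in>{1..}. a m / real m < l + e / 2"
      using cINF_less_iff[OF _ bdd, of "l + e/2"] \<open>e > 0\<close> by (auto simp: l_def)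
    then obtain m where m: "m \<ge> 1" "a m / real m < l + e / 2" by auto
    \<comment> \<open>An error bound independent of \<open>n\<close>: the sum covers
      \<open>a r\<close>, and the extra \<open>\<bar>a m\<bar>\<close> covers the replacement of
      \<open>q\<close> by \<open>n / m\<close>, which differ by
      \<open>r / m \<le> 1\<close>.\<close>
    define M where "M = (\<Sum>r\<in>{1..m}. \<bar>a r\<bar>) + \<bar>a m\<bar>"
    have bound: "a n / real n \<le> a m / real m + M / real n" if "n \<ge> 1" for n
    proof -
      \<comment> \<open>Division of \<open>n - 1\<close> instead of \<open>n\<close> puts the
        remainder \<open>r\<close> into \<open>{1..m}\<close>, so that \<open>a 0\<close>, about
        which nothing is assumed, never occurs.\<close>
      define q where "q = (n - 1) div m"
      define r where "r = (n - 1) mod m + 1"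
      have n: "n = q * m + r"
        using div_mult_mod_eq[of "n - 1" m] that unfolding q_def r_def by linarith
      have r: "r \<ge> 1" "r \<le> m"
        using m(1) mod_less_divisor[of m "n - 1"] by (auto simp: r_def Suc_le_eq)
      have "\<bar>a r\<bar> \<le> (\<Sum>r\<in>{1..m}. \<bar>a r\<bar>)" using r by (intro member_le_sum) auto
      moreover have "a n \<le> real q * a m + a r" unfolding n using m r by (intro mult) auto
      moreover have "real q * a m \<le> real n * (a m / real m) + \<bar>a m\<bar>"
      proof -
        have "real q * a m = (real n - real r) * (a m / real m)"
          using m by (simp add: n field_simps)
        then have "real q * a m = real n * (a m / real m) - real r / real m * a m"
          by (simp add: left_diff_distrib diff_divide_distrib)
        moreover have "\<bar>real r / real m * a m\<bar> \<le> \<bar>a m\<bar>"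
          using r m(1) by (simp add: abs_mult field_simps mult_right_mono)
        ultimately show ?thesis by (smt (verit) abs_ge_minus_self)
      qed
      ultimately have "a n \<le> real n * (a m / real m) + M" by (simp add: M_def)
      then show ?thesis using that by (simp add: field_simps)
    qed
    obtain N where N: "real N > 2 * M / e" using reals_Archimedean2 by blast
    show "\<exists>no. \<forall>n\<ge>no. norm (a n / real n - l) < e"
    proof (intro exI allI impI)
      fix n assume n: "n \<ge> N + 1"
      then have "real n > 2 * M / e" using N by linarith
      then have "M / real n < e / 2" using \<open>e > 0\<close> n by (auto simp: field_simps)
      moreover have "l \<le> a n / real n" "a n / real n \<le> a m / real m + M / real n"
        using bound[of n] l_le[of n] n by auto
      ultimately show "norm (a n / real n - l) < e" using m unfolding real_norm_def by linarith
    qed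
  qed
  then show ?thesis using l_le \<open>L \<le> l\<close> that by blast
qed

section \<open>Means over roots of unity and Chebyshev's lower bound on an interval\<close>

lemma sum_roots_of_unity_power:
  assumes "k < N"
  shows "(\<Sum>i<N. cis (2 * pi * real i / real N) ^ k) = (if k = 0 then of_nat N else 0)"
proof (cases "k = 0")
  case False
  define z where "z = cis (2 * pi * real k / real N)"
  have "z \<noteq> 1"
  proof
    assume "z = 1"
    then have "cis (2 * pi * real k / real N) = cis (2 * pi * real 0 / real N)" by (simp add: z_def)
    moreover have "inj_on (\<lambda>k. cis (2 * pi * real k / real N)) {..<N}"
      using Complex.bij_betw_roots_unity[of N] assms by (auto simp: bij_betw_def)
    ultimately have "k = 0" using assms inj_onD[of _ "{..<N}" k 0] by fastforce
    with False show False by simp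
  qed
  have "z ^ N = cis (real N * (2 * pi * real k / real N))" unfolding z_def by (rule Complex.DeMoivre)
  also have "real N * (2 * pi * real k / real N) = 2 * pi * real k" using assms by simp
  also have "cis (2 * pi * real k) = 1" by (intro cis_multiple_2pi) auto
  finally have "z ^ N = 1" .
  have "cis (2 * pi * real i / real N) ^ k = z ^ i" for i
    by (simp add: z_def Complex.DeMoivre mult_ac)
  then show ?thesis using \<open>z \<noteq> 1\<close> \<open>z ^ N = 1\<close> False by (simp add: sum_gp_strict)
qed auto

text \<open>A discrete mean value property: the powers from 1 to \<open>N - 1\<close> average to 0,
  so below degree \<open>N\<close> the mean is exactly the value at 0. It plays the part of Cauchy's
  formula in the bound that follows.\<close>

lemma sum_roots_of_unity_poly:
  assumes "degree R < N"
  shows "(\<Sum>i<N. poly R (cis (2 * pi * real i / real N))) = of_nat N * coeff R 0"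
proof -
  have "(\<Sum>i<N. poly R (cis (2 * pi * real i / real N)))
      = (\<Sum>k\<le>degree R. coeff R k * (\<Sum>i<N. cis (2 * pi * real i / real N) ^ k))"
    unfolding poly_altdef sum_distrib_left by (rule sum.swap)
  also have "\<dots> = (\<Sum>k\<le>degree R. if k = 0 then of_nat N * coeff R 0 else 0)"
    using assms by (intro sum.cong refl) (simp add: sum_roots_of_unity_power)
  finally show ?thesis by simp
qed

text \<open>With \<open>z = (a + b) / 2 + (b - a) / 4 * (w + 1 / w)\<close>, the function \<open>w ^ n * poly P z\<close> is a
  polynomial in \<open>w\<close> with value \<open>((b - a) / 4) ^ n\<close> at \<open>0\<close>; this is its mean over roots of unity.\<close>

lemma monic_lower_bound_interval:
  fixes P :: "complex poly"
  assumes "a < b" and monic: "lead_coeff P = 1"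
    and M: "\<And>x. x \<in> {a..b} \<Longrightarrow> norm (poly P (of_real x)) \<le> M"
  shows "((b - a) / 4) ^ degree P \<le> M"
proof -
  define n where "n = degree P"
  define m where "m = (a + b) / 2"
  define r where "r = (b - a) / 4"
  define N where "N = 2 * n + 1"
  define Q where "Q = pcompose P [:of_real m, of_real r:]"
  \<comment> \<open>The factor \<open>w ^ n\<close> is distributed over the powers by
    \<open>w^n (w + 1/w)^k = w^(n-k) (1 + w^2)^k\<close>. This makes \<open>R\<close> a polynomial,
    so it has a value at 0, to which only \<open>k = n\<close> contributes.\<close>
  define R where "R = (\<Sum>k\<le>n. smult (coeff Q k) (monom 1 (n - k) * [:1, 0, 1:] ^ k))"
  have r: "r > 0" using assms by (simp add: r_def)
  have degQ: "degree Q = n" using r by (simp add: Q_def n_def degree_pcompose)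
  have lcQ: "coeff Q n = of_real r ^ n"
  proof -
    have "lead_coeff Q = lead_coeff P * lead_coeff [:of_real m, of_real r:] ^ degree P"
      unfolding Q_def using r by (intro lead_coeff_comp) auto
    then show ?thesis using r monic by (simp add: degQ n_def)
  qed
  have "degree (smult (coeff Q k) (monom 1 (n - k) * [:1, 0, 1:] ^ k)) \<le> 2 * n" if "k \<le> n" for k
  proof -
    have "degree (smult (coeff Q k) (monom 1 (n - k) * [:1, 0, 1:] ^ k))
        \<le> degree (monom (1::complex) (n - k)) + degree ([:1, 0, 1 :: complex:] ^ k)"
      by (rule order.trans[OF degree_smult_le degree_mult_le])
    also have "\<dots> \<le> (n - k) + 2 * k"
      using degree_power_le[of "[:1, 0, 1 :: complex:]" k] by (simp add: degree_monom_eq)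
    finally show ?thesis using that by simp
  qed
  then have "degree R \<le> 2 * n"
    unfolding R_def by (intro degree_sum_le) auto
  then have degR: "degree R < N" by (simp add: N_def)
  have polyR: "poly R w = w ^ n * poly Q (w + 1 / w)" if "w \<noteq> 0" for w
  proof -
    have "w ^ (n - k) * (1 + w * w) ^ k = w ^ n * (w + 1 / w) ^ k" if "k \<le> n" for k
    proof -
      have "w ^ n * (w + 1 / w) ^ k = w ^ (n - k) * (w * (w + 1 / w)) ^ k"
        using that by (simp add: power_mult_distrib flip: power_add mult.assoc)
      also have "w * (w + 1 / w) = 1 + w * w" using \<open>w \<noteq> 0\<close> by (simp add: field_simps)
      finally show ?thesis by simp
    qed
    then show ?thesis
      unfolding R_def poly_altdef[of Q] degQ
      by (simp add: poly_sum poly_monom sum_distrib_left mult_ac)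
  qed
  have "coeff R 0 = poly R 0" by (simp add: poly_0_coeff_0)
  also have "\<dots> = (\<Sum>k\<le>n. if k = n then coeff Q n else 0)"
    unfolding R_def poly_sum by (intro sum.cong refl) (auto simp: poly_monom)
  finally have R0: "coeff R 0 = of_real r ^ n" by (simp add: lcQ)
  have bnd: "norm (poly R (cis \<theta>)) \<le> M" for \<theta>
  proof -
    have "cis \<theta> + 1 / cis \<theta> = of_real (2 * cos \<theta>)"
      by (simp add: complex_eq_iff inverse_eq_divide[symmetric])
    then have "poly R (cis \<theta>) = cis \<theta> ^ n * poly P (of_real (m + r * (2 * cos \<theta>)))"
      by (simp add: polyR Q_def poly_pcompose mult_ac)
    moreover have "m + r * (2 * cos \<theta>) \<in> {a..b}"
    proof -
      have "\<bar>r * (2 * cos \<theta>)\<bar> \<le> r * 2 * 1"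
        using r abs_cos_le_one[of \<theta>] by (simp add: abs_mult)
      then show ?thesis by (auto simp: m_def r_def abs_le_iff field_simps)
    qed
    ultimately show ?thesis using M[of "m + r * (2 * cos \<theta>)"] by (simp add: norm_mult norm_power)
  qed
  have "real N * r ^ n = norm (\<Sum>i<N. poly R (cis (2 * pi * real i / real N)))"
    using sum_roots_of_unity_poly[OF degR] R0 r by (simp add: norm_mult norm_power)
  also have "\<dots> \<le> real N * M"
    using sum_norm_bound[of "{..<N}", OF bnd] by simp
  finally show ?thesis by (simp add: N_def n_def r_def)
qed

section \<open>Monic polynomials, submultiplicativity and existence of the limit\<close>

lemma min_dev_le:
  fixes P :: "complex poly"
  assumes C: "compact C" "C \<noteq> {}" and P: "lead_coeff P = 1" "degree P \<ge> 1"
    and M: "\<And>z. z \<in> C \<Longrightarrow> norm (poly P z) \<le> M"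
  shows "min_dev (degree P) C \<le> M"
proof -
  define n where "n = degree P"
  \<comment> \<open>The definition subtracts a polynomial of smaller degree from
    \<open>z ^ n\<close>; monic polynomials are used instead because they are closed under
    products.\<close>
  define p where "p = monom 1 n - P"
  have bdd: "bdd_above ((\<lambda>z. norm (z ^ n - poly q z)) ` C)" for q
    by (intro compact_imp_bounded[THEN bounded_imp_bdd_above] compact_continuous_image C)
       (intro continuous_intros)
  have "degree p < n"
  proof -
    have "degree p \<le> n" unfolding p_def
      by (intro degree_diff_le) (auto simp: n_def degree_monom_le)
    moreover have "coeff p n = 0" using P by (simp add: p_def n_def)
    ultimately show ?thesis using P unfolding n_def
      by (metis degree_0 leading_coeff_0_iff nat_less_le not_one_le_zero)
  qed
  moreover have "bdd_below ((\<lambda>p. SUP z\<in>C. norm (z ^ n - poly p z)) ` {p. degree p < n})"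
  proof (rule bdd_belowI2)
    fix q :: "complex poly"
    from C obtain z where "z \<in> C" by auto
    then show "0 \<le> (SUP z\<in>C. norm (z ^ n - poly q z))"
      by (intro cSUP_upper2[OF bdd]) auto
  qed
  moreover have "(SUP z\<in>C. norm (z ^ n - poly p z)) \<le> M"
    using C M by (intro cSUP_least) (auto simp: p_def poly_monom)
  ultimately show ?thesis
    unfolding min_dev_def n_def[symmetric] by (intro cINF_lower2[where x = p]) auto
qed

text \<open>No minimizer is constructed; every bound strictly above the infimum is realized by some
  monic polynomial, and the slack is removed at each use.\<close>

lemma min_dev_approx:
  assumes C: "compact C" "C \<noteq> {}" and "n \<ge> 1" "min_dev n C < M"
  obtains P :: "complex poly" where "lead_coeff P = 1" "degree P = n"
    "\<And>z. z \<in> C \<Longrightarrow> norm (poly P z) \<le> M"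
proof -
  have bdd: "bdd_above ((\<lambda>z. norm (z ^ n - poly q z)) ` C)" for q
    by (intro compact_imp_bounded[THEN bounded_imp_bdd_above] compact_continuous_image C)
       (intro continuous_intros)
  have "bdd_below ((\<lambda>p. SUP z\<in>C. norm (z ^ n - poly p z)) ` {p. degree p < n})"
  proof (rule bdd_belowI2)
    fix q :: "complex poly"
    from C obtain z where "z \<in> C" by auto
    then show "0 \<le> (SUP z\<in>C. norm (z ^ n - poly q z))"
      by (intro cSUP_upper2[OF bdd]) auto
  qed
  moreover have "{p :: complex poly. degree p < n} \<noteq> {}" using \<open>n \<ge> 1\<close> by (auto intro: exI[of _ 0])
  ultimately obtain p where p: "degree p < n" "(SUP z\<in>C. norm (z ^ n - poly p z)) < M"
    using assms cINF_less_iff unfolding min_dev_def by (smt (verit) mem_Collect_eq)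
  have "degree (monom 1 n - p) = n"
    using p degree_add_eq_left[of "- p" "monom 1 n"] by (simp add: degree_monom_eq)
  moreover from this have "lead_coeff (monom 1 n - p) = 1" using p by (simp add: coeff_eq_0)
  moreover have "norm (poly (monom 1 n - p) z) \<le> M" if "z \<in> C" for z
    using cSUP_upper[OF that bdd, of p] p by (simp add: poly_monom)
  ultimately show ?thesis using that by blast
qed

text \<open>The product of two nearly optimal monic polynomials competes in degree
  \<open>m + n\<close>; the slack \<open>e\<close> tends to 0 at the end. Nonnegativity of the two
  values lets the bounds be multiplied.\<close>

lemma min_dev_submult:
  assumes C: "compact C" "C \<noteq> {}" and "m \<ge> 1" "n \<ge> 1" and nn: "min_dev m C \<ge> 0" "min_dev n C \<ge> 0"
  shows "min_dev (m + n) C \<le> min_dev m C * min_dev n C"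
proof -
  have "min_dev (m + n) C \<le> (min_dev m C + e) * (min_dev n C + e)" if e: "e > 0" for e
  proof -
    obtain P where P: "lead_coeff P = 1" "degree P = m"
      "\<And>z. z \<in> C \<Longrightarrow> norm (poly P z) \<le> min_dev m C + e"
      using min_dev_approx[OF C \<open>m \<ge> 1\<close>, of "min_dev m C + e"] e by (metis less_add_same_cancel1)
    obtain Q where Q: "lead_coeff Q = 1" "degree Q = n"
      "\<And>z. z \<in> C \<Longrightarrow> norm (poly Q z) \<le> min_dev n C + e"
      using min_dev_approx[OF C \<open>n \<ge> 1\<close>, of "min_dev n C + e"] e by (metis less_add_same_cancel1)
    have deg: "degree (P * Q) = m + n" using P Q by (subst degree_mult_eq) auto
    have lc: "lead_coeff (P * Q) = 1" using P(1) Q(1) by (simp add: lead_coeff_mult)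
    have "min_dev (degree (P * Q)) C \<le> (min_dev m C + e) * (min_dev n C + e)"
      using P Q nn that lc \<open>m \<ge> 1\<close> by (intro min_dev_le C) (auto simp: norm_mult deg intro!: mult_mono)
    then show ?thesis by (simp add: deg)
  qed
  moreover have "((\<lambda>e. (min_dev m C + e) * (min_dev n C + e)) \<longlongrightarrow> (min_dev m C + 0) * (min_dev n C + 0)) (at_right 0)"
    by (intro tendsto_intros)
  ultimately have "min_dev (m + n) C \<le> (min_dev m C + 0) * (min_dev n C + 0)"
    by (intro tendsto_lowerbound) (auto simp: eventually_at_filter)
  then show ?thesis by simp
qed

lemma min_dev_ge_interval:
  assumes C: "compact C" and ab: "a < b" "complex_of_real ` {a..b} \<subseteq> C" and "n \<ge> 1"
  shows "((b - a) / 4) ^ n \<le> min_dev n C"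
proof (rule dense_ge)
  fix M assume "min_dev n C < M"
  moreover have "C \<noteq> {}" using ab by auto
  ultimately obtain P :: "complex poly" where P: "lead_coeff P = 1" "degree P = n"
    "\<And>z. z \<in> C \<Longrightarrow> norm (poly P z) \<le> M"
    using min_dev_approx[OF C _ \<open>n \<ge> 1\<close>] by blast
  then show "((b - a) / 4) ^ n \<le> M"
    using monic_lower_bound_interval[OF \<open>a < b\<close> P(1), of M] ab by (auto simp: image_subset_iff)
qed

text \<open>Fekete's lemma for \<open>ln (min_dev n C)\<close>: the limit behind
  \<open>log_cap\<close> exists and lies below every term, which is the power bound. The interval
  inside \<open>C\<close> keeps \<open>min_dev\<close> positive, so that its logarithm is
  subadditive, and bounds the limit from below.\<close>

lemma
  assumes C: "compact C" and ab: "a < b" "complex_of_real ` {a..b} \<subseteq> C"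
  shows log_cap_ge_interval: "(b - a) / 4 \<le> log_cap C"
    and log_cap_power_le: "n \<ge> 1 \<Longrightarrow> log_cap C ^ n \<le> min_dev n C"
proof -
  have ne: "C \<noteq> {}" using ab by auto
  have pos: "min_dev n C > 0" if "n \<ge> 1" for n
    using min_dev_ge_interval[OF assms that] ab(1) by (auto intro: less_le_trans[rotated])
  have "ln (min_dev (m + n) C) \<le> ln (min_dev m C) + ln (min_dev n C)" if "m \<ge> 1" "n \<ge> 1" for m n
    using min_dev_submult[OF C ne that] pos[of m] pos[of n] pos[of "m + n"] that
    by (simp add: ln_mult_pos[symmetric])
  moreover have "ln ((b - a) / 4) * real n \<le> ln (min_dev n C)" if "n \<ge> 1" for n
  proof -
    have "ln (((b - a) / 4) ^ n) \<le> ln (min_dev n C)"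
      using min_dev_ge_interval[OF assms that] pos[OF that] ab(1) by (intro ln_mono) auto
    then show ?thesis using ab(1) by (simp add: ln_realpow mult.commute)
  qed
  ultimately obtain l where l: "(\<lambda>n. ln (min_dev n C) / real n) \<longlonglongrightarrow> l"
    "\<And>m. m \<ge> 1 \<Longrightarrow> l \<le> ln (min_dev m C) / real m" "ln ((b - a) / 4) \<le> l"
    using subadditive_limit[of "\<lambda>n. ln (min_dev n C)"] by blast
  have "(\<lambda>n. exp (ln (min_dev n C) / real n)) \<longlonglongrightarrow> exp l"
    by (intro tendsto_intros l)
  moreover have "\<forall>\<^sub>F n in sequentially. exp (ln (min_dev n C) / real n) = root n (min_dev n C)"
    using eventually_ge_at_top[of "1::nat"]
  proof eventually_elim
    case (elim n)
    then show ?case using root_powr_inverse[of n "min_dev n C"] pos[of n]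
      by (simp add: powr_def field_simps)
  qed
  ultimately have "(\<lambda>n. root n (min_dev n C)) \<longlonglongrightarrow> exp l"
    by (blast intro: Lim_transform_eventually)
  then have cap: "log_cap C = exp l" by (simp add: log_cap_def limI)
  show "(b - a) / 4 \<le> log_cap C"
    using l(3) ab(1) unfolding cap by (metis exp_le_cancel_iff exp_ln diff_gt_0_iff_gt divide_pos_pos zero_less_numeral)
  show "log_cap C ^ n \<le> min_dev n C" if "n \<ge> 1"
  proof -
    have "log_cap C ^ n = exp (real n * l)" by (simp add: cap exp_of_nat_mult)
    also have "\<dots> \<le> exp (ln (min_dev n C))"
      using l(2)[OF that] that by (simp add: field_simps)
    finally show ?thesis using pos[OF that] by simp
  qed
qed

text \<open>Evaluating the potential at height \<open>\<epsilon>\<close> above the real line only increases it, and removes the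
  logarithmic singularities.\<close>

lemma ln_log_cap_le_discrete_potential:
  fixes w t :: "'i \<Rightarrow> real"
  assumes C: "compact C" and ab: "a < b" "complex_of_real ` {a..b} \<subseteq> C" and CS: "C = complex_of_real ` S"
    and J: "finite J" "\<And>j. j \<in> J \<Longrightarrow> w j \<ge> 0" "sum w J = 1" and "\<epsilon> > 0"
    and B: "\<And>x. x \<in> S \<Longrightarrow> (\<Sum>j\<in>J. w j * ln (cmod (Complex (x - t j) \<epsilon>))) \<le> B"
  shows "ln (log_cap C) \<le> B"
proof -
  define lc where "lc = ln (log_cap C)"
  have cap_pos: "log_cap C > 0" using log_cap_ge_interval[OF C ab] ab(1) by (auto intro: less_le_trans[rotated])
  have ne: "C \<noteq> {}" using ab by auto
  have mod_ge: "\<epsilon> \<le> cmod (Complex y \<epsilon>)" for y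
    using abs_Im_le_cmod[of "Complex y \<epsilon>"] \<open>\<epsilon> > 0\<close> by simp
  \<comment> \<open>Rounding errors that do not grow with \<open>n\<close>; this is why
    \<open>n * (lc - B) \<le> D\<close> for all large \<open>n\<close> forces
    \<open>lc \<le> B\<close>.\<close>
  define D where "D = real (card J) * \<bar>ln \<epsilon>\<bar> + real (card J) * \<bar>lc\<bar>"
  have key: "real n * (lc - B) \<le> D" if n: "n \<ge> card J + 1" for n
  proof -
    \<comment> \<open>Multiplicity of the root \<open>t j\<close>: the share \<open>n * w j\<close>
      rounded down. The degree then falls short of \<open>n\<close> by at most
      \<open>card J\<close>, and \<open>n \<ge> card J + 1\<close> keeps it positive.\<close>
    define m where "m j = nat \<lfloor>real n * w j\<rfloor>" for j
    define P where "P = (\<Prod>j\<in>J. [:- of_real (t j), 1 :: complex:] ^ m j)"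
    have m: "real (m j) \<le> real n * w j" "real n * w j - 1 \<le> real (m j)" if "j \<in> J" for j
      using J(2)[OF that] by (auto simp: m_def of_nat_nat)
    have degP: "degree P = sum m J"
      unfolding P_def by (subst degree_prod_eq_sum_degree) (auto simp: degree_power_eq)
    have lcP: "lead_coeff P = 1" unfolding P_def by (simp add: lead_coeff_prod lead_coeff_power)
    have sum_m: "real (sum m J) \<le> real n" "real n - real (card J) \<le> real (sum m J)"
    proof -
      have "(\<Sum>j\<in>J. real (m j)) \<le> (\<Sum>j\<in>J. real n * w j)" by (intro sum_mono m)
      then show "real (sum m J) \<le> real n" using J by (simp add: sum_distrib_left[symmetric])
      have "(\<Sum>j\<in>J. real n * w j - 1) \<le> (\<Sum>j\<in>J. real (m j))" by (intro sum_mono m)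
      then show "real n - real (card J) \<le> real (sum m J)"
        using J by (simp add: sum_subtractf sum_distrib_left[symmetric])
    qed
    have "norm (poly P z) \<le> exp (real n * B + real (card J) * \<bar>ln \<epsilon>\<bar>)" if z: "z \<in> C" for z
    proof -
      obtain x where x: "x \<in> S" "z = of_real x" using z CS by blast
      let ?L = "\<lambda>j. ln (cmod (Complex (x - t j) \<epsilon>))"
      have pos: "cmod (Complex y \<epsilon>) > 0" for y using mod_ge[of y] \<open>\<epsilon> > 0\<close> by linarith
      have "norm (poly P z) = (\<Prod>j\<in>J. \<bar>x - t j\<bar> ^ m j)"
        by (simp add: P_def poly_prod prod_norm[symmetric] norm_power x flip: of_real_diff)
      also have "\<dots> \<le> (\<Prod>j\<in>J. cmod (Complex (x - t j) \<epsilon>) ^ m j)"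
        using abs_Re_le_cmod[of "Complex _ \<epsilon>"] by (intro prod_mono conjI power_mono) auto
      also have "\<dots> = (\<Prod>j\<in>J. exp (real (m j) * ?L j))"
        using pos by (intro prod.cong refl) (simp add: exp_of_nat_mult)
      also have "\<dots> = exp (\<Sum>j\<in>J. real (m j) * ?L j)" using J by (simp add: exp_sum)
      also have "(\<Sum>j\<in>J. real (m j) * ?L j) \<le> (\<Sum>j\<in>J. real n * (w j * ?L j) + \<bar>ln \<epsilon>\<bar>)"
      proof (intro sum_mono)
        fix j assume j: "j \<in> J"
        \<comment> \<open>Rounding down discards factors that may be smaller than 1. At height
          \<epsilon> no factor is smaller than \<epsilon>, so each \<open>j\<close> loses at most
          \<open>\<bar>ln \<epsilon>\<bar>\<close>.\<close>
        have "- \<bar>ln \<epsilon>\<bar> \<le> ?L j" using mod_ge[of "x - t j"] pos[of "x - t j"] \<open>\<epsilon> > 0\<close>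
          by (smt (verit) ln_mono)
        then have "(real n * w j - real (m j)) * (- \<bar>ln \<epsilon>\<bar>) \<le> (real n * w j - real (m j)) * ?L j"
          using m(1)[OF j] by (intro mult_left_mono) auto
        moreover have "(real n * w j - real (m j)) * \<bar>ln \<epsilon>\<bar> \<le> 1 * \<bar>ln \<epsilon>\<bar>"
          using m(2)[OF j] by (intro mult_right_mono) auto
        ultimately show "real (m j) * ?L j \<le> real n * (w j * ?L j) + \<bar>ln \<epsilon>\<bar>"
          by (simp add: algebra_simps)
      qed
      also have "\<dots> = real n * (\<Sum>j\<in>J. w j * ?L j) + real (card J) * \<bar>ln \<epsilon>\<bar>"
        by (simp add: sum.distrib sum_distrib_left)
      also have "\<dots> \<le> real n * B + real (card J) * \<bar>ln \<epsilon>\<bar>"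
        using B[OF x(1)] by (simp add: mult_left_mono)
      finally show ?thesis by simp
    qed
    moreover have deg1: "degree P \<ge> 1" using sum_m n unfolding degP by linarith
    ultimately have "min_dev (degree P) C \<le> exp (real n * B + real (card J) * \<bar>ln \<epsilon>\<bar>)"
      by (intro min_dev_le C ne lcP) auto
    then have "log_cap C ^ degree P \<le> exp (real n * B + real (card J) * \<bar>ln \<epsilon>\<bar>)"
      using log_cap_power_le[OF C ab deg1] by linarith
    moreover have "log_cap C ^ degree P = exp (real (degree P) * lc)"
      using cap_pos by (simp add: lc_def exp_of_nat_mult)
    ultimately have "real (degree P) * lc \<le> real n * B + real (card J) * \<bar>ln \<epsilon>\<bar>" by simp
    moreover have "(real n - real (degree P)) * lc \<le> real (card J) * \<bar>lc\<bar>"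
    proof -
      have "(real n - real (degree P)) * lc \<le> (real n - real (degree P)) * \<bar>lc\<bar>"
        using sum_m unfolding degP by (intro mult_left_mono) auto
      also have "\<dots> \<le> real (card J) * \<bar>lc\<bar>"
        using sum_m unfolding degP by (intro mult_right_mono) auto
      finally show ?thesis .
    qed
    ultimately show ?thesis by (simp add: D_def algebra_simps)
  qed
  show ?thesis
  proof (rule ccontr)
    assume "\<not> ?thesis"
    then have "lc - B > 0" by (simp add: lc_def)
    then obtain k :: nat where "D < real k * (lc - B)" using reals_Archimedean3 by blast
    also have "\<dots> \<le> real (k + card J + 1) * (lc - B)" using \<open>lc - B > 0\<close> by (intro mult_right_mono) auto
    finally show False using key[of "k + card J + 1"] by simp
  qed
qed

section \<open>The test measure\<close>

text \<open>The geometric series folded modulo \<open>N\<close>: as the \<open>N\<close>-th power of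
  a root of unity is 1, each term is a sum over \<open>k < N\<close> divided by
  \<open>1 - y ^ N\<close>, and summation over the roots leaves only \<open>k = 0\<close>.\<close>

lemma sum_inverse_roots_of_unity:
  fixes y :: complex
  assumes "norm y < 1" "N > 0"
  shows "(\<Sum>i<N. 1 / (1 - y * cis (2 * pi * real i / real N))) = of_nat N / (1 - y ^ N)"
proof -
  let ?c = "\<lambda>i. cis (2 * pi * real i / real N)"
  have "norm (y ^ N) < 1" using assms by (simp add: norm_power power_less_one_iff)
  then have yN: "y ^ N \<noteq> 1" by auto
  have "1 / (1 - y * ?c i) = (\<Sum>k<N. y ^ k * ?c i ^ k) / (1 - y ^ N)" for i
  proof -
    have "norm (y * ?c i) < 1" using assms by (simp add: norm_mult)
    then have ne: "y * ?c i \<noteq> 1" by auto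
    have "?c i ^ N = cis (real N * (2 * pi * real i / real N))" by (rule Complex.DeMoivre)
    also have "real N * (2 * pi * real i / real N) = 2 * pi * real i" using assms by simp
    also have "cis (2 * pi * real i) = 1" by (intro cis_multiple_2pi) auto
    finally have "(y * ?c i) ^ N = y ^ N" by (simp add: power_mult_distrib)
    then have "(\<Sum>k<N. (y * ?c i) ^ k) = (1 - y ^ N) / (1 - y * ?c i)"
      using ne by (simp add: sum_gp_strict)
    then show ?thesis using ne yN by (simp add: power_mult_distrib)
  qed
  then have "(\<Sum>i<N. 1 / (1 - y * ?c i)) = (\<Sum>i<N. \<Sum>k<N. y ^ k * ?c i ^ k) / (1 - y ^ N)"
    by (simp add: sum_divide_distrib)
  also have "(\<Sum>i<N. \<Sum>k<N. y ^ k * ?c i ^ k) = (\<Sum>k<N. y ^ k * (\<Sum>i<N. ?c i ^ k))"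
    unfolding sum_distrib_left by (rule sum.swap)
  also have "\<dots> = (\<Sum>k<N. if k = 0 then of_nat N else 0)"
    by (intro sum.cong refl) (simp add: sum_roots_of_unity_power)
  also have "\<dots> = of_nat N" using assms by simp
  finally show ?thesis .
qed

text \<open>Projections of the \<open>N\<close>-th roots of unity to \<open>[a,b]\<close>. With
  equal weights \<open>1 / N\<close> they approximate the arcsine distribution; coinciding nodes
  simply add their weights.\<close>

definition cheb_node :: "real \<Rightarrow> real \<Rightarrow> nat \<Rightarrow> nat \<Rightarrow> real" where
  "cheb_node a b N i = (a + b) / 2 + (b - a) / 2 * cos (2 * pi * real i / real N)"

text \<open>Cauchy transform of the uniform distribution on the nodes, that is, the complex force it
  exerts.\<close>

definition cheb_mean :: "real \<Rightarrow> real \<Rightarrow> nat \<Rightarrow> complex \<Rightarrow> complex" where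
  "cheb_mean a b N z = (\<Sum>i<N. 1 / (z - of_real (cheb_node a b N i))) / of_nat N"

lemma cheb_node_bounds:
  assumes "a \<le> b"
  shows "cheb_node a b N i \<in> {a..b}"
proof -
  have "\<bar>(b - a) / 2 * cos (2 * pi * real i / real N)\<bar> \<le> (b - a) / 2 * 1"
    unfolding abs_mult using assms by (intro mult_mono) auto
  then show ?thesis by (auto simp: cheb_node_def abs_le_iff field_simps)
qed

text \<open>Uniform in \<open>N\<close>, hence the source of a constant majorant for dominated
  convergence at a fixed height. For \<open>N = 0\<close> the mean is 0 by the convention on
  division.\<close>

lemma norm_cheb_mean_le:
  assumes "Im z > 0"
  shows "norm (cheb_mean a b N z) \<le> 1 / Im z"
proof (cases "N = 0")
  case False
  have "norm (1 / (z - of_real t)) \<le> 1 / Im z" for t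
    using abs_Im_le_cmod[of "z - of_real t"] assms by (simp add: norm_divide frac_le)
  then have "norm (\<Sum>i<N. 1 / (z - of_real (cheb_node a b N i))) \<le> real N * (1 / Im z)"
    using sum_norm_bound[of "{..<N}"] by (metis card_lessThan)
  then show ?thesis using False by (simp add: cheb_mean_def norm_divide field_simps)
qed (use assms in \<open>auto simp: cheb_mean_def\<close>)

lemma csqrt_upper_half_plane:
  assumes "Im z > 0"
  shows "Re (csqrt z) > 0" "Im (csqrt z) > 0"
proof -
  have "\<bar>Re z\<bar> < cmod z"
    by (rule power_less_imp_less_base[of _ 2]) (use assms in \<open>auto simp: cmod_power2\<close>)
  then show "Re (csqrt z) > 0" "Im (csqrt z) > 0" using assms by auto
qed

text \<open>The conformal map to the disc is \<open>y = (p - q) / (p + q)\<close> for \<open>p = csqrt (z - a)\<close> and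
  \<open>q = csqrt (z - b)\<close>; each summand is a Poisson kernel in \<open>y\<close>.\<close>

lemma cheb_mean_tendsto:
  assumes "a < b" "Im z > 0"
  shows "(\<lambda>N. cheb_mean a b N z) \<longlonglongrightarrow> 1 / (csqrt (z - of_real a) * csqrt (z - of_real b))"
proof -
  define p where "p = csqrt (z - of_real a)"
  define q where "q = csqrt (z - of_real b)"
  define y where "y = (p - q) / (p + q)"
  have pq: "Re p > 0" "Im p > 0" "Re q > 0" "Im q > 0"
    using csqrt_upper_half_plane[of "z - of_real a"] csqrt_upper_half_plane[of "z - of_real b"] assms
    by (auto simp: p_def q_def)
  have p2: "p\<^sup>2 = z - of_real a" and q2: "q\<^sup>2 = z - of_real b" by (auto simp: p_def q_def)
  have ne: "p + q \<noteq> 0" "p \<noteq> 0" "q \<noteq> 0" using pq by (auto simp: complex_eq_iff)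
  \<comment> \<open>Both roots lie in the open first quadrant, so \<open>Re (p * cnj q) > 0\<close>
    and \<open>p\<close> is closer to \<open>q\<close> than to \<open>- q\<close>.\<close>
  have "(norm (p - q))\<^sup>2 < (norm (p + q))\<^sup>2"
    unfolding cmod_power2 using pq by (simp add: power2_eq_square algebra_simps add_pos_pos)
  then have "norm (p - q) < norm (p + q)" by (rule power_less_imp_less_base) auto
  then have y: "norm y < 1" using ne by (simp add: y_def norm_divide)
  \<comment> \<open>The part with the conjugate root of unity is written as a conjugate, so that the
    root-of-unity sum applies to it as well, with \<open>cnj y\<close> for \<open>y\<close>.\<close>
  have kernel: "1 / (z - of_real (cheb_node a b N i)) =
      (1 / (1 - y * cis (2 * pi * real i / real N)) + cnj (1 / (1 - cnj y * cis (2 * pi * real i / real N))) - 1) / (p * q)"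
    (is "1 / (z - of_real ?t) = (1 / (1 - y * ?w) + _ - 1) / _") for N i
  proof -
    define C where "C = complex_of_real (cos (2 * pi * real i / real N))"
    have ww: "?w * cnj ?w = 1" by (metis cis_cnj cis_inverse cis_neq_zero right_inverse)
    have w2: "?w + cnj ?w = 2 * C" by (simp add: complex_eq_iff C_def)
    have n1: "1 - y * ?w \<noteq> 0" "1 - y * cnj ?w \<noteq> 0"
    proof -
      have "norm (y * ?w) < 1" "norm (y * cnj ?w) < 1" using y by (simp_all add: norm_mult)
      then show "1 - y * ?w \<noteq> 0" "1 - y * cnj ?w \<noteq> 0" by force+
    qed
    have "z - of_real ?t \<noteq> 0" using assms by (auto simp: complex_eq_iff)
    have "(1 - y * ?w) * (1 - y * cnj ?w) = 1 - y * (?w + cnj ?w) + y\<^sup>2 * (?w * cnj ?w)"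
      by (simp add: power2_eq_square algebra_simps)
    also have "\<dots> = 1 - 2 * y * C + y\<^sup>2" by (simp add: ww w2)
    finally have den: "(1 - y * ?w) * (1 - y * cnj ?w) = 1 - 2 * y * C + y\<^sup>2" .
    have "1 / (1 - y * ?w) + 1 / (1 - y * cnj ?w) - 1
        = ((1 - y * cnj ?w) + (1 - y * ?w) - (1 - y * ?w) * (1 - y * cnj ?w)) / ((1 - y * ?w) * (1 - y * cnj ?w))"
    proof -
      have "1 / A + 1 / B - 1 = (B + A - A * B) / (A * B)" if "A \<noteq> 0" "B \<noteq> 0" for A B :: complex
        using that by (simp add: divide_simps)
      then show ?thesis using n1 by blast
    qed
    also have "(1 - y * cnj ?w) + (1 - y * ?w) - (1 - y * ?w) * (1 - y * cnj ?w) = 1 - y\<^sup>2 * (?w * cnj ?w)"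
      by (simp add: power2_eq_square algebra_simps)
    also have "\<dots> = 1 - y\<^sup>2" by (simp add: ww)
    also note den
    finally have s: "1 / (1 - y * ?w) + 1 / (1 - y * cnj ?w) - 1 = (1 - y\<^sup>2) / (1 - 2 * y * C + y\<^sup>2)" .
    have den0: "1 - 2 * y * C + y\<^sup>2 \<noteq> 0" using n1 unfolding den[symmetric] by simp
    have yp: "y * (p + q) = p - q" using ne by (simp add: y_def)
    have "(p + q)\<^sup>2 * (1 - 2 * y * C + y\<^sup>2) = (p + q)\<^sup>2 - 2 * (y * (p + q)) * (p + q) * C + (y * (p + q))\<^sup>2"
      by (simp add: power2_eq_square algebra_simps)
    also have "\<dots> = (p + q)\<^sup>2 - 2 * (p - q) * (p + q) * C + (p - q)\<^sup>2"
      unfolding yp ..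
    also have "\<dots> = 2 * (p\<^sup>2 + q\<^sup>2) - 2 * (p\<^sup>2 - q\<^sup>2) * C" by algebra
    also have "\<dots> = 4 * (z - of_real ?t)"
      unfolding p2 q2 by (simp add: cheb_node_def C_def field_simps)
    finally have d: "(p + q)\<^sup>2 * (1 - 2 * y * C + y\<^sup>2) = 4 * (z - of_real ?t)" .
    have "(p + q)\<^sup>2 * (1 - y\<^sup>2) = (p + q)\<^sup>2 - (y * (p + q))\<^sup>2"
      by (simp add: power2_eq_square algebra_simps)
    also have "\<dots> = 4 * (p * q)" unfolding yp by algebra
    finally have n: "(p + q)\<^sup>2 * (1 - y\<^sup>2) = 4 * (p * q)" .
    have "(1 - y\<^sup>2) / (1 - 2 * y * C + y\<^sup>2) = ((p + q)\<^sup>2 * (1 - y\<^sup>2)) / ((p + q)\<^sup>2 * (1 - 2 * y * C + y\<^sup>2))"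
      using ne by simp
    also have "\<dots> = (p * q) / (z - of_real ?t)" unfolding d n by (rule mult_divide_mult_cancel_left) simp
    finally have "(1 - y\<^sup>2) / (1 - 2 * y * C + y\<^sup>2) = (p * q) / (z - of_real ?t)" .
    with s ne show ?thesis by simp
  qed
  have mean: "cheb_mean a b N z = (2 / (1 - y ^ N) - 1) / (p * q)" if "N > 0" for N
  proof -
    let ?w = "\<lambda>i. cis (2 * pi * real i / real N)"
    have "(\<Sum>i<N. 1 / (z - of_real (cheb_node a b N i))) =
       ((\<Sum>i<N. 1 / (1 - y * ?w i)) + cnj (\<Sum>i<N. 1 / (1 - cnj y * ?w i)) - of_nat N) / (p * q)"
      unfolding kernel by (simp add: sum_divide_distrib[symmetric] sum.distrib sum_subtractf)
    also have "\<dots> = of_nat N * (2 / (1 - y ^ N) - 1) / (p * q)"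
      using sum_inverse_roots_of_unity[of y N] sum_inverse_roots_of_unity[of "cnj y" N] y that
      by (simp add: field_simps)
    finally show ?thesis using that by (simp add: cheb_mean_def)
  qed
  have "(\<lambda>N. (2 / (1 - y ^ N) - 1) / (p * q)) \<longlonglongrightarrow> (2 / (1 - 0) - 1) / (p * q)"
    using y ne by (intro tendsto_intros LIMSEQ_power_zero) auto
  moreover have "\<forall>\<^sub>F N in sequentially. (2 / (1 - y ^ N) - 1) / (p * q) = cheb_mean a b N z"
    using eventually_gt_at_top[of "0::nat"] by eventually_elim (simp add: mean)
  ultimately show ?thesis unfolding p_def q_def by (simp add: Lim_transform_eventually)
qed

text \<open>The third claim is stronger than convergence of the integrals: it controls the integrals
  over all subintervals \<open>{a..x}\<close> at once. The finite set \<open>E\<close> leaves room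
  for the branch points, where the functions are reset to 0.\<close>

lemma dominated_convergence_L1:
  fixes f :: "nat \<Rightarrow> real \<Rightarrow> real"
  assumes f: "\<And>k. f k integrable_on {a..b}" and h: "h integrable_on {a..b}" and E: "finite E"
    and le: "\<And>k x. x \<in> {a..b} - E \<Longrightarrow> \<bar>f k x\<bar> \<le> h x"
    and lim: "\<And>x. x \<in> {a..b} - E \<Longrightarrow> (\<lambda>k. f k x) \<longlonglongrightarrow> g x"
  shows "g absolutely_integrable_on {a..b}"
    and "(\<lambda>x. \<bar>f k x - g x\<bar>) integrable_on {a..b}"
    and "(\<lambda>k. integral {a..b} (\<lambda>x. \<bar>f k x - g x\<bar>)) \<longlonglongrightarrow> 0"
proof -
  define f' where "f' k x = (if x \<in> E then 0 else f k x)" for k x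
  define g' where "g' x = (if x \<in> E then 0 else g x)" for x
  define h' where "h' x = (if x \<in> E then 0 else h x)" for x
  have neg: "negligible E" using E by (rule negligible_finite)
  have f': "f' k integrable_on {a..b}" for k
    by (rule integrable_spike_finite[OF E _ f[of k]]) (auto simp: f'_def)
  have h': "h' integrable_on {a..b}"
    by (rule integrable_spike_finite[OF E _ h]) (auto simp: h'_def)
  have le': "norm (f' k x) \<le> h' x" if "x \<in> {a..b}" for k x
    using le that by (auto simp: f'_def h'_def)
  have lim': "(\<lambda>k. f' k x) \<longlonglongrightarrow> g' x" if "x \<in> {a..b}" for x
    using lim that by (auto simp: f'_def g'_def)
  have g': "g' integrable_on {a..b}"
    by (rule dominated_convergence[OF f' h' le' lim'])
  have g'_le: "norm (g' x) \<le> h' x" if "x \<in> {a..b}" for x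
    by (rule LIMSEQ_le_const2[OF tendsto_norm[OF lim'[OF that]]]) (use le' that in auto)
  have ag': "g' absolutely_integrable_on {a..b}"
    by (rule absolutely_integrable_integrable_bound[OF g'_le g' h'])
  have af': "f' k absolutely_integrable_on {a..b}" for k
    by (rule absolutely_integrable_integrable_bound[OF le' f' h'])
  have fg': "(\<lambda>x. \<bar>f' k x - g' x\<bar>) integrable_on {a..b}" for k
    using set_integral_diff(1)[OF af'[of k] ag'] unfolding absolutely_integrable_on_def by auto
  show "g absolutely_integrable_on {a..b}"
    by (rule absolutely_integrable_spike[OF ag' neg]) (auto simp: g'_def)
  show "(\<lambda>x. \<bar>f k x - g x\<bar>) integrable_on {a..b}" for k
    by (rule integrable_spike_finite[OF E _ fg'[of k]]) (auto simp: f'_def g'_def)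
  have "(\<lambda>k. integral {a..b} (\<lambda>x. \<bar>f' k x - g' x\<bar>)) \<longlonglongrightarrow> integral {a..b} (\<lambda>x. 0)"
  proof (rule dominated_convergence(2)[OF fg', where h = "\<lambda>x. 2 * h' x"])
    show "(\<lambda>x. 2 * h' x) integrable_on {a..b}" using h' by (rule integrable_on_mult_right)
    show "norm \<bar>f' k x - g' x\<bar> \<le> 2 * h' x" if "x \<in> {a..b}" for k x
      using le'[OF that, of k] g'_le[OF that] by simp
    show "(\<lambda>k. \<bar>f' k x - g' x\<bar>) \<longlonglongrightarrow> 0" if "x \<in> {a..b}" for x
      using lim'[OF that] by (intro tendsto_rabs_zero LIM_zero)
  qed
  moreover have "integral {a..b} (\<lambda>x. \<bar>f' k x - g' x\<bar>) = integral {a..b} (\<lambda>x. \<bar>f k x - g x\<bar>)" for k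
    by (rule integral_spike[OF neg]) (auto simp: f'_def g'_def)
  ultimately show "(\<lambda>k. integral {a..b} (\<lambda>x. \<bar>f k x - g x\<bar>)) \<longlonglongrightarrow> 0" by simp
qed

text \<open>The potential is recovered from the force by integration from \<open>-Z\<close>. All
  \<open>t j\<close> are within distance \<open>Z + 1\<close> of \<open>-Z\<close>, whence the
  initial value is at most \<open>ln (Z + 1 + \<epsilon>)\<close>.\<close>

lemma ln_log_cap_le_discrete_force:
  fixes w t :: "'i \<Rightarrow> real"
  assumes C: "compact C" and ab: "a < b" "complex_of_real ` {a..b} \<subseteq> C" and CS: "C = complex_of_real ` S"
    and J: "finite J" "\<And>j. j \<in> J \<Longrightarrow> w j \<ge> 0" "sum w J = 1" and "\<epsilon> > 0"
    and t: "\<And>j. j \<in> J \<Longrightarrow> \<bar>t j\<bar> \<le> 1" and "Z > 1" and S: "S \<subseteq> {-Z..1}"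
    and B: "\<And>x. x \<in> S \<Longrightarrow>
      integral {-Z..x} (\<lambda>y. \<Sum>j\<in>J. w j * Re (1 / (Complex y \<epsilon> - of_real (t j)))) \<le> B"
  shows "ln (log_cap C) \<le> ln (Z + 1 + \<epsilon>) + B"
proof (rule ln_log_cap_le_discrete_potential[OF C ab CS J \<open>\<epsilon> > 0\<close>])
  fix x assume x: "x \<in> S"
  define U where "U x = (\<Sum>j\<in>J. w j * ln (cmod (Complex (x - t j) \<epsilon>)))" for x
  have pos: "cmod (Complex y \<epsilon>) > 0" for y using \<open>\<epsilon> > 0\<close> by (simp add: complex_eq_iff)
  have "(U has_real_derivative (\<Sum>j\<in>J. w j * Re (1 / (Complex y \<epsilon> - of_real (t j))))) (at y within A)" for y A
  proof -
    have "((\<lambda>y. w j * ln (cmod (Complex (y - t j) \<epsilon>))) has_real_derivative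
        w j * Re (1 / (Complex y \<epsilon> - of_real (t j)))) (at y within A)" for j
    proof -
      have pos: "(y - t j)\<^sup>2 + \<epsilon>\<^sup>2 > 0" for y
        using \<open>\<epsilon> > 0\<close> by (auto intro: add_nonneg_pos)
      have ln_eq: "ln (cmod (Complex (y - t j) \<epsilon>)) = ln ((y - t j)\<^sup>2 + \<epsilon>\<^sup>2) / 2" for y
        using pos[of y] by (simp add: cmod_def ln_sqrt)
      have Re_eq: "Re (1 / (Complex y \<epsilon> - of_real (t j))) = (y - t j) / ((y - t j)\<^sup>2 + \<epsilon>\<^sup>2)"
        by (simp add: Re_divide)
      have "((\<lambda>y. w j * (ln ((y - t j)\<^sup>2 + \<epsilon>\<^sup>2) / 2)) has_real_derivative
          w j * ((y - t j) / ((y - t j)\<^sup>2 + \<epsilon>\<^sup>2))) (at y within A)"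
      proof -
        have "((\<lambda>y. (y - t j)\<^sup>2 + \<epsilon>\<^sup>2) has_real_derivative 2 * (y - t j)) (at y within A)"
          by (auto intro!: derivative_eq_intros)
        then have "((\<lambda>y. ln ((y - t j)\<^sup>2 + \<epsilon>\<^sup>2)) has_real_derivative
            1 / ((y - t j)\<^sup>2 + \<epsilon>\<^sup>2) * (2 * (y - t j))) (at y within A)"
          by (rule DERIV_chain2[where f = ln and g = "\<lambda>y. (y - t j)\<^sup>2 + \<epsilon>\<^sup>2", OF DERIV_ln_divide[OF pos]])
        from DERIV_cmult[OF DERIV_cdivide[OF this, of 2], of "w j"]
        show ?thesis
        proof (rule DERIV_cong)
          have "v * (1 / A * (2 * d) / 2) = v * (d / A)" for v A d :: real by simp
          then show "w j * (1 / ((y - t j)\<^sup>2 + \<epsilon>\<^sup>2) * (2 * (y - t j)) / 2) = w j * ((y - t j) / ((y - t j)\<^sup>2 + \<epsilon>\<^sup>2))" .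
        qed
      qed
      then show ?thesis by (simp only: ln_eq Re_eq)
    qed
    then show ?thesis unfolding U_def by (intro DERIV_sum)
  qed
  then have D: "(U has_vector_derivative (\<Sum>j\<in>J. w j * Re (1 / (Complex y \<epsilon> - of_real (t j))))) (at y within A)" for y A
    unfolding has_real_derivative_iff_has_vector_derivative .
  have "-Z \<le> x" using x S by auto
  from fundamental_theorem_of_calculus[OF this D]
  have "((\<lambda>y. \<Sum>j\<in>J. w j * Re (1 / (Complex y \<epsilon> - of_real (t j)))) has_integral U x - U (- Z)) {-Z..x}" .
  then have "U x - U (- Z) \<le> B" using B[OF x] by (simp add: integral_unique)
  moreover have "U (- Z) \<le> (\<Sum>j\<in>J. w j * ln (Z + 1 + \<epsilon>))"
    unfolding U_def
  proof (intro sum_mono mult_left_mono J ln_mono pos)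
    fix j assume "j \<in> J"
    have "cmod (Complex (- Z - t j) \<epsilon>) \<le> \<bar>- Z - t j\<bar> + \<bar>\<epsilon>\<bar>"
      using cmod_le[of "Complex (- Z - t j) \<epsilon>"] by simp
    then show "cmod (Complex (- Z - t j) \<epsilon>) \<le> Z + 1 + \<epsilon>"
      using t[OF \<open>j \<in> J\<close>] \<open>Z > 1\<close> \<open>\<epsilon> > 0\<close> by linarith
  qed
  moreover have "(\<Sum>j\<in>J. w j * ln (Z + 1 + \<epsilon>)) = ln (Z + 1 + \<epsilon>)"
    using J by (simp add: sum_distrib_right[symmetric])
  ultimately show "(\<Sum>j\<in>J. w j * ln (cmod (Complex (x - t j) \<epsilon>))) \<le> ln (Z + 1 + \<epsilon>) + B"
    by (simp add: U_def)
qed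

text \<open>On the real axis \<open>csqrt\<close> takes the boundary values from the upper half-plane, and so does this
  function.\<close>

definition two_interval_force :: "real \<Rightarrow> real \<Rightarrow> real \<Rightarrow> complex \<Rightarrow> real" where
  "two_interval_force \<alpha> \<beta> c z = Re ((z - of_real c) /
     (csqrt (z - of_real (-1)) * csqrt (z - of_real \<alpha>) * (csqrt (z - of_real \<beta>) * csqrt (z - of_real 1))))"

lemma compact_two_intervals: "compact (two_intervals \<alpha> \<beta>)"
  unfolding two_intervals_def
  by (intro compact_continuous_image continuous_intros compact_Un compact_Icc)

lemma left_interval_subset_two_intervals: "complex_of_real ` {-1..\<alpha>} \<subseteq> two_intervals \<alpha> \<beta>"
  by (auto simp: two_intervals_def)

lemma ln_log_cap_le_force:
  assumes ab: "-1 < \<alpha>" "\<alpha> < \<beta>" "\<beta> < 1" and c: "\<alpha> \<le> c" "c \<le> \<beta>" and "\<epsilon> > 0" "Z > 1"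
    and B: "\<And>x. x \<in> {-1..\<alpha>} \<union> {\<beta>..1} \<Longrightarrow>
      integral {-Z..x} (\<lambda>y. two_interval_force \<alpha> \<beta> c (Complex y \<epsilon>)) \<le> B"
  shows "ln (log_cap (two_intervals \<alpha> \<beta>)) \<le> ln (Z + 1 + \<epsilon>) + B"
proof -
  define F where "F N y = Re ((Complex y \<epsilon> - of_real c) *
     (cheb_mean (-1) \<alpha> N (Complex y \<epsilon>) * cheb_mean \<beta> 1 N (Complex y \<epsilon>)))" for N y
  define F0 where "F0 y = two_interval_force \<alpha> \<beta> c (Complex y \<epsilon>)" for y
  let ?M = "(Z + 2 + \<epsilon>) * (1 / \<epsilon> * (1 / \<epsilon>))"
  have ne: "Complex y \<epsilon> \<noteq> of_real e" for y e using \<open>\<epsilon> > 0\<close> by (auto simp: complex_eq_iff)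
  have Complex_eq: "Complex y \<epsilon> = of_real y + \<i> * of_real \<epsilon>" for y by (simp add: complex_eq_iff)
  have cont: "continuous_on A (F N)" for N A
    unfolding F_def cheb_mean_def sum_divide_distrib
    using ne by (auto intro!: continuous_intros simp: Complex_eq)
  have int: "F N integrable_on {l..u}" for N l u by (intro integrable_continuous_interval cont)
  have Fle: "\<bar>F N y\<bar> \<le> ?M" if "y \<in> {-Z..1} - {}" for N y
  proof -
    have "cmod (Complex y \<epsilon> - of_real c) \<le> \<bar>y - c\<bar> + \<bar>\<epsilon>\<bar>"
      using cmod_le[of "Complex y \<epsilon> - of_real c"] by simp
    also have "\<dots> \<le> Z + 2 + \<epsilon>" using that ab c \<open>\<epsilon> > 0\<close> \<open>Z > 1\<close> by auto
    finally have "cmod (Complex y \<epsilon> - of_real c) \<le> Z + 2 + \<epsilon>" .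
    then have "cmod ((Complex y \<epsilon> - of_real c) *
       (cheb_mean (-1) \<alpha> N (Complex y \<epsilon>) * cheb_mean \<beta> 1 N (Complex y \<epsilon>))) \<le> ?M"
      unfolding norm_mult using norm_cheb_mean_le[of "Complex y \<epsilon>"] \<open>\<epsilon> > 0\<close> \<open>Z > 1\<close>
      by (intro mult_mono mult_nonneg_nonneg) auto
    then show ?thesis unfolding F_def using abs_Re_le_cmod order.trans by blast
  qed
  have Flim: "(\<lambda>N. F N y) \<longlonglongrightarrow> F0 y" for y
  proof -
    have "(\<lambda>N. F N y) \<longlonglongrightarrow> Re ((Complex y \<epsilon> - of_real c) *
       (1 / (csqrt (Complex y \<epsilon> - of_real (-1)) * csqrt (Complex y \<epsilon> - of_real \<alpha>)) *
       (1 / (csqrt (Complex y \<epsilon> - of_real \<beta>) * csqrt (Complex y \<epsilon> - of_real 1)))))"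
      unfolding F_def using ab \<open>\<epsilon> > 0\<close> by (intro tendsto_intros cheb_mean_tendsto) auto
    then show ?thesis by (simp add: F0_def two_interval_force_def mult_ac)
  qed
  have M_int: "(\<lambda>y. ?M) integrable_on {-Z..1}" by (intro integrable_const_ivl)
  note L1 = dominated_convergence_L1[OF int M_int finite.emptyI Fle Flim]
  have F0int: "F0 integrable_on {-Z..1}" using L1(1) by (auto simp: absolutely_integrable_on_def)
  define \<delta> where "\<delta> N = integral {-Z..1} (\<lambda>y. \<bar>F N y - F0 y\<bar>)" for N
  have main: "ln (log_cap (two_intervals \<alpha> \<beta>)) \<le> ln (Z + 1 + \<epsilon>) + (B + \<delta> N)" if "N > 0" for N
  proof -
    define t where "t i = cheb_node (-1) \<alpha> N i" for i
    define s where "s i = cheb_node \<beta> 1 N i" for i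
    have t: "t i \<in> {-1..\<alpha>}" and s: "s i \<in> {\<beta>..1}" for i
      using cheb_node_bounds ab by (auto simp: t_def s_def)
    have st: "s j - t i > 0" for i j using t[of i] s[of j] ab by simp
    \<comment> \<open>An atom is a pair of nodes with a flag, \<open>True\<close> for the left node
      \<open>t\<close> and \<open>False\<close> for the right node \<open>s\<close>. The masses
      \<open>(c - t) / (s - t)\<close> at \<open>t\<close> and \<open>(s - c) / (s - t)\<close> at
      \<open>s\<close> make the force of the pair vanish at \<open>c\<close>; the mean position of
      the pair is \<open>s + t - c\<close>. Summation over independent nodes then factors into the
      two Cauchy transforms.\<close>
    define J where "J = ({..<N} \<times> {..<N}) \<times> (UNIV :: bool set)"
    define w where "w = (\<lambda>((i, j), v). (if v then (c - t i) / (s j - t i) else (s j - c) / (s j - t i)) / (real N)\<^sup>2)"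
    define p where "p = (\<lambda>((i, j), v). if v then t i else s j)"
    have sumJ: "(\<Sum>x\<in>J. f x) = (\<Sum>i<N. \<Sum>j<N. f ((i, j), True) + f ((i, j), False))" for f :: "_ \<Rightarrow> real"
      unfolding J_def sum.cartesian_product' by (simp add: UNIV_bool add.commute)
    have w0: "w x \<ge> 0" for x
    proof -
      obtain i j v where x: "x = ((i, j), v)" by (metis prod.exhaust)
      have "c - t i \<ge> 0" "s j - c \<ge> 0" using t[of i] s[of j] c by auto
      then show ?thesis using st[of j i] by (simp add: x w_def)
    qed
    have w1: "sum w J = 1"
    proof -
      have "w ((i, j), True) + w ((i, j), False) = 1 / (real N)\<^sup>2" for i j
        using st[of j i] by (simp add: w_def add_divide_distrib[symmetric])
      then show ?thesis unfolding sumJ using \<open>N > 0\<close> by (simp add: power2_eq_square)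
    qed
    have force: "(\<Sum>x\<in>J. w x * Re (1 / (Complex y \<epsilon> - of_real (p x)))) = F N y" for y
    proof -
      define z where "z = Complex y \<epsilon>"
      have pair: "of_real (w ((i, j), True)) * (1 / (z - of_real (t i))) + of_real (w ((i, j), False)) * (1 / (z - of_real (s j)))
         = (z - of_real c) * (1 / (z - of_real (t i)) * (1 / (z - of_real (s j)))) / (of_nat N)\<^sup>2" for i j
      proof -
        have n: "z - of_real (t i) \<noteq> 0" "z - of_real (s j) \<noteq> 0" "complex_of_real (s j) - of_real (t i) \<noteq> 0"
          using ne st[of j i] by (auto simp: z_def simp flip: of_real_diff)
        have "(of_real c - of_real (t i)) * (z - of_real (s j)) + (of_real (s j) - of_real c) * (z - of_real (t i))
           = (z - of_real c) * (complex_of_real (s j) - of_real (t i))" by (simp add: algebra_simps)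
        then have "(of_real c - of_real (t i)) / (complex_of_real (s j) - of_real (t i)) * (1 / (z - of_real (t i)))
          + (of_real (s j) - of_real c) / (complex_of_real (s j) - of_real (t i)) * (1 / (z - of_real (s j)))
          = (z - of_real c) * (1 / (z - of_real (t i)) * (1 / (z - of_real (s j))))"
          using n by (simp add: divide_simps)
        note eq = this
        have "of_real (w ((i, j), True)) * (1 / (z - of_real (t i))) + of_real (w ((i, j), False)) * (1 / (z - of_real (s j)))
          = ((of_real c - of_real (t i)) / (complex_of_real (s j) - of_real (t i)) * (1 / (z - of_real (t i)))
          + (of_real (s j) - of_real c) / (complex_of_real (s j) - of_real (t i)) * (1 / (z - of_real (s j)))) / (of_nat N)\<^sup>2"
          by (simp add: w_def add_divide_distrib mult_ac)
        then show ?thesis unfolding eq .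
      qed
      have "(\<Sum>x\<in>J. w x * Re (1 / (z - of_real (p x)))) =
        Re (\<Sum>i<N. \<Sum>j<N. of_real (w ((i, j), True)) * (1 / (z - of_real (t i))) + of_real (w ((i, j), False)) * (1 / (z - of_real (s j))))"
      proof -
        have Re_mult: "Re (of_real r * u) = r * Re u" for r u by simp
        show ?thesis unfolding sumJ by (simp only: Re_sum plus_complex.sel Re_mult p_def case_prod_conv if_True if_False)
      qed
      also have "(\<Sum>i<N. \<Sum>j<N. of_real (w ((i, j), True)) * (1 / (z - of_real (t i))) + of_real (w ((i, j), False)) * (1 / (z - of_real (s j))))
         = (z - of_real c) * (cheb_mean (-1) \<alpha> N z * cheb_mean \<beta> 1 N z)"
      proof -
        have "(\<Sum>i<N. \<Sum>j<N. k * (a i * b j) / n\<^sup>2) = k * (sum a {..<N} / n * (sum b {..<N} / n))"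
          for k n :: complex and a b
        proof -
          have "(\<Sum>i<N. \<Sum>j<N. k * (a i * b j) / n\<^sup>2) = k * (\<Sum>i<N. \<Sum>j<N. a i * b j) / n\<^sup>2"
            by (simp only: sum_distrib_left sum_divide_distrib)
          also have "\<dots> = k * (sum a {..<N} / n * (sum b {..<N} / n))"
            unfolding sum_product[symmetric] by (simp add: power2_eq_square)
          finally show ?thesis .
        qed
        then show ?thesis
          unfolding pair cheb_mean_def t_def[symmetric] s_def[symmetric] .
      qed
      finally show ?thesis by (simp add: F_def z_def)
    qed
    show ?thesis
    proof (rule ln_log_cap_le_discrete_force[where J = J and w = w and t = p and a = "-1" and b = \<alpha>
            and S = "{-1..\<alpha>} \<union> {\<beta>..1}"])
      show "\<bar>p x\<bar> \<le> 1" for x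
      proof -
        obtain i j v where x: "x = ((i, j), v)" by (metis prod.exhaust)
        show ?thesis using t[of i] s[of j] ab by (auto simp: x p_def)
      qed
      fix x assume x: "x \<in> {-1..\<alpha>} \<union> {\<beta>..1}"
      then have sub: "{-Z..x} \<subseteq> {-Z..1}" using ab by auto
      have i0: "F0 integrable_on {-Z..x}" using F0int sub by (rule integrable_on_subinterval)
      have i1: "(\<lambda>y. \<bar>F N y - F0 y\<bar>) integrable_on {-Z..x}" using L1(2) sub by (rule integrable_on_subinterval)
      have "integral {-Z..x} (F N) \<le> integral {-Z..x} (\<lambda>y. F0 y + \<bar>F N y - F0 y\<bar>)"
        by (intro integral_le int integrable_add i0 i1) auto
      also have "\<dots> = integral {-Z..x} F0 + integral {-Z..x} (\<lambda>y. \<bar>F N y - F0 y\<bar>)"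
        by (intro integral_add i0 i1)
      also have "integral {-Z..x} (\<lambda>y. \<bar>F N y - F0 y\<bar>) \<le> \<delta> N"
        unfolding \<delta>_def by (intro integral_subset_le i1 L1(2) sub) auto
      also have "integral {-Z..x} F0 \<le> B" unfolding F0_def by (rule B[OF x])
      finally show "integral {-Z..x} (\<lambda>y. \<Sum>x\<in>J. w x * Re (1 / (Complex y \<epsilon> - of_real (p x)))) \<le> B + \<delta> N"
        unfolding force by simp
    next
      show "finite J" by (simp add: J_def)
      show "two_intervals \<alpha> \<beta> = complex_of_real ` ({-1..\<alpha>} \<union> {\<beta>..1})" by (simp add: two_intervals_def)
      show "{-1..\<alpha>} \<union> {\<beta>..1} \<subseteq> {-Z..1}" using ab \<open>Z > 1\<close> by auto
    qed (rule w0 w1 compact_two_intervals left_interval_subset_two_intervals \<open>\<epsilon> > 0\<close> \<open>Z > 1\<close> ab(1))+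
  qed
  have "(\<lambda>N. ln (Z + 1 + \<epsilon>) + (B + \<delta> N)) \<longlonglongrightarrow> ln (Z + 1 + \<epsilon>) + (B + 0)"
    unfolding \<delta>_def by (intro tendsto_intros L1(3))
  then have "ln (log_cap (two_intervals \<alpha> \<beta>)) \<le> ln (Z + 1 + \<epsilon>) + (B + 0)"
    by (rule LIMSEQ_le_const) (use main in \<open>auto intro!: exI[of _ 1]\<close>)
  then show ?thesis by simp
qed

section \<open>Boundary values of the force on the real line\<close>

lemma inverse_sqrt_abs_integrable: "(\<lambda>x::real. 1 / sqrt \<bar>x - e\<bar>) integrable_on {a..b}"
proof (cases "a \<le> b")
  case True
  \<comment> \<open>One antiderivative serves on both sides of \<open>e\<close>, because
    \<open>sqrt\<close> is extended to negative arguments as an odd function; it is continuous at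
    \<open>e\<close>.\<close>
  have "((\<lambda>x. 2 * sqrt (x - e)) has_vector_derivative 1 / sqrt \<bar>x - e\<bar>) (at x)" if "x \<noteq> e" for x
  proof -
    have "((\<lambda>x. 2 * sqrt (x - e)) has_real_derivative 1 / sqrt \<bar>x - e\<bar>) (at x)"
    proof (cases "x > e")
      case True
      then show ?thesis by (auto intro!: derivative_eq_intros simp: field_simps)
    next
      case False
      then have "x < e" using that by simp
      have "((\<lambda>x. 2 * (- sqrt (e - x))) has_real_derivative 1 / sqrt \<bar>x - e\<bar>) (at x)"
        using \<open>x < e\<close> by (auto intro!: derivative_eq_intros simp: field_simps)
      moreover have "- sqrt (e - x) = sqrt (x - e)" for x using real_sqrt_minus[of "e - x"] by simp
      ultimately show ?thesis by simp
    qed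
    then show ?thesis by (simp add: has_real_derivative_iff_has_vector_derivative)
  qed
  then have "((\<lambda>x. 1 / sqrt \<bar>x - e\<bar>) has_integral 2 * sqrt (b - e) - 2 * sqrt (a - e)) {a..b}"
    by (intro fundamental_theorem_of_calculus_interior_strong[where S = "{e}"] True continuous_intros) auto
  then show ?thesis by (rule has_integral_integrable)
qed auto

text \<open>At most one factor is smaller than \<open>d\<close>. The other three reciprocals are at
  most \<open>1 / d\<close>, and the fourth is a summand on the right, so a product of singularities
  is majorized by a sum of integrable ones.\<close>

lemma inverse_product4_le:
  fixes A B C D :: real
  assumes d: "d > 0" and nonneg: "A \<ge> 0" "B \<ge> 0" "C \<ge> 0" "D \<ge> 0"
    and far: "A \<ge> d \<or> B \<ge> d" "A \<ge> d \<or> C \<ge> d" "A \<ge> d \<or> D \<ge> d" "B \<ge> d \<or> C \<ge> d" "B \<ge> d \<or> D \<ge> d" "C \<ge> d \<or> D \<ge> d"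
  shows "1 / (A * B * (C * D)) \<le> (1 / d) ^ 3 * (1 / A + 1 / B + 1 / C + 1 / D)"
proof -
  have one: "1 / (w * x * (y * z)) \<le> (1 / d) ^ 3 * (1 / w)" if "w \<ge> 0" "x \<ge> d" "y \<ge> d" "z \<ge> d" for w x y z
  proof -
    have "1 / (w * x * (y * z)) = 1 / x * (1 / y) * (1 / z) * (1 / w)" by simp
    also have "\<dots> \<le> 1 / d * (1 / d) * (1 / d) * (1 / w)"
      using that d by (intro mult_right_mono mult_mono) (auto simp: frac_le)
    finally show ?thesis by (simp add: power3_eq_cube)
  qed
  have nn: "0 \<le> (1 / d) ^ 3 * (1 / A)" "0 \<le> (1 / d) ^ 3 * (1 / B)" "0 \<le> (1 / d) ^ 3 * (1 / C)" "0 \<le> (1 / d) ^ 3 * (1 / D)"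
    using assms by auto
  consider "B \<ge> d" "C \<ge> d" "D \<ge> d" | "A \<ge> d" "C \<ge> d" "D \<ge> d" | "A \<ge> d" "B \<ge> d" "D \<ge> d" | "A \<ge> d" "B \<ge> d" "C \<ge> d"
    using far by argo
  then show ?thesis
  proof cases
    case 1
    from one[OF nonneg(1) this] show ?thesis using nn unfolding distrib_left by linarith
  next
    case 2
    have "1 / (A * B * (C * D)) \<le> (1 / d) ^ 3 * (1 / B)" using one[OF nonneg(2) 2] by (simp only: mult_ac)
    then show ?thesis using nn unfolding distrib_left by linarith
  next
    case 3
    have "1 / (A * B * (C * D)) \<le> (1 / d) ^ 3 * (1 / C)" using one[OF nonneg(3) 3] by (simp only: mult_ac)
    then show ?thesis using nn unfolding distrib_left by linarith
  next
    case 4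
    have "1 / (A * B * (C * D)) \<le> (1 / d) ^ 3 * (1 / D)" using one[OF nonneg(4) 4] by (simp only: mult_ac)
    then show ?thesis using nn unfolding distrib_left by linarith
  qed
qed

lemma csqrt_Complex:
  assumes "\<epsilon> > 0"
  shows "csqrt (Complex y \<epsilon>) =
    Complex (sqrt ((sqrt (y\<^sup>2 + \<epsilon>\<^sup>2) + y) / 2)) (sqrt ((sqrt (y\<^sup>2 + \<epsilon>\<^sup>2) - y) / 2))"
  using assms by (simp add: complex_eq_iff cmod_def)

text \<open>\<open>csqrt\<close> jumps across the negative axis but is continuous up to it from
  above: the formula \<open>csqrt_Complex\<close>, valid for positive height, extends continuously
  to height 0 with value \<open>csqrt (of_real y)\<close>.\<close>

lemma csqrt_Complex_tendsto:
  assumes "\<And>n. e n > 0" "e \<longlonglongrightarrow> 0"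
  shows "(\<lambda>n. csqrt (Complex y (e n))) \<longlonglongrightarrow> csqrt (of_real y)"
proof -
  have "(\<lambda>n. Complex (sqrt ((sqrt (y\<^sup>2 + (e n)\<^sup>2) + y) / 2)) (sqrt ((sqrt (y\<^sup>2 + (e n)\<^sup>2) - y) / 2)))
    \<longlonglongrightarrow> Complex (sqrt ((sqrt (y\<^sup>2 + 0\<^sup>2) + y) / 2)) (sqrt ((sqrt (y\<^sup>2 + 0\<^sup>2) - y) / 2))"
    by (intro tendsto_intros assms) auto
  moreover have "Complex (sqrt ((sqrt (y\<^sup>2 + 0\<^sup>2) + y) / 2)) (sqrt ((sqrt (y\<^sup>2 + 0\<^sup>2) - y) / 2)) = csqrt (of_real y)"
    by (simp add: complex_eq_iff)
  ultimately show ?thesis using assms(1) by (simp add: csqrt_Complex)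
qed

text \<open>The majorant does not depend on \<epsilon>: moving up from the real line only increases
  the modulus of each root in the denominator.\<close>

lemma two_interval_force_dominated:
  assumes ab: "-1 < \<alpha>" "\<alpha> < \<beta>" "\<beta> < 1" and c: "\<alpha> \<le> c" "c \<le> \<beta>" and "Z > 1"
  obtains h where "h integrable_on {-Z..1}"
    "\<And>\<epsilon> y. 0 < \<epsilon> \<Longrightarrow> \<epsilon> \<le> 1 \<Longrightarrow> y \<in> {-Z..1} - {-1, \<alpha>, \<beta>, 1} \<Longrightarrow> \<bar>two_interval_force \<alpha> \<beta> c (Complex y \<epsilon>)\<bar> \<le> h y"
proof -
  \<comment> \<open>Two branch points cannot both be closer to \<open>y\<close> than half of the
    smallest distance between neighbours; \<open>d\<close> is the square root of that half, since
    the factors are square roots of distances.\<close>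
  define d where "d = sqrt (min (\<alpha> + 1) (min (\<beta> - \<alpha>) (1 - \<beta>)) / 2)"
  have d: "d > 0" using ab by (simp add: d_def)
  define h where "h y = (Z + 3) * ((1 / d) ^ 3 * (1 / sqrt \<bar>y - (-1)\<bar> + 1 / sqrt \<bar>y - \<alpha>\<bar> + 1 / sqrt \<bar>y - \<beta>\<bar> + 1 / sqrt \<bar>y - 1\<bar>))" for y
  have "h integrable_on {-Z..1}"
    unfolding h_def by (intro integrable_on_mult_right integrable_add inverse_sqrt_abs_integrable)
  moreover have "\<bar>two_interval_force \<alpha> \<beta> c (Complex y \<epsilon>)\<bar> \<le> h y"
    if e: "0 < \<epsilon>" "\<epsilon> \<le> 1" and y: "y \<in> {-Z..1} - {-1, \<alpha>, \<beta>, 1}" for \<epsilon> y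
  proof -
    have sq: "sqrt \<bar>y - e\<bar> \<le> cmod (csqrt (Complex y \<epsilon> - of_real e))" for e
      using abs_Re_le_cmod[of "Complex y \<epsilon> - of_real e"] by simp
    have pos: "sqrt \<bar>y - (-1)\<bar> > 0" "sqrt \<bar>y - \<alpha>\<bar> > 0" "sqrt \<bar>y - \<beta>\<bar> > 0" "sqrt \<bar>y - 1\<bar> > 0"
      using y by auto
    have "cmod (Complex y \<epsilon> - of_real c) \<le> \<bar>y - c\<bar> + \<bar>\<epsilon>\<bar>"
      using cmod_le[of "Complex y \<epsilon> - of_real c"] by simp
    also have "\<dots> \<le> Z + 3" using y ab c e \<open>Z > 1\<close> by auto
    finally have num: "cmod (Complex y \<epsilon> - of_real c) \<le> Z + 3" .
    have "\<bar>two_interval_force \<alpha> \<beta> c (Complex y \<epsilon>)\<bar> \<le> cmod ((Complex y \<epsilon> - of_real c) /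
     (csqrt (Complex y \<epsilon> - of_real (-1)) * csqrt (Complex y \<epsilon> - of_real \<alpha>) * (csqrt (Complex y \<epsilon> - of_real \<beta>) * csqrt (Complex y \<epsilon> - of_real 1))))"
      unfolding two_interval_force_def by (rule abs_Re_le_cmod)
    also have "\<dots> \<le> (Z + 3) / (sqrt \<bar>y - (-1)\<bar> * sqrt \<bar>y - \<alpha>\<bar> * (sqrt \<bar>y - \<beta>\<bar> * sqrt \<bar>y - 1\<bar>))"
      unfolding norm_divide norm_mult using num pos \<open>Z > 1\<close>
      by (intro frac_le mult_mono sq mult_pos_pos) auto
    also have "\<dots> = (Z + 3) * (1 / (sqrt \<bar>y - (-1)\<bar> * sqrt \<bar>y - \<alpha>\<bar> * (sqrt \<bar>y - \<beta>\<bar> * sqrt \<bar>y - 1\<bar>)))" by simp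
    also have "\<dots> \<le> h y"
      unfolding h_def
    proof (intro mult_left_mono inverse_product4_le d)
      have far: "d \<le> sqrt \<bar>y - u\<bar> \<or> d \<le> sqrt \<bar>y - v\<bar>" if "min (\<alpha> + 1) (min (\<beta> - \<alpha>) (1 - \<beta>)) \<le> \<bar>u - v\<bar>" for u v
      proof -
        have "min (\<alpha> + 1) (min (\<beta> - \<alpha>) (1 - \<beta>)) / 2 \<le> \<bar>y - u\<bar> \<or> min (\<alpha> + 1) (min (\<beta> - \<alpha>) (1 - \<beta>)) / 2 \<le> \<bar>y - v\<bar>"
        proof -
          have "m / 2 \<le> \<bar>y - u\<bar> \<or> m / 2 \<le> \<bar>y - v\<bar>" if "m \<le> \<bar>u - v\<bar>" for m
            using that by arith
          then show ?thesis using that by blast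
        qed
        then show ?thesis unfolding d_def by (metis real_sqrt_le_iff)
      qed
      show "d \<le> sqrt \<bar>y - (-1)\<bar> \<or> d \<le> sqrt \<bar>y - \<alpha>\<bar>" "d \<le> sqrt \<bar>y - (-1)\<bar> \<or> d \<le> sqrt \<bar>y - \<beta>\<bar>"
        "d \<le> sqrt \<bar>y - (-1)\<bar> \<or> d \<le> sqrt \<bar>y - 1\<bar>" "d \<le> sqrt \<bar>y - \<alpha>\<bar> \<or> d \<le> sqrt \<bar>y - \<beta>\<bar>"
        "d \<le> sqrt \<bar>y - \<alpha>\<bar> \<or> d \<le> sqrt \<bar>y - 1\<bar>" "d \<le> sqrt \<bar>y - \<beta>\<bar> \<or> d \<le> sqrt \<bar>y - 1\<bar>"
        using ab by (intro far; linarith)+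
    qed (use \<open>Z > 1\<close> in auto)
    finally show ?thesis .
  qed
  ultimately show ?thesis using that by blast
qed

lemma
  assumes ab: "-1 < \<alpha>" "\<alpha> < \<beta>" "\<beta> < 1" and c: "\<alpha> \<le> c" "c \<le> \<beta>" and "Z > 1"
  shows two_interval_force_integrable:
      "(\<lambda>y. two_interval_force \<alpha> \<beta> c (of_real y)) absolutely_integrable_on {-Z..1}"
    and ln_log_cap_le_boundary_force:
      "(\<And>x. x \<in> {-1..\<alpha>} \<union> {\<beta>..1} \<Longrightarrow>
         integral {-Z..x} (\<lambda>y. two_interval_force \<alpha> \<beta> c (of_real y)) \<le> B) \<Longrightarrow>
       ln (log_cap (two_intervals \<alpha> \<beta>)) \<le> ln (Z + 1) + B"
proof -
  define e where "e n = inverse (real (Suc n))" for n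
  have e: "e n > 0" "e n \<le> 1" for n by (auto simp: e_def field_simps)
  have e0: "e \<longlonglongrightarrow> 0" unfolding e_def by (rule LIMSEQ_inverse_real_of_nat)
  define G where "G = (\<lambda>y. two_interval_force \<alpha> \<beta> c (of_real y))"
  define F where "F n y = two_interval_force \<alpha> \<beta> c (Complex y (e n))" for n y
  obtain h where h: "h integrable_on {-Z..1}"
    "\<And>\<epsilon> y. 0 < \<epsilon> \<Longrightarrow> \<epsilon> \<le> 1 \<Longrightarrow> y \<in> {-Z..1} - {-1, \<alpha>, \<beta>, 1} \<Longrightarrow> \<bar>two_interval_force \<alpha> \<beta> c (Complex y \<epsilon>)\<bar> \<le> h y"
    using two_interval_force_dominated[OF assms] by blast
  have shift: "Complex y \<epsilon> - of_real a = Complex (y - a) \<epsilon>" for y \<epsilon> a by (simp add: complex_eq_iff)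
  have Fle: "\<bar>F n y\<bar> \<le> h y" if "y \<in> {-Z..1} - {-1, \<alpha>, \<beta>, 1}" for n y
    unfolding F_def by (rule h(2)[OF e that])
  have cont_csqrt: "continuous_on A (\<lambda>y. csqrt (Complex (y - a) (e n)))" for a n A
    unfolding csqrt_Complex[OF e(1)] unfolding Complex_eq by (intro continuous_intros) auto
  have Fint: "F n integrable_on {l..u}" for n l u
  proof (rule integrable_continuous_interval)
    have "Complex y (e n) \<noteq> 0" for y using e(1)[of n] by (auto simp: complex_eq_iff)
    moreover have "continuous_on {l..u} (\<lambda>y. Complex (y - a) (e n))" for a
      unfolding Complex_eq by (intro continuous_intros)
    ultimately show "continuous_on {l..u} (F n)"
      unfolding F_def two_interval_force_def shift by (intro continuous_intros cont_csqrt) auto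
  qed
  have Flim: "(\<lambda>n. F n y) \<longlonglongrightarrow> G y" if y: "y \<in> {-Z..1} - {-1, \<alpha>, \<beta>, 1}" for y
  proof -
    have lim1: "(\<lambda>n. csqrt (Complex (y - a) (e n))) \<longlonglongrightarrow> csqrt (of_real y - of_real a)" for a
      using csqrt_Complex_tendsto[of e "y - a"] e e0 by simp
    have ne: "csqrt (of_real y - of_real a) \<noteq> 0" if "y \<noteq> a" for a
      using that by simp
    have lim2: "(\<lambda>n. Complex (y - c) (e n)) \<longlonglongrightarrow> of_real y - of_real c"
    proof -
      have "(\<lambda>n. of_real (y - c) + \<i> * of_real (e n)) \<longlonglongrightarrow> of_real (y - c) + \<i> * of_real 0"
        by (intro tendsto_intros e0)
      then show ?thesis by (simp add: Complex_eq)
    qed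
    show ?thesis
      unfolding F_def G_def two_interval_force_def shift
      by (intro tendsto_intros lim1 lim2 no_zero_divisors ne) (use y in auto)
  qed
  have fin: "finite {-1, \<alpha>, \<beta>, 1}" by simp
  note L1 = dominated_convergence_L1[OF Fint h(1) fin Fle Flim]
  show "(\<lambda>y. two_interval_force \<alpha> \<beta> c (of_real y)) absolutely_integrable_on {-Z..1}"
    using L1(1) by (simp add: G_def)
  then have Gint: "G integrable_on {-Z..1}" by (simp add: absolutely_integrable_on_def G_def)
  define \<delta> where "\<delta> n = integral {-Z..1} (\<lambda>y. \<bar>F n y - G y\<bar>)" for n
  assume B: "\<And>x. x \<in> {-1..\<alpha>} \<union> {\<beta>..1} \<Longrightarrow>
         integral {-Z..x} (\<lambda>y. two_interval_force \<alpha> \<beta> c (of_real y)) \<le> B"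
  have main: "ln (log_cap (two_intervals \<alpha> \<beta>)) \<le> ln (Z + 1 + e n) + (B + \<delta> n)" for n
  proof (rule ln_log_cap_le_force[OF ab c e(1) \<open>Z > 1\<close>])
    fix x assume x: "x \<in> {-1..\<alpha>} \<union> {\<beta>..1}"
    then have sub: "{-Z..x} \<subseteq> {-Z..1}" using ab by auto
    have i0: "G integrable_on {-Z..x}" using Gint sub by (rule integrable_on_subinterval)
    have i1: "(\<lambda>y. \<bar>F n y - G y\<bar>) integrable_on {-Z..x}" using L1(2) sub by (rule integrable_on_subinterval)
    have "integral {-Z..x} (F n) \<le> integral {-Z..x} (\<lambda>y. G y + \<bar>F n y - G y\<bar>)"
      by (intro integral_le Fint integrable_add i0 i1) auto
    also have "\<dots> = integral {-Z..x} G + integral {-Z..x} (\<lambda>y. \<bar>F n y - G y\<bar>)"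
      by (intro integral_add i0 i1)
    also have "integral {-Z..x} (\<lambda>y. \<bar>F n y - G y\<bar>) \<le> \<delta> n"
      unfolding \<delta>_def by (intro integral_subset_le i1 L1(2) sub) auto
    also have "integral {-Z..x} G \<le> B" unfolding G_def by (rule B[OF x])
    finally show "integral {-Z..x} (\<lambda>y. two_interval_force \<alpha> \<beta> c (Complex y (e n))) \<le> B + \<delta> n"
      by (simp add: F_def[abs_def])
  qed
  have "(\<lambda>n. ln (Z + 1 + e n) + (B + \<delta> n)) \<longlonglongrightarrow> ln (Z + 1 + 0) + (B + 0)"
    unfolding \<delta>_def using \<open>Z > 1\<close> by (intro tendsto_intros L1(3) e0) auto
  then have "ln (log_cap (two_intervals \<alpha> \<beta>)) \<le> ln (Z + 1 + 0) + (B + 0)"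
    by (rule LIMSEQ_le_const) (use main in auto)
  then show "ln (log_cap (two_intervals \<alpha> \<beta>)) \<le> ln (Z + 1) + B" by simp
qed

lemma integral_zero_on_Ioo:
  fixes f :: "real \<Rightarrow> real"
  assumes "\<And>x. x \<in> {a<..<b} \<Longrightarrow> f x = 0"
  shows "integral {a..b} f = 0"
  unfolding integral_open_interval_real by (subst integral_cong[where g = "\<lambda>x. 0", OF assms]) auto

definition branch_poly :: "real \<Rightarrow> real \<Rightarrow> real \<Rightarrow> real" where
  "branch_poly \<alpha> \<beta> x = (x + 1) * (x - \<alpha>) * ((x - \<beta>) * (x - 1))"

text \<open>A branch point to the right of \<open>x\<close> contributes a factor \<i> to the
  denominator, one to the left a factor 1. With four factors \<i> the quotient keeps its sign, with
  two it changes sign, and with one or three it is imaginary.\<close>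

lemma two_interval_force_real:
  assumes ab: "-1 < \<alpha>" "\<alpha> < \<beta>" "\<beta> < 1"
  shows "x < -1 \<Longrightarrow> two_interval_force \<alpha> \<beta> c (of_real x) = (x - c) / sqrt \<bar>branch_poly \<alpha> \<beta> x\<bar>"
    and "x \<in> {-1<..<\<alpha>} \<Longrightarrow> two_interval_force \<alpha> \<beta> c (of_real x) = 0"
    and "x \<in> {\<alpha><..<\<beta>} \<Longrightarrow> two_interval_force \<alpha> \<beta> c (of_real x) = - ((x - c) / sqrt \<bar>branch_poly \<alpha> \<beta> x\<bar>)"
    and "x \<in> {\<beta><..<1} \<Longrightarrow> two_interval_force \<alpha> \<beta> c (of_real x) = 0"
proof -
  have csq: "csqrt (of_real x - of_real a) = (if x \<ge> a then 1 else \<i>) * of_real (sqrt \<bar>x - a\<bar>)" for x a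
  proof (cases "x \<ge> a")
    case True
    then show ?thesis using csqrt_of_real_nonneg[of "of_real (x - a)"] by (simp flip: of_real_diff)
  next
    case False
    then show ?thesis using csqrt_of_real_nonpos[of "of_real (x - a)"] by (simp flip: of_real_diff)
  qed
  have eq: "two_interval_force \<alpha> \<beta> c (of_real x) = (x - c) / sqrt \<bar>branch_poly \<alpha> \<beta> x\<bar> *
      Re (1 / ((if x \<ge> -1 then 1 else \<i>) * (if x \<ge> \<alpha> then 1 else \<i>) * ((if x \<ge> \<beta> then 1 else \<i>) * (if x \<ge> 1 then 1 else \<i>))))" for x
  proof -
    have "two_interval_force \<alpha> \<beta> c (of_real x) = Re (of_real ((x - c) / sqrt \<bar>branch_poly \<alpha> \<beta> x\<bar>) *
      (1 / ((if x \<ge> -1 then 1 else \<i>) * (if x \<ge> \<alpha> then 1 else \<i>) * ((if x \<ge> \<beta> then 1 else \<i>) * (if x \<ge> 1 then 1 else \<i>)))))"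
    proof -
      have "(of_real x - of_real c) / (u1 * of_real s1 * (u2 * of_real s2) * (u3 * of_real s3 * (u4 * of_real s4)))
        = complex_of_real ((x - c) / (s1 * s2 * (s3 * s4))) * (1 / (u1 * u2 * (u3 * u4)))" for s1 s2 s3 s4 u1 u2 u3 u4
        by (simp add: divide_inverse mult_ac)
      moreover have "sqrt \<bar>branch_poly \<alpha> \<beta> x\<bar> = sqrt \<bar>x - (-1)\<bar> * sqrt \<bar>x - \<alpha>\<bar> * (sqrt \<bar>x - \<beta>\<bar> * sqrt \<bar>x - 1\<bar>)"
        by (simp add: branch_poly_def abs_mult real_sqrt_mult)
      ultimately show ?thesis unfolding two_interval_force_def csq by (simp only:)
    qed
    moreover have "Re (of_real r * u) = r * Re u" for r u by simp
    ultimately show ?thesis by (simp only:)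
  qed
  show "x < -1 \<Longrightarrow> two_interval_force \<alpha> \<beta> c (of_real x) = (x - c) / sqrt \<bar>branch_poly \<alpha> \<beta> x\<bar>"
    "x \<in> {-1<..<\<alpha>} \<Longrightarrow> two_interval_force \<alpha> \<beta> c (of_real x) = 0"
    "x \<in> {\<alpha><..<\<beta>} \<Longrightarrow> two_interval_force \<alpha> \<beta> c (of_real x) = - ((x - c) / sqrt \<bar>branch_poly \<alpha> \<beta> x\<bar>)"
    "x \<in> {\<beta><..<1} \<Longrightarrow> two_interval_force \<alpha> \<beta> c (of_real x) = 0"
    using ab unfolding eq by auto
qed

lemma ln_log_cap_le_period:
  assumes ab: "-1 < \<alpha>" "\<alpha> < \<beta>" "\<beta> < 1" and c: "\<alpha> \<le> c" "c \<le> \<beta>" and "Z > 1"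
    and gap: "integral {\<alpha><..<\<beta>} (\<lambda>x. (x - c) / sqrt \<bar>branch_poly \<alpha> \<beta> x\<bar>) = 0"
  shows "ln (log_cap (two_intervals \<alpha> \<beta>)) \<le>
    ln (Z + 1) + integral {-Z<..<-1} (\<lambda>x. (x - c) / sqrt \<bar>branch_poly \<alpha> \<beta> x\<bar>)"
proof (rule ln_log_cap_le_boundary_force[OF ab c \<open>Z > 1\<close>])
  define G where "G = (\<lambda>y. two_interval_force \<alpha> \<beta> c (of_real y))"
  have Gint: "G integrable_on {-Z..1}"
    using two_interval_force_integrable[OF ab c \<open>Z > 1\<close>] by (simp add: absolutely_integrable_on_def G_def)
  have int: "G integrable_on {l..u}" if "-Z \<le> l" "u \<le> 1" for l u
    by (rule integrable_on_subinterval[OF Gint]) (use that in auto)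
  have left: "integral {-Z..-1} G = integral {-Z<..<-1} (\<lambda>x. (x - c) / sqrt \<bar>branch_poly \<alpha> \<beta> x\<bar>)"
    unfolding integral_open_interval_real G_def using two_interval_force_real[OF ab] by (intro integral_cong) auto
  have mid: "integral {\<alpha>..\<beta>} G = 0"
  proof -
    have "integral {\<alpha>..\<beta>} G = integral {\<alpha><..<\<beta>} (\<lambda>x. - ((x - c) / sqrt \<bar>branch_poly \<alpha> \<beta> x\<bar>))"
      unfolding integral_open_interval_real G_def using two_interval_force_real[OF ab] by (intro integral_cong) auto
    then show ?thesis using gap by simp
  qed
  have I1: "integral {-1..x} G = 0" if "x \<le> \<alpha>" for x
    using that two_interval_force_real(2)[OF ab] by (intro integral_zero_on_Ioo) (auto simp: G_def)
  have I2: "integral {\<beta>..x} G = 0" if "x \<le> 1" for x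
    using that two_interval_force_real(4)[OF ab] by (intro integral_zero_on_Ioo) (auto simp: G_def)
  have comb: "integral {l..m} G + integral {m..u} G = integral {l..u} G" if "-Z \<le> l" "l \<le> m" "m \<le> u" "u \<le> 1" for l m u
    using that by (intro Henstock_Kurzweil_Integration.integral_combine int) auto
  fix x assume "x \<in> {-1..\<alpha>} \<union> {\<beta>..1}"
  then consider "-1 \<le> x" "x \<le> \<alpha>" | "\<beta> \<le> x" "x \<le> 1" by auto
  then have "integral {-Z..x} G = integral {-Z..-1} G"
  proof cases
    case 1
    then show ?thesis using comb[of "-Z" "-1" x] I1[of x] ab \<open>Z > 1\<close> by simp
  next
    case 2
    then show ?thesis
      using comb[of "-Z" "-1" x] comb[of "-1" \<alpha> x] comb[of \<alpha> \<beta> x] I1[of \<alpha>] I2[of x] mid ab \<open>Z > 1\<close> by simp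
  qed
  then show "integral {-Z..x} (\<lambda>y. two_interval_force \<alpha> \<beta> c (of_real y))
     \<le> integral {-Z<..<-1} (\<lambda>x. (x - c) / sqrt \<bar>branch_poly \<alpha> \<beta> x\<bar>)"
    using left by (simp add: G_def)
qed

section \<open>Elliptic integrals\<close>

text \<open>Derivatives are taken within the interval because indefinite integrals are
  differentiated that way, one-sidedly at the ends. Identities and inequalities between elliptic
  integrals are obtained below by comparing such derivatives.\<close>

lemma nonneg_deriv_within_imp_le:
  fixes f :: "real \<Rightarrow> real"
  assumes "a \<le> b" and D: "\<And>x. x \<in> {a..b} \<Longrightarrow> (f has_real_derivative f' x) (at x within {a..b})"
    and nonneg: "\<And>x. x \<in> {a..b} \<Longrightarrow> f' x \<ge> 0"
  shows "f a \<le> f b"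
proof (rule DERIV_nonneg_imp_increasing_open[OF \<open>a \<le> b\<close>])
  show "continuous_on {a..b} f" using D by (intro DERIV_continuous_on) auto
  fix x assume "a < x" "x < b"
  then have "(f has_real_derivative f' x) (at x)" "f' x \<ge> 0"
    using D[of x] nonneg[of x] by (auto simp: at_within_Icc_at)
  then show "\<exists>y. (f has_real_derivative y) (at x) \<and> 0 \<le> y" by blast
qed

lemma eq_deriv_within_imp_eq:
  fixes f g :: "real \<Rightarrow> real"
  assumes "a \<le> b" and "\<And>x. x \<in> {a..b} \<Longrightarrow> (f has_real_derivative f' x) (at x within {a..b})"
    and "\<And>x. x \<in> {a..b} \<Longrightarrow> (g has_real_derivative f' x) (at x within {a..b})" and "f a = g a"
  shows "f b = g b"
  using nonneg_deriv_within_imp_le[OF \<open>a \<le> b\<close> DERIV_diff[OF assms(2,3)]]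
    nonneg_deriv_within_imp_le[OF \<open>a \<le> b\<close> DERIV_diff[OF assms(3,2)]] \<open>f a = g a\<close>
  by simp

text \<open>Removes the variable upper limit, so that an integral depending on \<phi> through both
  limit and integrand can be differentiated over a fixed range.\<close>

lemma integral_rescale:
  fixes f :: "real \<Rightarrow> real"
  assumes "\<phi> \<ge> 0" "continuous_on {0..\<phi>} f"
  shows "((\<lambda>t. \<phi> * f (\<phi> * t)) has_integral integral {0..\<phi>} f) {0..1}"
proof -
  have "(*) \<phi> ` {0..1} \<subseteq> {0..\<phi>}" using assms(1) by (auto intro: mult_left_le)
  then show ?thesis
    using has_integral_substitution[of 0 1 "\<lambda>t. \<phi> * t" 0 \<phi> f "\<lambda>_. \<phi>"] assms
    by (auto intro!: derivative_eq_intros)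
qed

section \<open>Legendre integrals as functions of the amplitude\<close>

definition ell_delta :: "real \<Rightarrow> real \<Rightarrow> real" where
  "ell_delta k \<theta> = sqrt (1 - k\<^sup>2 * (sin \<theta>)\<^sup>2)"

definition incF :: "real \<Rightarrow> real \<Rightarrow> real" where
  "incF k \<phi> = integral {0..\<phi>} (\<lambda>\<theta>. 1 / ell_delta k \<theta>)"

definition incE :: "real \<Rightarrow> real \<Rightarrow> real" where
  "incE k \<phi> = integral {0..\<phi>} (ell_delta k)"

lemma ellK_eq: "ellK k = incF k (pi / 2)" and ellE_eq: "ellE k = incE k (pi / 2)"
  by (simp_all add: ellK_def ellE_def incF_def incE_def ell_delta_def[abs_def])

text \<open>The complete integral of the third kind with characteristic \<open>k\<^sup>2 sin\<^sup>2 \<phi>\<close> is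
  \<open>ellK k + sin\<^sup>2 \<phi> * ellP k \<phi>\<close>.\<close>

definition ellP :: "real \<Rightarrow> real \<Rightarrow> real" where
  "ellP k \<phi> = integral {0..pi / 2} (\<lambda>\<theta>. k\<^sup>2 * (sin \<theta>)\<^sup>2 / ((1 - k\<^sup>2 * (sin \<phi>)\<^sup>2 * (sin \<theta>)\<^sup>2) * ell_delta k \<theta>))"

text \<open>This is \<open>2 sin \<phi> cos \<phi> (1 - \<Delta>(\<phi>) / \<Delta>(\<theta>)) / (sin\<^sup>2 \<phi> - sin\<^sup>2 \<theta>)\<close> with the singularity at
  \<open>\<theta> = \<phi>\<close> cancelled: an integrand of the third kind, compared with its value for \<open>k = 0\<close>.\<close>

definition ellq :: "real \<Rightarrow> real \<Rightarrow> real \<Rightarrow> real" where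
  "ellq k \<phi> \<theta> = 2 * k\<^sup>2 * sin \<phi> * cos \<phi> / (ell_delta k \<theta> * (ell_delta k \<theta> + ell_delta k \<phi>))"

definition ellQ :: "real \<Rightarrow> real \<Rightarrow> real" where
  "ellQ k \<phi> = integral {0..\<phi>} (ellq k \<phi>)"

context
  fixes k :: real
  assumes k: "0 < k" "k < 1"
begin

lemma k2: "0 < k\<^sup>2" "k\<^sup>2 < 1"
  using k by (auto simp: power_less_one_iff)

lemma ell_delta_pos: "ell_delta k \<theta> > 0"
  and ell_delta_le_1: "ell_delta k \<theta> \<le> 1"
  and ell_delta_sq: "(ell_delta k \<theta>)\<^sup>2 = 1 - k\<^sup>2 * (sin \<theta>)\<^sup>2"
  and ell_delta_sq_ge: "1 - k\<^sup>2 \<le> (ell_delta k \<theta>)\<^sup>2"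
proof -
  have "k\<^sup>2 * (sin \<theta>)\<^sup>2 \<le> k\<^sup>2 * 1" using k2 by (intro mult_left_mono) (auto simp: abs_square_le_1)
  then have *: "1 - k\<^sup>2 * (sin \<theta>)\<^sup>2 > 0" "1 - k\<^sup>2 \<le> 1 - k\<^sup>2 * (sin \<theta>)\<^sup>2" using k2 by linarith+
  then show "ell_delta k \<theta> > 0" "ell_delta k \<theta> \<le> 1"
    "(ell_delta k \<theta>)\<^sup>2 = 1 - k\<^sup>2 * (sin \<theta>)\<^sup>2" "1 - k\<^sup>2 \<le> (ell_delta k \<theta>)\<^sup>2"
    by (auto simp: ell_delta_def)
qed

lemma ell_delta_neq_0 [simp]: "ell_delta k \<theta> \<noteq> 0"
  using ell_delta_pos[of \<theta>] by simp

lemma ell_delta_add_neq_0 [simp]: "ell_delta k \<theta> + ell_delta k \<phi> \<noteq> 0"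
  using ell_delta_pos[of \<theta>] ell_delta_pos[of \<phi>] by simp

lemma continuous_on_ell_delta [continuous_intros]:
  fixes f :: "'a :: t2_space \<Rightarrow> real"
  shows "continuous_on A f \<Longrightarrow> continuous_on A (\<lambda>x. ell_delta k (f x))"
  unfolding ell_delta_def by (auto intro!: continuous_intros)

lemma ell_delta_deriv:
  assumes "(f has_real_derivative f') (at x within A)"
  shows "((\<lambda>x. ell_delta k (f x)) has_real_derivative
    - (k\<^sup>2 * sin (f x) * cos (f x)) / ell_delta k (f x) * f') (at x within A)"
proof -
  have "1 - k\<^sup>2 * (sin (f x))\<^sup>2 > 0" using ell_delta_pos[of "f x"] by (simp add: ell_delta_def)
  then show ?thesis
    unfolding ell_delta_def using assms
    by (auto intro!: derivative_eq_intros simp: field_simps)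
qed

lemma incF_deriv: "x \<in> {0..b} \<Longrightarrow> (incF k has_real_derivative 1 / ell_delta k x) (at x within {0..b})"
  unfolding incF_def[abs_def] by (intro integral_has_real_derivative continuous_intros) auto

lemma incE_deriv: "x \<in> {0..b} \<Longrightarrow> (incE k has_real_derivative ell_delta k x) (at x within {0..b})"
  unfolding incE_def[abs_def] by (intro integral_has_real_derivative continuous_intros) auto

lemma incF_0 [simp]: "incF k 0 = 0" and incE_0 [simp]: "incE k 0 = 0"
  by (simp_all add: incF_def incE_def)

lemma incF_diff_ge:
  assumes "0 \<le> a" "a \<le> b"
  shows "b - a \<le> incF k b - incF k a"
proof -
  have "incF k a - a \<le> incF k b - b"
  proof (rule nonneg_deriv_within_imp_le[OF \<open>a \<le> b\<close>])
    fix x assume x: "x \<in> {a..b}"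
    have "(incF k has_real_derivative 1 / ell_delta k x) (at x within {a..b})"
      by (rule DERIV_subset[OF incF_deriv[of x b]]) (use assms x in auto)
    then show "((\<lambda>x. incF k x - x) has_real_derivative 1 / ell_delta k x - 1) (at x within {a..b})"
      by (auto intro!: derivative_eq_intros)
    show "0 \<le> 1 / ell_delta k x - 1" using ell_delta_pos[of x] ell_delta_le_1[of x] by simp
  qed
  then show ?thesis by simp
qed

lemma ellK_pos: "ellK k > 0"
  using incF_diff_ge[of 0 "pi / 2"] pi_gt_zero unfolding ellK_eq incF_0 by linarith

text \<open>Pointwise, \<open>1 - k^2 \<le> \<Delta>^2\<close>. This makes the coefficient of the
  squared logarithm in the exponent nonnegative, so that enlarging the logarithm enlarges the
  bound.\<close>

lemma ellE_ellK: "(1 - k\<^sup>2) * ellK k \<le> ellE k"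
proof -
  have "incE k 0 - (1 - k\<^sup>2) * incF k 0 \<le> incE k (pi / 2) - (1 - k\<^sup>2) * incF k (pi / 2)"
  proof (rule nonneg_deriv_within_imp_le[where f = "\<lambda>x. incE k x - (1 - k\<^sup>2) * incF k x"
        and f' = "\<lambda>x. ell_delta k x - (1 - k\<^sup>2) * (1 / ell_delta k x)"])
    fix x assume "x \<in> {0..pi / 2}"
    then show "((\<lambda>x. incE k x - (1 - k\<^sup>2) * incF k x) has_real_derivative ell_delta k x - (1 - k\<^sup>2) * (1 / ell_delta k x)) (at x within {0..pi / 2})"
      by (intro DERIV_diff DERIV_cmult incE_deriv incF_deriv)
    show "0 \<le> ell_delta k x - (1 - k\<^sup>2) * (1 / ell_delta k x)"
      using ell_delta_sq_ge[of x] ell_delta_pos[of x] by (simp add: field_simps power2_eq_square)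
  qed auto
  then show ?thesis by (simp add: ellK_eq ellE_eq)
qed

lemma char_pos: "1 - k\<^sup>2 * (sin \<phi>)\<^sup>2 * (sin \<theta>)\<^sup>2 > 0"
proof -
  have "k\<^sup>2 * (sin \<phi>)\<^sup>2 * (sin \<theta>)\<^sup>2 \<le> k\<^sup>2 * (sin \<phi>)\<^sup>2 * 1" using k2 by (intro mult_left_mono) (auto simp: abs_square_le_1)
  then show ?thesis using ell_delta_sq[of \<phi>] ell_delta_pos[of \<phi>] by (smt (verit) zero_less_power2 mult_1_right)
qed

lemma char_neq [simp]: "k\<^sup>2 * (sin \<phi>)\<^sup>2 * (sin \<theta>)\<^sup>2 \<noteq> 1"
  using char_pos[of \<phi> \<theta>] by linarith

text \<open>In the next two derivatives with respect to \<open>\<phi>\<close>, the derivative of the integrand is the total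
  \<open>\<theta>\<close>-derivative \<open>b'\<close> of an elementary function plus a remainder \<open>r\<close> that consists of integrands of the
  first and second kind (interchange of argument and parameter).\<close>

lemma ellP_eq:
  assumes "0 \<le> \<phi>" "\<phi> \<le> pi / 2"
  shows "sin \<phi> * cos \<phi> * ell_delta k \<phi> * ellP k \<phi> = ellK k * incE k \<phi> - ellE k * incF k \<phi>"
proof -
  define w where "w \<phi> \<theta> = 1 - k\<^sup>2 * (sin \<phi>)\<^sup>2 * (sin \<theta>)\<^sup>2" for \<phi> \<theta>
  have w: "w \<phi> \<theta> \<noteq> 0" for \<phi> \<theta> by (simp add: w_def)
  define n where "n \<phi> \<theta> = sin \<phi> * cos \<phi> * ell_delta k \<phi> * (k\<^sup>2 * (sin \<theta>)\<^sup>2 / (w \<phi> \<theta> * ell_delta k \<theta>))" for \<phi> \<theta>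
  \<comment> \<open>The factor \<open>sin \<theta> * cos \<theta>\<close> vanishes at both ends of
    \<open>{0..pi / 2}\<close>, so the total derivative \<open>b'\<close> integrates to 0 and only
    \<open>r\<close> contributes to the derivative in \<phi>.\<close>
  define b where "b \<phi> \<theta> = k\<^sup>2 * (sin \<phi>)\<^sup>2 * (sin \<theta> * cos \<theta> * ell_delta k \<theta> / (ell_delta k \<phi> * w \<phi> \<theta>))" for \<phi> \<theta>
  define b' where "b' \<phi> \<theta> = k\<^sup>2 * (sin \<phi>)\<^sup>2 / ell_delta k \<phi> *
     ((((cos \<theta>)\<^sup>2 - (sin \<theta>)\<^sup>2) * ell_delta k \<theta> - k\<^sup>2 * (sin \<theta>)\<^sup>2 * (cos \<theta>)\<^sup>2 / ell_delta k \<theta>) / w \<phi> \<theta>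
       + sin \<theta> * cos \<theta> * ell_delta k \<theta> * (2 * k\<^sup>2 * (sin \<phi>)\<^sup>2 * sin \<theta> * cos \<theta>) / (w \<phi> \<theta>)\<^sup>2)" for \<phi> \<theta>
  define n' where "n' \<phi> \<theta> = (((cos \<phi>)\<^sup>2 - (sin \<phi>)\<^sup>2) * ell_delta k \<phi> - k\<^sup>2 * (sin \<phi>)\<^sup>2 * (cos \<phi>)\<^sup>2 / ell_delta k \<phi>) * (k\<^sup>2 * (sin \<theta>)\<^sup>2 / (w \<phi> \<theta> * ell_delta k \<theta>))
     + sin \<phi> * cos \<phi> * ell_delta k \<phi> * (k\<^sup>2 * (sin \<theta>)\<^sup>2 * (2 * k\<^sup>2 * sin \<phi> * cos \<phi> * (sin \<theta>)\<^sup>2) / ((w \<phi> \<theta>)\<^sup>2 * ell_delta k \<theta>))" for \<phi> \<theta>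
  define r where "r \<phi> \<theta> = ell_delta k \<phi> * (1 / ell_delta k \<theta>) - ell_delta k \<theta> / ell_delta k \<phi>" for \<phi> \<theta>
  have wd\<phi>: "((\<lambda>\<phi>. w \<phi> \<theta>) has_real_derivative - (2 * k\<^sup>2 * sin \<phi> * cos \<phi> * (sin \<theta>)\<^sup>2)) (at \<phi> within A)" for \<phi> \<theta> A
    unfolding w_def by (auto intro!: derivative_eq_intros)
  have wd\<theta>: "((\<lambda>\<theta>. w \<phi> \<theta>) has_real_derivative - (2 * k\<^sup>2 * (sin \<phi>)\<^sup>2 * sin \<theta> * cos \<theta>)) (at \<theta> within A)" for \<phi> \<theta> A
    unfolding w_def by (auto intro!: derivative_eq_intros)
  have dn: "((\<lambda>\<phi>. n \<phi> \<theta>) has_real_derivative n' \<phi> \<theta>) (at \<phi> within A)" for \<phi> \<theta> A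
    unfolding n_def n'_def using w[of \<phi> \<theta>]
    by (auto intro!: derivative_eq_intros ell_delta_deriv wd\<phi> simp: divide_simps) (simp add: algebra_simps power2_eq_square)
  have db: "((\<lambda>\<theta>. b \<phi> \<theta>) has_real_derivative b' \<phi> \<theta>) (at \<theta> within A)" for \<phi> \<theta> A
    unfolding b_def b'_def using w[of \<phi> \<theta>]
    by (auto intro!: derivative_eq_intros ell_delta_deriv wd\<theta> simp: divide_simps) (simp add: algebra_simps power2_eq_square)
  have id: "n' \<phi> \<theta> = b' \<phi> \<theta> + r \<phi> \<theta>" for \<phi> \<theta>
  proof -
    \<comment> \<open>Over the common denominator \<open>d * D * v^2\<close> both sides are
      polynomials in \<open>k^2\<close> and the squared sines; small letters belong to \<phi>,
      capital letters to \<theta>.\<close>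
    have alg: "((c2 - s2) * d2 - \<kappa> * s2 * c2) * \<kappa> * S2 * v + 2 * \<kappa>\<^sup>2 * s2 * c2 * S2\<^sup>2 * d2
      = \<kappa> * s2 * (((C2 - S2) * D2 - \<kappa> * S2 * C2) * v + 2 * \<kappa> * s2 * S2 * C2 * D2) + (d2 - D2) * v\<^sup>2"
      if "c2 = 1 - s2" "C2 = 1 - S2" "d2 = 1 - \<kappa> * s2" "D2 = 1 - \<kappa> * S2" "v = 1 - \<kappa> * s2 * S2"
      for c2 s2 d2 \<kappa> S2 C2 D2 v :: real
      unfolding that by (simp add: power2_eq_square algebra_simps)
    have fr: "((c\<^sup>2 - s\<^sup>2) * d - \<kappa> * s\<^sup>2 * c\<^sup>2 / d) * (\<kappa> * S\<^sup>2 / (v * D)) + s * c * d * (\<kappa> * S\<^sup>2 * (2 * \<kappa> * s * c * S\<^sup>2) / (v\<^sup>2 * D))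
       = (((c\<^sup>2 - s\<^sup>2) * d\<^sup>2 - \<kappa> * s\<^sup>2 * c\<^sup>2) * \<kappa> * S\<^sup>2 * v + 2 * \<kappa>\<^sup>2 * s\<^sup>2 * c\<^sup>2 * (S\<^sup>2)\<^sup>2 * d\<^sup>2) / (d * D * v\<^sup>2)"
      "\<kappa> * s\<^sup>2 / d * (((C\<^sup>2 - S\<^sup>2) * D - \<kappa> * S\<^sup>2 * C\<^sup>2 / D) / v + S * C * D * (2 * \<kappa> * s\<^sup>2 * S * C) / v\<^sup>2)
       = \<kappa> * s\<^sup>2 * (((C\<^sup>2 - S\<^sup>2) * D\<^sup>2 - \<kappa> * S\<^sup>2 * C\<^sup>2) * v + 2 * \<kappa> * s\<^sup>2 * S\<^sup>2 * C\<^sup>2 * D\<^sup>2) / (d * D * v\<^sup>2)"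
      "d * (1 / D) - D / d = (d\<^sup>2 - D\<^sup>2) * v\<^sup>2 / (d * D * v\<^sup>2)"
      if "d \<noteq> 0" "D \<noteq> 0" "v \<noteq> 0" for s c d S C D v \<kappa> :: real
      using that by (simp_all add: divide_simps) (simp_all add: power2_eq_square power4_eq_xxxx algebra_simps)
    show ?thesis
      unfolding n'_def b'_def r_def fr(1,2)[OF ell_delta_neq_0 ell_delta_neq_0 w]
        fr(3)[where v = "w \<phi> \<theta>", OF ell_delta_neq_0 ell_delta_neq_0 w] add_divide_distrib[symmetric]
        alg[OF cos_squared_eq cos_squared_eq ell_delta_sq ell_delta_sq w_def] ..
  qed
  show ?thesis
  proof (rule eq_deriv_within_imp_eq[OF assms(1), where f = "\<lambda>\<phi>. sin \<phi> * cos \<phi> * ell_delta k \<phi> * ellP k \<phi>"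
        and g = "\<lambda>\<phi>. ellK k * incE k \<phi> - ellE k * incF k \<phi>" and f' = "\<lambda>\<phi>. ellK k * ell_delta k \<phi> - ellE k * (1 / ell_delta k \<phi>)"])
    fix x assume x: "x \<in> {0..\<phi>}"
    have "(\<lambda>x. sin x * cos x * ell_delta k x * ellP k x) = (\<lambda>x. integral (cbox 0 (pi / 2)) (n x))"
      unfolding ellP_def n_def w_def by (simp only: integral_mult_right cbox_interval)
    moreover have "((\<lambda>x. integral (cbox 0 (pi / 2)) (n x)) has_real_derivative integral (cbox 0 (pi / 2)) (n' x)) (at x within {0..\<phi>})"
    proof (rule leibniz_rule_field_derivative[OF dn])
      show "n y integrable_on cbox 0 (pi / 2)" for y
        unfolding n_def w_def by (intro integrable_continuous continuous_intros) auto
      show "continuous_on ({0..\<phi>} \<times> cbox 0 (pi / 2)) (\<lambda>(x, t). n' x t)"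
        unfolding n'_def w_def split_beta by (intro continuous_intros) auto
    qed (use x in auto)
    moreover have "integral (cbox 0 (pi / 2)) (n' x) = ellK k * ell_delta k x - ellE k * (1 / ell_delta k x)"
    proof -
      have "(b' x has_integral b x (pi / 2) - b x 0) {0..pi / 2}"
        by (rule fundamental_theorem_of_calculus) (auto simp: db simp flip: has_real_derivative_iff_has_vector_derivative)
      moreover have "(r x has_integral ell_delta k x * ellK k - ellE k / ell_delta k x) {0..pi / 2}"
        unfolding r_def ellK_eq ellE_eq incF_def incE_def
        by (intro has_integral_diff has_integral_mult_right has_integral_divide integrable_integral integrable_continuous_interval continuous_intros) auto
      ultimately have "((\<lambda>\<theta>. b' x \<theta> + r x \<theta>) has_integral (b x (pi / 2) - b x 0) + (ell_delta k x * ellK k - ellE k / ell_delta k x)) {0..pi / 2}"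
        by (rule has_integral_add)
      then show ?thesis unfolding id[symmetric] by (simp add: integral_unique b_def mult.commute)
    qed
    ultimately show "((\<lambda>\<phi>. sin \<phi> * cos \<phi> * ell_delta k \<phi> * ellP k \<phi>) has_real_derivative ellK k * ell_delta k x - ellE k * (1 / ell_delta k x)) (at x within {0..\<phi>})"
      by simp
    show "((\<lambda>\<phi>. ellK k * incE k \<phi> - ellE k * incF k \<phi>) has_real_derivative ellK k * ell_delta k x - ellE k * (1 / ell_delta k x)) (at x within {0..\<phi>})"
      using x by (intro DERIV_diff DERIV_cmult incE_deriv incF_deriv)
  qed simp
qed

lemma continuous_on_ellq [continuous_intros]:
  fixes f g :: "'a :: t2_space \<Rightarrow> real"
  shows "continuous_on A f \<Longrightarrow> continuous_on A g \<Longrightarrow> continuous_on A (\<lambda>x. ellq k (f x) (g x))"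
  unfolding ellq_def by (auto intro!: continuous_intros)

lemma ellQ_deriv:
  assumes \<phi>: "\<phi> \<in> {0..b}"
  shows "(ellQ k has_real_derivative 2 * k\<^sup>2 * sin \<phi> * cos \<phi> / (ell_delta k \<phi>)\<^sup>2
    + 2 * (ell_delta k \<phi> * incF k \<phi> - incE k \<phi> / ell_delta k \<phi>)) (at \<phi> within {0..b})"
proof -
  define u where "u \<phi> \<theta> = ell_delta k \<theta> * (ell_delta k \<theta> + ell_delta k \<phi>)" for \<phi> \<theta>
  have u: "u \<phi> \<theta> \<noteq> 0" for \<phi> \<theta> by (simp add: u_def)
  define D' where "D' \<theta> = - (k\<^sup>2 * sin \<theta> * cos \<theta>) / ell_delta k \<theta>" for \<theta>
  have Dd: "((\<lambda>x. ell_delta k (f x)) has_real_derivative D' (f x) * f') (at x within A)"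
    if "(f has_real_derivative f') (at x within A)" for f f' x A
    using ell_delta_deriv[OF that] by (simp add: D'_def)
  define u\<phi> where "u\<phi> \<phi> \<theta> = ell_delta k \<theta> * D' \<phi>" for \<phi> \<theta>
  define u\<theta> where "u\<theta> \<phi> \<theta> = 2 * ell_delta k \<theta> * D' \<theta> + D' \<theta> * ell_delta k \<phi>" for \<phi> \<theta>
  \<comment> \<open>This is \<open>ellq k \<theta> \<phi>\<close>: argument and parameter are
    interchanged.\<close>
  define b1 where "b1 \<phi> \<theta> = 2 * k\<^sup>2 * sin \<theta> * cos \<theta> / (ell_delta k \<phi> * (ell_delta k \<phi> + ell_delta k \<theta>))" for \<phi> \<theta>
  define b' where "b' \<phi> \<theta> = 2 * k\<^sup>2 * (((cos \<theta>)\<^sup>2 - (sin \<theta>)\<^sup>2) / (ell_delta k \<phi> * (ell_delta k \<phi> + ell_delta k \<theta>))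
    - sin \<theta> * cos \<theta> * D' \<theta> / (ell_delta k \<phi> * (ell_delta k \<phi> + ell_delta k \<theta>)\<^sup>2))" for \<phi> \<theta>
  define r where "r \<phi> \<theta> = 2 * (ell_delta k \<phi> * (1 / ell_delta k \<theta>) - ell_delta k \<theta> / ell_delta k \<phi>)" for \<phi> \<theta>
  define m where "m x t = x * ellq k x (x * t)" for x t
  define m' where "m' x t = ellq k x (x * t) + x * (2 * k\<^sup>2 * (((cos x)\<^sup>2 - (sin x)\<^sup>2) / u x (x * t)
    - sin x * cos x * (u\<phi> x (x * t) + t * u\<theta> x (x * t)) / (u x (x * t))\<^sup>2))" for x t
  \<comment> \<open>The derivative of \<open>t * ellq k x (x * t) + b1 x (x * t)\<close> in
    \<open>t\<close>. The first term absorbs the effect of the scaled variable, which stands for the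
    moving upper limit; the second is the exact part of the derivative of \<open>ellq\<close> in
    \<phi>.\<close>
  define W where "W x t = ellq k x (x * t) - t * x * (2 * k\<^sup>2 * sin x * cos x * u\<theta> x (x * t) / (u x (x * t))\<^sup>2)
     + x * b' x (x * t)" for x t
  have ellq_u: "ellq k \<phi> \<theta> = 2 * k\<^sup>2 * sin \<phi> * cos \<phi> / u \<phi> \<theta>" for \<phi> \<theta> by (simp add: ellq_def u_def)
  have du: "((\<lambda>x. u x (x * t)) has_real_derivative u\<phi> x (x * t) + t * u\<theta> x (x * t)) (at x within A)" for x t A
    unfolding u_def u\<phi>_def u\<theta>_def by (auto intro!: derivative_eq_intros Dd simp: algebra_simps)
  have du': "((\<lambda>t. u x (x * t)) has_real_derivative x * u\<theta> x (x * t)) (at t within A)" for x t A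
    unfolding u_def u\<phi>_def u\<theta>_def by (auto intro!: derivative_eq_intros Dd simp: algebra_simps)
  have dm: "((\<lambda>x. m x t) has_real_derivative m' x t) (at x within A)" for x t A
    unfolding m_def m'_def ellq_u using u[of x "x * t"]
    by (auto intro!: derivative_eq_intros du simp: divide_simps) (simp add: algebra_simps power2_eq_square)
  have db: "((\<lambda>\<theta>. b1 x \<theta>) has_real_derivative b' x \<theta>) (at \<theta> within A)" for x \<theta> A
    unfolding b1_def b'_def
    by (auto intro!: derivative_eq_intros Dd simp: divide_simps) (simp add: algebra_simps power2_eq_square)
  have dW: "((\<lambda>t. t * ellq k x (x * t) + b1 x (x * t)) has_real_derivative W x t) (at t within A)" for x t A
  proof -
    have "((\<lambda>t. b1 x (x * t)) has_real_derivative b' x (x * t) * x) (at t within A)"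
      by (rule DERIV_chain2[OF db]) (auto intro!: derivative_eq_intros)
    moreover have "((\<lambda>t. t * ellq k x (x * t)) has_real_derivative
        ellq k x (x * t) - t * x * (2 * k\<^sup>2 * sin x * cos x * u\<theta> x (x * t) / (u x (x * t))\<^sup>2)) (at t within A)"
      unfolding ellq_u using u[of x "x * t"]
      by (auto intro!: derivative_eq_intros du' simp: divide_simps) (simp add: algebra_simps power2_eq_square)
    ultimately show ?thesis
      unfolding W_def by (subst mult.commute[of x "b' x (x * t)"]) (rule DERIV_add)
  qed
  have id: "2 * k\<^sup>2 * (((cos \<phi>)\<^sup>2 - (sin \<phi>)\<^sup>2) / u \<phi> \<theta> - sin \<phi> * cos \<phi> * u\<phi> \<phi> \<theta> / (u \<phi> \<theta>)\<^sup>2) = b' \<phi> \<theta> + r \<phi> \<theta>" for \<phi> \<theta>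
  proof -
    have alg: "\<kappa> * (c2 - s2) * (e + d2) + \<kappa>\<^sup>2 * s2 * c2
      = (\<kappa> * (C2 - S2) * (D2 + e) + \<kappa>\<^sup>2 * S2 * C2) + (d2 - D2) * (D2 + d2 + 2 * e)"
      if "c2 = 1 - s2" "C2 = 1 - S2" "d2 = 1 - \<kappa> * s2" "D2 = 1 - \<kappa> * S2"
      for c2 s2 d2 \<kappa> S2 C2 D2 e :: real
      unfolding that by (simp add: power2_eq_square algebra_simps)
    have fr: "2 * \<kappa> * ((c\<^sup>2 - s\<^sup>2) / (D * (D + d)) - s * c * (D * (- (\<kappa> * s * c) / d)) / (D * (D + d))\<^sup>2)
       = 2 * (\<kappa> * (c\<^sup>2 - s\<^sup>2) * (d * D + d\<^sup>2) + \<kappa>\<^sup>2 * s\<^sup>2 * c\<^sup>2) / (d * D * (D + d)\<^sup>2)"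
      "2 * \<kappa> * ((C\<^sup>2 - S\<^sup>2) / (d * (d + D)) - S * C * (- (\<kappa> * S * C) / D) / (d * (d + D)\<^sup>2))
       = 2 * (\<kappa> * (C\<^sup>2 - S\<^sup>2) * (D\<^sup>2 + d * D) + \<kappa>\<^sup>2 * S\<^sup>2 * C\<^sup>2) / (d * D * (D + d)\<^sup>2)"
      "2 * (d * (1 / D) - D / d) = 2 * ((d\<^sup>2 - D\<^sup>2) * (D\<^sup>2 + d\<^sup>2 + 2 * (d * D))) / (d * D * (D + d)\<^sup>2)"
      if "d \<noteq> 0" "D \<noteq> 0" "D + d \<noteq> 0" for s c d S C D \<kappa> :: real
    proof -
      have "d + D \<noteq> 0" using that by (simp add: add.commute)
      with that show "2 * \<kappa> * ((c\<^sup>2 - s\<^sup>2) / (D * (D + d)) - s * c * (D * (- (\<kappa> * s * c) / d)) / (D * (D + d))\<^sup>2)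
         = 2 * (\<kappa> * (c\<^sup>2 - s\<^sup>2) * (d * D + d\<^sup>2) + \<kappa>\<^sup>2 * s\<^sup>2 * c\<^sup>2) / (d * D * (D + d)\<^sup>2)"
        "2 * \<kappa> * ((C\<^sup>2 - S\<^sup>2) / (d * (d + D)) - S * C * (- (\<kappa> * S * C) / D) / (d * (d + D)\<^sup>2))
         = 2 * (\<kappa> * (C\<^sup>2 - S\<^sup>2) * (D\<^sup>2 + d * D) + \<kappa>\<^sup>2 * S\<^sup>2 * C\<^sup>2) / (d * D * (D + d)\<^sup>2)"
        "2 * (d * (1 / D) - D / d) = 2 * ((d\<^sup>2 - D\<^sup>2) * (D\<^sup>2 + d\<^sup>2 + 2 * (d * D))) / (d * D * (D + d)\<^sup>2)"
        by (simp_all add: divide_simps) (simp_all add: power2_eq_square algebra_simps)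
    qed
    show ?thesis
      unfolding u_def u\<phi>_def b'_def r_def D'_def
        fr[OF ell_delta_neq_0 ell_delta_neq_0 ell_delta_add_neq_0] add_divide_distrib[symmetric] distrib_left[symmetric]
        alg[OF cos_squared_eq[of \<phi>] cos_squared_eq[of \<theta>] ell_delta_sq[of \<phi>] ell_delta_sq[of \<theta>]] ..
  qed
  have m'_eq: "m' x t = W x t + x * r x (x * t)" for x t
  proof -
    have "m' x t - W x t = x * (2 * k\<^sup>2 * (((cos x)\<^sup>2 - (sin x)\<^sup>2) / u x (x * t) - sin x * cos x * u\<phi> x (x * t) / (u x (x * t))\<^sup>2) - b' x (x * t))"
      unfolding m'_def W_def using u[of x "x * t"] by (simp add: add_divide_distrib algebra_simps)
    then show ?thesis unfolding id by (simp add: algebra_simps)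
  qed
  have "((\<lambda>x. integral (cbox 0 1) (m x)) has_real_derivative integral (cbox 0 1) (m' \<phi>)) (at \<phi> within {0..b})"
  proof (rule leibniz_rule_field_derivative[OF dm])
    show "m y integrable_on cbox 0 1" for y
      unfolding m_def by (intro integrable_continuous continuous_intros)
    show "continuous_on ({0..b} \<times> cbox 0 1) (\<lambda>(x, t). m' x t)"
      unfolding m'_def u_def u\<phi>_def u\<theta>_def D'_def split_beta by (intro continuous_intros) auto
  qed (use \<phi> in auto)
  moreover have "integral (cbox 0 1) (m x) = ellQ k x" if "x \<in> {0..b}" for x
  proof -
    have "continuous_on {0..x} (ellq k x)" by (intro continuous_intros)
    with that have "(m x has_integral ellQ k x) {0..1}"
      unfolding m_def[abs_def] ellQ_def by (intro integral_rescale) auto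
    then show ?thesis by (simp add: integral_unique)
  qed
  moreover have "integral (cbox 0 1) (m' \<phi>) = 2 * k\<^sup>2 * sin \<phi> * cos \<phi> / (ell_delta k \<phi>)\<^sup>2
    + 2 * (ell_delta k \<phi> * incF k \<phi> - incE k \<phi> / ell_delta k \<phi>)"
  proof -
    have "(W \<phi> has_integral (1 * ellq k \<phi> (\<phi> * 1) + b1 \<phi> (\<phi> * 1)) - (0 * ellq k \<phi> (\<phi> * 0) + b1 \<phi> (\<phi> * 0))) {0..1}"
      by (rule fundamental_theorem_of_calculus) (auto simp: dW[simplified] simp flip: has_real_derivative_iff_has_vector_derivative)
    note W_int = this
    have "(r \<phi> has_integral 2 * (ell_delta k \<phi> * incF k \<phi> - incE k \<phi> / ell_delta k \<phi>)) {0..\<phi>}"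
      unfolding r_def incF_def incE_def
      by (intro has_integral_diff has_integral_mult_right has_integral_divide integrable_integral integrable_continuous_interval continuous_intros) auto
    then have "integral {0..\<phi>} (r \<phi>) = 2 * (ell_delta k \<phi> * incF k \<phi> - incE k \<phi> / ell_delta k \<phi>)"
      by (rule integral_unique)
    moreover have "continuous_on {0..\<phi>} (r \<phi>)" unfolding r_def by (intro continuous_intros) auto
    then have "((\<lambda>t. \<phi> * r \<phi> (\<phi> * t)) has_integral integral {0..\<phi>} (r \<phi>)) {0..1}"
      using \<phi> by (intro integral_rescale) auto
    ultimately have "((\<lambda>t. \<phi> * r \<phi> (\<phi> * t)) has_integral 2 * (ell_delta k \<phi> * incF k \<phi> - incE k \<phi> / ell_delta k \<phi>)) {0..1}"
      by (simp only:)
    with W_int have "((\<lambda>t. W \<phi> t + \<phi> * r \<phi> (\<phi> * t)) has_integral (1 * ellq k \<phi> (\<phi> * 1) + b1 \<phi> (\<phi> * 1)) - (0 * ellq k \<phi> (\<phi> * 0) + b1 \<phi> (\<phi> * 0))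
       + 2 * (ell_delta k \<phi> * incF k \<phi> - incE k \<phi> / ell_delta k \<phi>)) {0..1}"
      by (rule has_integral_add)
    \<comment> \<open>The value of \<open>b1\<close> at 0 vanishes; at \<theta> = \<phi> the terms
      \<open>ellq\<close> and \<open>b1\<close> coincide, and each gives half of the elementary
      part.\<close>
    moreover have "(1 * ellq k \<phi> (\<phi> * 1) + b1 \<phi> (\<phi> * 1)) - (0 * ellq k \<phi> (\<phi> * 0) + b1 \<phi> (\<phi> * 0)) = 2 * k\<^sup>2 * sin \<phi> * cos \<phi> / (ell_delta k \<phi>)\<^sup>2"
      by (simp add: ellq_def b1_def field_simps power2_eq_square)
    ultimately show ?thesis unfolding m'_eq[symmetric] by (simp add: integral_unique)
  qed
  ultimately show ?thesis
    using \<phi> by (auto intro: has_field_derivative_transform_within[of _ _ _ _ 1])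
qed

section \<open>Monotonicity bounds in the amplitude\<close>

lemma incF_le_gd:
  assumes "0 \<le> \<phi>" "\<phi> < pi / 2"
  shows "incF k \<phi> \<le> ln ((1 + sin \<phi>) / cos \<phi>)"
proof -
  have "ln ((1 + sin 0) / cos 0) - incF k 0 \<le> ln ((1 + sin \<phi>) / cos \<phi>) - incF k \<phi>"
  proof (rule nonneg_deriv_within_imp_le[OF assms(1), where f = "\<lambda>x. ln ((1 + sin x) / cos x) - incF k x"
        and f' = "\<lambda>x. 1 / cos x - 1 / ell_delta k x"])
    fix x assume x: "x \<in> {0..\<phi>}"
    then have c: "cos x > 0" and s: "sin x \<ge> 0" using assms by (auto intro!: cos_gt_zero_pi sin_ge_zero)
    have "((\<lambda>x. ln ((1 + sin x) / cos x)) has_real_derivative 1 / cos x) (at x within {0..\<phi>})"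
    proof -
      have "((\<lambda>x. ln ((1 + sin x) / cos x)) has_real_derivative
          1 / ((1 + sin x) / cos x) * ((cos x * cos x - (1 + sin x) * (- sin x)) / (cos x * cos x))) (at x within {0..\<phi>})"
        using c s by (auto intro!: derivative_eq_intros)
      moreover have "1 / ((1 + sin x) / cos x) * ((cos x * cos x - (1 + sin x) * (- sin x)) / (cos x * cos x)) = 1 / cos x"
      proof -
        have "cos x * cos x - (1 + sin x) * (- sin x) = 1 + sin x"
          using sin_cos_squared_add[of x] by (simp add: power2_eq_square algebra_simps)
        moreover have "1 / (a / b) * (a / (b * b)) = 1 / b" if "a > 0" "b > 0" for a b :: real
          using that by simp
        ultimately show ?thesis using c s by simp
      qed
      ultimately show ?thesis by (simp only:)
    qed
    then show "((\<lambda>x. ln ((1 + sin x) / cos x) - incF k x) has_real_derivative 1 / cos x - 1 / ell_delta k x) (at x within {0..\<phi>})"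
      using x by (intro DERIV_diff incF_deriv)
    \<comment> \<open>The logarithm is the inverse Gudermannian function, which is the integral of
      the first kind for modulus 1; the claim is monotonicity in the modulus.\<close>
    have "(cos x)\<^sup>2 \<le> (ell_delta k x)\<^sup>2"
      using mult_left_le[of "k\<^sup>2" "(sin x)\<^sup>2"] k2 by (simp add: ell_delta_sq cos_squared_eq mult.commute)
    then have "cos x \<le> ell_delta k x" by (rule power2_le_imp_le) (use ell_delta_pos[of x] in simp)
    then show "0 \<le> 1 / cos x - 1 / ell_delta k x" using frac_le[of 1 1 "cos x" "ell_delta k x"] c by simp
  qed
  then show ?thesis by simp
qed

text \<open>The difference \<open>H\<close> of the two sides vanishes at 0 and has derivative
  \<open>4 * M / \<Delta>\<close>, since the terms with \<Delta> times \<open>incF\<close> cancel.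
  In turn, \<open>M\<close> is \<open>1 - k^2\<close> times the integral of
  \<open>1 / \<Delta>^3 - 1 / \<Delta>\<close>, written in closed form, and hence
  nonnegative.\<close>

lemma ellQ_le:
  assumes "0 \<le> \<phi>"
  shows "ellQ k \<phi> \<le> 2 * incF k \<phi> * incE k \<phi> + 2 * ln (ell_delta k \<phi>) - 2 * (1 - k\<^sup>2) * (incF k \<phi>)\<^sup>2"
proof -
  define M where "M x = incE k x - k\<^sup>2 * (sin x * cos x / ell_delta k x) - (1 - k\<^sup>2) * incF k x" for x
  have M: "M \<psi> \<ge> 0" if "0 \<le> \<psi>" for \<psi>
  proof -
    have "M 0 \<le> M \<psi>"
    proof (rule nonneg_deriv_within_imp_le[OF that, where f = M and f' = "\<lambda>x. (1 - k\<^sup>2) * (1 / ell_delta k x ^ 3 - 1 / ell_delta k x)"])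
      fix x assume x: "x \<in> {0..\<psi>}"
      have eq: "d - \<kappa> * (((c\<^sup>2 - s\<^sup>2) * d - s * c * (- (\<kappa> * s * c) / d)) / d\<^sup>2) = (1 - \<kappa>) * (1 / d ^ 3)"
        if "d \<noteq> 0" "d\<^sup>2 = 1 - \<kappa> * s\<^sup>2" "c\<^sup>2 = 1 - s\<^sup>2" for d \<kappa> s c :: real
      proof -
        have "d ^ 4 - \<kappa> * ((c\<^sup>2 - s\<^sup>2) * d\<^sup>2 + \<kappa> * s\<^sup>2 * c\<^sup>2) = 1 - \<kappa>"
        proof -
          have "d ^ 4 = (d\<^sup>2)\<^sup>2" by simp
          then show ?thesis unfolding that by (simp add: power2_eq_square algebra_simps)
        qed
        moreover have "d - \<kappa> * (((c\<^sup>2 - s\<^sup>2) * d - s * c * (- (\<kappa> * s * c) / d)) / d\<^sup>2)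
           = (d ^ 4 - \<kappa> * ((c\<^sup>2 - s\<^sup>2) * d\<^sup>2 + \<kappa> * s\<^sup>2 * c\<^sup>2)) / d ^ 3"
          using that(1) by (simp add: divide_simps) (simp add: power2_eq_square power3_eq_cube power4_eq_xxxx algebra_simps)
        ultimately show ?thesis by simp
      qed
      have "((\<lambda>x. sin x * cos x / ell_delta k x) has_real_derivative
         ((((cos x)\<^sup>2 - (sin x)\<^sup>2) * ell_delta k x - sin x * cos x * (- (k\<^sup>2 * sin x * cos x) / ell_delta k x)) / (ell_delta k x)\<^sup>2)) (at x within {0..\<psi>})"
        by (auto intro!: derivative_eq_intros ell_delta_deriv simp: power2_eq_square algebra_simps)
      then have "(M has_real_derivative ell_delta k x - k\<^sup>2 *
         ((((cos x)\<^sup>2 - (sin x)\<^sup>2) * ell_delta k x - sin x * cos x * (- (k\<^sup>2 * sin x * cos x) / ell_delta k x)) / (ell_delta k x)\<^sup>2)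
         - (1 - k\<^sup>2) * (1 / ell_delta k x)) (at x within {0..\<psi>})"
        unfolding M_def[abs_def] using x by (intro DERIV_diff DERIV_cmult incF_deriv incE_deriv)
      moreover have "ell_delta k x - k\<^sup>2 *
         ((((cos x)\<^sup>2 - (sin x)\<^sup>2) * ell_delta k x - sin x * cos x * (- (k\<^sup>2 * sin x * cos x) / ell_delta k x)) / (ell_delta k x)\<^sup>2)
         = (1 - k\<^sup>2) * (1 / ell_delta k x ^ 3)"
        by (rule eq) (simp_all add: ell_delta_sq cos_squared_eq)
      ultimately show "(M has_real_derivative (1 - k\<^sup>2) * (1 / ell_delta k x ^ 3 - 1 / ell_delta k x)) (at x within {0..\<psi>})"
        by (simp add: right_diff_distrib)
      have "ell_delta k x ^ 3 \<le> ell_delta k x"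
        using power_decreasing[of 1 3 "ell_delta k x"] ell_delta_pos[of x] ell_delta_le_1[of x] by simp
      then show "0 \<le> (1 - k\<^sup>2) * (1 / ell_delta k x ^ 3 - 1 / ell_delta k x)"
        using k2 ell_delta_pos[of x] frac_le[of 1 1 "ell_delta k x ^ 3" "ell_delta k x"]
        by (intro mult_nonneg_nonneg) simp_all
    qed
    then show ?thesis by (simp add: M_def)
  qed
  define H where "H x = 2 * (incF k x * incE k x) + 2 * ln (ell_delta k x) - 2 * (1 - k\<^sup>2) * (incF k x)\<^sup>2 - ellQ k x" for x
  have "H 0 \<le> H \<phi>"
  proof (rule nonneg_deriv_within_imp_le[OF assms, where f = H and f' = "\<lambda>x. 4 / ell_delta k x * M x"])
    fix x assume x: "x \<in> {0..\<phi>}"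
    have dln: "((\<lambda>x. ln (ell_delta k x)) has_real_derivative - (k\<^sup>2 * sin x * cos x / (ell_delta k x)\<^sup>2)) (at x within {0..\<phi>})"
      using ell_delta_pos[of x] by (auto intro!: derivative_eq_intros ell_delta_deriv simp: power2_eq_square field_simps)
    have dF2: "((\<lambda>x. (incF k x)\<^sup>2) has_real_derivative 2 * incF k x * (1 / ell_delta k x)) (at x within {0..\<phi>})"
      using x by (auto intro!: derivative_eq_intros incF_deriv)
    have "(H has_real_derivative 2 * (1 / ell_delta k x * incE k x + ell_delta k x * incF k x) + 2 * (- (k\<^sup>2 * sin x * cos x / (ell_delta k x)\<^sup>2))
        - 2 * (1 - k\<^sup>2) * (2 * incF k x * (1 / ell_delta k x)) - (2 * k\<^sup>2 * sin x * cos x / (ell_delta k x)\<^sup>2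
    + 2 * (ell_delta k x * incF k x - incE k x / ell_delta k x))) (at x within {0..\<phi>})"
      unfolding H_def[abs_def] using x
      by (intro DERIV_diff DERIV_add DERIV_cmult DERIV_mult dln dF2 ellQ_deriv incF_deriv incE_deriv)
    moreover have "2 * (1 / d * e + d * f) + 2 * (- (\<kappa> * s * c / d\<^sup>2)) - 2 * (1 - \<kappa>) * (2 * f * (1 / d)) - (2 * \<kappa> * s * c / d\<^sup>2 + 2 * (d * f - e / d))
        = 4 / d * (e - \<kappa> * (s * c / d) - (1 - \<kappa>) * f)" if "d \<noteq> 0" for d e f \<kappa> s c :: real
      using that by (simp add: divide_simps) (simp add: algebra_simps power2_eq_square)
    ultimately show "(H has_real_derivative 4 / ell_delta k x * M x) (at x within {0..\<phi>})"
      by (simp only: ell_delta_neq_0 M_def not_False_eq_True)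
    show "0 \<le> 4 / ell_delta k x * M x" using M[of x] x ell_delta_pos[of x] by simp
  qed
  moreover have "H 0 = 0" by (simp add: H_def ellQ_def ell_delta_def)
  ultimately show ?thesis by (simp add: H_def)
qed

text \<open>The left-hand side is the logarithm of the capacity itself; the inequality loses
  \<open>incF k \<phi> \<le> ln ((1 + sin \<phi>) / cos \<phi>)\<close> and the estimate \<open>ellQ_le\<close>.\<close>

lemma elliptic_estimate:
  assumes "0 \<le> \<phi>" "\<phi> < pi / 2"
  shows "ln (1 / 2) - 2 * incF k \<phi> * (sin \<phi> * cos \<phi> * ell_delta k \<phi> * ellP k \<phi> / ellK k) + ellQ k \<phi>
    \<le> ln (1 / 2) + 2 * ln (ell_delta k \<phi>) + 2 * (ellE k / ellK k - (1 - k\<^sup>2)) * (ln ((1 + sin \<phi>) / cos \<phi>))\<^sup>2"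
proof -
  let ?L = "ln ((1 + sin \<phi>) / cos \<phi>)"
  have "0 \<le> incF k \<phi>" using incF_diff_ge[of 0 \<phi>] assms by simp
  then have "(incF k \<phi>)\<^sup>2 \<le> ?L\<^sup>2" using incF_le_gd[OF assms] by (intro power_mono)
  moreover have "ellE k / ellK k - (1 - k\<^sup>2) \<ge> 0" using ellE_ellK ellK_pos by (simp add: field_simps)
  ultimately have "(ellE k / ellK k - (1 - k\<^sup>2)) * (incF k \<phi>)\<^sup>2 \<le> (ellE k / ellK k - (1 - k\<^sup>2)) * ?L\<^sup>2"
    by (rule mult_left_mono)
  moreover have eq: "sin \<phi> * cos \<phi> * ell_delta k \<phi> * ellP k \<phi> / ellK k = incE k \<phi> - ellE k / ellK k * incF k \<phi>"
    using ellP_eq[of \<phi>] assms ellK_pos by (simp add: field_simps)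
  have "2 * incF k \<phi> * (sin \<phi> * cos \<phi> * ell_delta k \<phi> * ellP k \<phi> / ellK k)
      = 2 * incF k \<phi> * incE k \<phi> - 2 * (ellE k / ellK k) * (incF k \<phi>)\<^sup>2"
    unfolding eq by (simp add: power2_eq_square algebra_simps)
  moreover have "(ellE k / ellK k - (1 - k\<^sup>2)) * (incF k \<phi>)\<^sup>2
      = ellE k / ellK k * (incF k \<phi>)\<^sup>2 - (1 - k\<^sup>2) * (incF k \<phi>)\<^sup>2"
    by (rule left_diff_distrib)
  ultimately show ?thesis using ellQ_le[OF assms(1)] unfolding mult.assoc by linarith
qed

end

section \<open>Uniformization\<close>

lemma image_Ioo_of_pos_deriv:
  fixes g :: "real \<Rightarrow> real"
  assumes "a < b" and cont: "continuous_on {a..b} g"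
    and D: "\<And>x. x \<in> {a<..<b} \<Longrightarrow> (g has_real_derivative g' x) (at x)"
    and pos: "\<And>x. x \<in> {a<..<b} \<Longrightarrow> g' x > 0"
  shows "g ` {a<..<b} = {g a<..<g b}" and "inj_on g {a<..<b}"
proof -
  have less: "g x < g y" if "a \<le> x" "x < y" "y \<le> b" for x y
  proof (rule DERIV_pos_imp_increasing_open[OF \<open>x < y\<close>])
    show "continuous_on {x..y} g" by (rule continuous_on_subset[OF cont]) (use that in auto)
    fix z assume "x < z" "z < y"
    then have "z \<in> {a<..<b}" using that by auto
    then show "\<exists>l. (g has_real_derivative l) (at z) \<and> 0 < l" using D pos by blast
  qed
  show "inj_on g {a<..<b}"
  proof (rule inj_onI)
    fix x y assume "x \<in> {a<..<b}" "y \<in> {a<..<b}" "g x = g y"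
    then show "x = y" using less[of x y] less[of y x] by (cases x y rule: linorder_cases) auto
  qed
  show "g ` {a<..<b} = {g a<..<g b}"
  proof (intro equalityI subsetI)
    fix y assume "y \<in> {g a<..<g b}"
    then obtain x where x: "a \<le> x" "x \<le> b" "g x = y"
      using IVT'[of g a y b] cont \<open>a < b\<close> by auto
    with \<open>y \<in> {g a<..<g b}\<close> show "y \<in> g ` {a<..<b}" by (intro image_eqI[of _ _ x]) (auto simp: less_le)
  qed (use less in auto)
qed

text \<open>\<open>f\<close> may be unbounded at an end that is a branch point; only the transformed
  integrand \<open>H\<close> is continuous on the closed interval. Hence the change of variables is
  made on the open interval, for absolutely integrable functions.\<close>

lemma integral_image_Ioo:
  fixes f g :: "real \<Rightarrow> real"
  assumes ab: "a < b" and cont: "continuous_on {a..b} g"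
    and D: "\<And>x. x \<in> {a<..<b} \<Longrightarrow> (g has_real_derivative g' x) (at x)"
    and pos: "\<And>x. x \<in> {a<..<b} \<Longrightarrow> g' x > 0"
    and H: "continuous_on {a..b} H" and eq: "\<And>x. x \<in> {a<..<b} \<Longrightarrow> g' x * f (g x) = H x"
  shows "integral {g a<..<g b} f = integral {a..b} H"
proof -
  have eq': "\<bar>g' x\<bar> * f (g x) = H x" if "x \<in> {a<..<b}" for x
    using eq[OF that] pos[OF that] by simp
  have "H absolutely_integrable_on {a<..<b}"
    using absolutely_integrable_continuous_real[OF H] by (simp only: absolutely_integrable_on_Icc_iff_Ioo)
  then have "(\<lambda>x. \<bar>g' x\<bar> * f (g x)) absolutely_integrable_on {a<..<b}"
    by (rule absolutely_integrable_spike[of _ _ "{}"]) (use eq' in auto)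
  moreover have "integral {a<..<b} (\<lambda>x. \<bar>g' x\<bar> * f (g x)) = integral {a..b} H"
    unfolding integral_open_interval_real by (rule integral_cong) (use eq' in auto)
  moreover have "(\<lambda>x. \<bar>g' x\<bar> * f (g x)) absolutely_integrable_on {a<..<b} \<and>
      integral {a<..<b} (\<lambda>x. \<bar>g' x\<bar> * f (g x)) = integral {a..b} H
    \<longleftrightarrow> f absolutely_integrable_on g ` {a<..<b} \<and> integral (g ` {a<..<b}) f = integral {a..b} H"
    by (rule has_absolute_integral_change_of_variables_1')
      (use D image_Ioo_of_pos_deriv(2)[OF ab cont D pos] in \<open>auto intro: has_field_derivative_at_within\<close>)
  ultimately show ?thesis using image_Ioo_of_pos_deriv(1)[OF ab cont D pos] by simp
qed

lemma sqrt_abs_eq: "\<bar>X\<bar> = y\<^sup>2 \<Longrightarrow> y \<ge> 0 \<Longrightarrow> sqrt \<bar>X\<bar> = y" for X y :: real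
  by simp

section \<open>Endpoints in terms of the amplitude\<close>

definition gap_left :: "real \<Rightarrow> real" where
  "gap_left \<phi> = 1 - 2 * (sin \<phi>)\<^sup>2"

definition gap_right :: "real \<Rightarrow> real \<Rightarrow> real" where
  "gap_right k \<phi> = 2 * (cos \<phi>)\<^sup>2 / (ell_delta k \<phi>)\<^sup>2 - 1"

context
  fixes k \<phi> :: real
  assumes k: "0 < k" "k < 1" and \<phi>: "0 < \<phi>" "\<phi> < pi / 2"
begin

definition "s0 = sin \<phi>"
definition "c0 = cos \<phi>"
definition "d0 = ell_delta k \<phi>"
abbreviation "alpha0 \<equiv> gap_left \<phi>"
abbreviation "beta0 \<equiv> gap_right k \<phi>"

lemma alpha0_eq: "alpha0 = 1 - 2 * s0\<^sup>2" and beta0_eq: "beta0 = 2 * c0\<^sup>2 / d0\<^sup>2 - 1"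
  by (simp_all add: gap_left_def gap_right_def s0_def c0_def d0_def)

lemma pos0: "s0 > 0" "c0 > 0" "d0 > 0"
  using \<phi> ell_delta_pos[OF k, of \<phi>] by (auto simp: s0_def c0_def d0_def sin_gt_zero cos_gt_zero)

lemma sq0: "c0\<^sup>2 = 1 - s0\<^sup>2" "d0\<^sup>2 = 1 - k\<^sup>2 * s0\<^sup>2"
  by (simp_all add: s0_def c0_def d0_def ell_delta_sq[OF k] cos_squared_eq)

lemma endpoints0: "-1 < alpha0" "alpha0 < beta0" "beta0 < 1"
proof -
  have c: "0 < c0\<^sup>2" and s: "0 < s0\<^sup>2" and d: "0 < d0\<^sup>2" using pos0 by auto
  note kk = k2[OF k]
  show "-1 < alpha0" using c sq0(1) by (simp add: alpha0_eq)
  have "k\<^sup>2 * s0\<^sup>2 > 0" "k\<^sup>2 * s0\<^sup>2 < s0\<^sup>2" using kk s by auto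
  then have "d0\<^sup>2 < 1" "c0\<^sup>2 < d0\<^sup>2" unfolding sq0 by auto
  then have "c0\<^sup>2 < c0\<^sup>2 / d0\<^sup>2" "c0\<^sup>2 / d0\<^sup>2 < 1" using c d by (auto simp: field_simps)
  moreover have "beta0 = 2 * (c0\<^sup>2 / d0\<^sup>2) - 1" "alpha0 = 2 * c0\<^sup>2 - 1"
    using sq0(1) by (simp_all add: alpha0_eq beta0_eq)
  ultimately show "alpha0 < beta0" "beta0 < 1" by linarith+
qed

section \<open>Integrals over the gap\<close>

definition "zbar = ellP k \<phi> / ellK k"
text \<open>The mean of \<open>gapx\<close> for the density
  \<open>1 / (ellK k * ell_delta k \<theta>)\<close> on \<open>{0..pi / 2}\<close>, which is what
  the gap condition demands after substitution; as a mean it lies between the endpoints. Likewise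
  \<open>zbar\<close> is the mean of \<open>k^2 sin^2 \<theta> / charw \<theta>\<close>.\<close>

definition "crit = 2 * c0\<^sup>2 - 1 + 2 * c0\<^sup>2 * s0\<^sup>2 * zbar"

definition "charw \<theta> = 1 - k\<^sup>2 * s0\<^sup>2 * (sin \<theta>)\<^sup>2"
text \<open>A Moebius function of \<open>sin^2 \<theta>\<close> that sends 0, 1, 1/k^2 and infinity
  to \<alpha>, \<beta>, 1 and -1, so that the square root over the four branch points takes
  Legendre's form with modulus \<open>k\<close>.\<close>

definition "gapx \<theta> = -1 + 2 * c0\<^sup>2 / charw \<theta>"

lemma charw_pos: "charw \<theta> > 0"
  using char_pos[OF k, of \<phi> \<theta>] by (simp add: charw_def s0_def)

lemma charw_neq [simp]: "charw \<theta> \<noteq> 0" using charw_pos[of \<theta>] by simp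

lemma charw_neq' [simp]: "k\<^sup>2 * s0\<^sup>2 * (sin \<theta>)\<^sup>2 \<noteq> 1"
  using charw_pos[of \<theta>] by (simp add: charw_def)

lemma gapx_ends: "gapx 0 = alpha0" "gapx (pi / 2) = beta0"
  using sq0 by (simp_all add: gapx_def charw_def alpha0_eq beta0_eq)

lemma continuous_on_gapx: "continuous_on A gapx"
  unfolding gapx_def charw_def by (intro continuous_intros) auto

lemma gapx_deriv: "(gapx has_real_derivative 4 * c0\<^sup>2 * k\<^sup>2 * s0\<^sup>2 * sin \<theta> * cos \<theta> / (charw \<theta>)\<^sup>2) (at \<theta>)"
proof -
  have "(charw has_real_derivative - (2 * k\<^sup>2 * s0\<^sup>2 * sin \<theta> * cos \<theta>)) (at \<theta>)"
    unfolding charw_def[abs_def] by (auto intro!: derivative_eq_intros)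
  then show ?thesis unfolding gapx_def[abs_def]
    by (auto intro!: derivative_eq_intros simp: power2_eq_square)
qed

lemma incr_pos: "0 < \<theta> \<Longrightarrow> \<theta> < pi / 2 \<Longrightarrow> sin \<theta> > 0 \<and> cos \<theta> > 0"
  by (simp add: sin_gt_zero cos_gt_zero)

lemma gapx_deriv_pos:
  "\<theta> \<in> {0<..<pi / 2} \<Longrightarrow> 4 * c0\<^sup>2 * k\<^sup>2 * s0\<^sup>2 * sin \<theta> * cos \<theta> / (charw \<theta>)\<^sup>2 > 0"
  using incr_pos[of \<theta>] pos0 k by simp

text \<open>Up to sign, the differences between \<open>gapx \<theta>\<close> and the four branch
  points are positive constants times 1, \<open>sin^2 \<theta>\<close>,
  \<open>cos^2 \<theta>\<close> and \<open>\<Delta>^2\<close>, each over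
  \<open>charw \<theta>\<close>. The root of their product is therefore explicit, and of its
  trigonometric factors only \<open>1 / \<Delta>\<close> survives multiplication by the
  derivative.\<close>

lemma gapx_force:
  assumes "\<theta> \<in> {0<..<pi / 2}"
  shows "4 * c0\<^sup>2 * k\<^sup>2 * s0\<^sup>2 * sin \<theta> * cos \<theta> / (charw \<theta>)\<^sup>2 *
     ((gapx \<theta> - m) / sqrt \<bar>branch_poly alpha0 beta0 (gapx \<theta>)\<bar>)
    = d0 / (s0 * c0) * ((gapx \<theta> - m) * (1 / ell_delta k \<theta>))"
proof -
  define S where "S = sin \<theta>"
  define C where "C = cos \<theta>"
  define D where "D = ell_delta k \<theta>"
  define w where "w = charw \<theta>"
  have pos: "S > 0" "C > 0" "D > 0" "w > 0"
    using assms incr_pos[of \<theta>] ell_delta_pos[OF k, of \<theta>] charw_pos[of \<theta>] by (auto simp: S_def C_def D_def w_def)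
  have sq: "C\<^sup>2 = 1 - S\<^sup>2" "D\<^sup>2 = 1 - k\<^sup>2 * S\<^sup>2" "w = 1 - k\<^sup>2 * s0\<^sup>2 * S\<^sup>2"
    by (simp_all add: S_def C_def D_def w_def charw_def ell_delta_sq[OF k] cos_squared_eq)
  have f1: "gapx \<theta> + 1 = 2 * c0\<^sup>2 / w" by (simp add: gapx_def w_def)
  have f2: "gapx \<theta> - alpha0 = 2 * c0\<^sup>2 * k\<^sup>2 * s0\<^sup>2 * S\<^sup>2 / w"
  proof -
    have "gapx \<theta> - alpha0 = 2 * c0\<^sup>2 / w - 2 * c0\<^sup>2" using sq0(1) by (simp add: gapx_def w_def alpha0_eq)
    also have "\<dots> = 2 * c0\<^sup>2 * (1 - w) / w" using pos by (simp add: field_simps)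
    also have "1 - w = k\<^sup>2 * s0\<^sup>2 * S\<^sup>2" by (simp add: sq)
    finally show ?thesis by (simp add: mult_ac)
  qed
  have f3: "gapx \<theta> - beta0 = - (2 * c0\<^sup>2 * k\<^sup>2 * s0\<^sup>2 * C\<^sup>2 / (d0\<^sup>2 * w))"
  proof -
    have "gapx \<theta> - beta0 = 2 * c0\<^sup>2 / w - 2 * c0\<^sup>2 / d0\<^sup>2" by (simp add: gapx_def w_def beta0_eq)
    also have "\<dots> = - (2 * c0\<^sup>2 * (w - d0\<^sup>2) / (d0\<^sup>2 * w))" using pos pos0 by (simp add: field_simps)
    also have "w - d0\<^sup>2 = k\<^sup>2 * s0\<^sup>2 * C\<^sup>2" unfolding sq0 sq by (simp add: algebra_simps)
    finally show ?thesis by (simp add: mult_ac)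
  qed
  have f4: "gapx \<theta> - 1 = - (2 * s0\<^sup>2 * D\<^sup>2 / w)"
  proof -
    have "gapx \<theta> - 1 = - (2 * (w - c0\<^sup>2) / w)" using pos by (simp add: gapx_def w_def[symmetric] field_simps)
    also have "w - c0\<^sup>2 = s0\<^sup>2 * D\<^sup>2" unfolding sq0 sq by (simp add: algebra_simps)
    finally show ?thesis by (simp add: mult_ac)
  qed
  have "\<bar>branch_poly alpha0 beta0 (gapx \<theta>)\<bar> = (4 * c0 ^ 3 * k\<^sup>2 * s0 ^ 3 * S * C * D / (d0 * w\<^sup>2))\<^sup>2"
    unfolding branch_poly_def f1 f2 f3 f4 using pos pos0 k
    by (simp add: abs_mult power_divide power_mult_distrib) (simp add: field_simps eval_nat_numeral)
  then have "sqrt \<bar>branch_poly alpha0 beta0 (gapx \<theta>)\<bar> = 4 * c0 ^ 3 * k\<^sup>2 * s0 ^ 3 * S * C * D / (d0 * w\<^sup>2)"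
    by (rule sqrt_abs_eq) (use pos pos0 in simp)
  note rt = this
  show ?thesis
    unfolding rt S_def[symmetric] C_def[symmetric] D_def[symmetric] w_def[symmetric]
    using pos pos0 k by (simp add: field_simps eval_nat_numeral)
qed

lemma gap_integral:
  "integral {alpha0<..<beta0} (\<lambda>x. (x - m) / sqrt \<bar>branch_poly alpha0 beta0 x\<bar>)
    = d0 / (s0 * c0) * integral {0..pi / 2} (\<lambda>\<theta>. (gapx \<theta> - m) * (1 / ell_delta k \<theta>))"
proof -
  have "integral {gapx 0<..<gapx (pi / 2)} (\<lambda>x. (x - m) / sqrt \<bar>branch_poly alpha0 beta0 x\<bar>)
    = integral {0..pi / 2} (\<lambda>\<theta>. d0 / (s0 * c0) * ((gapx \<theta> - m) * (1 / ell_delta k \<theta>)))"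
    by (rule integral_image_Ioo[OF _ continuous_on_gapx gapx_deriv gapx_deriv_pos _ gapx_force])
      (use pos0 in \<open>auto intro!: continuous_intros continuous_on_gapx continuous_on_ell_delta[OF k] simp: ell_delta_neq_0[OF k]\<close>)
  then show ?thesis unfolding gapx_ends integral_mult_right .
qed

lemma gapx_mean: "((\<lambda>\<theta>. gapx \<theta> * (1 / ell_delta k \<theta>)) has_integral crit * ellK k) {0..pi / 2}"
proof -
  have "((\<lambda>\<theta>. 1 / ell_delta k \<theta>) has_integral ellK k) {0..pi / 2}"
    unfolding ellK_eq incF_def
    by (intro integrable_integral integrable_continuous_interval continuous_intros continuous_on_ell_delta[OF k])
      (auto simp: ell_delta_neq_0[OF k])
  moreover have "((\<lambda>\<theta>. k\<^sup>2 * (sin \<theta>)\<^sup>2 / (charw \<theta> * ell_delta k \<theta>)) has_integral ellP k \<phi>) {0..pi / 2}"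
    unfolding ellP_def s0_def[symmetric] charw_def[symmetric]
    by (intro integrable_integral integrable_continuous_interval continuous_intros continuous_on_ell_delta[OF k])
      (use k in \<open>auto simp: ell_delta_neq_0[OF k] charw_def intro!: continuous_intros\<close>)
  ultimately have "((\<lambda>\<theta>. (2 * c0\<^sup>2 - 1) * (1 / ell_delta k \<theta>) + 2 * c0\<^sup>2 * s0\<^sup>2 * (k\<^sup>2 * (sin \<theta>)\<^sup>2 / (charw \<theta> * ell_delta k \<theta>)))
     has_integral (2 * c0\<^sup>2 - 1) * ellK k + 2 * c0\<^sup>2 * s0\<^sup>2 * ellP k \<phi>) {0..pi / 2}"
    by (intro has_integral_add has_integral_mult_right)
  moreover have "(2 * c0\<^sup>2 - 1) * (1 / ell_delta k \<theta>) + 2 * c0\<^sup>2 * s0\<^sup>2 * (k\<^sup>2 * (sin \<theta>)\<^sup>2 / (charw \<theta> * ell_delta k \<theta>))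
      = gapx \<theta> * (1 / ell_delta k \<theta>)" for \<theta>
  proof -
    have "1 / charw \<theta> = 1 + s0\<^sup>2 * (k\<^sup>2 * (sin \<theta>)\<^sup>2) / charw \<theta>"
    proof -
      have "1 = charw \<theta> + s0\<^sup>2 * (k\<^sup>2 * (sin \<theta>)\<^sup>2)" by (simp add: charw_def)
      then have "1 / charw \<theta> = (charw \<theta> + s0\<^sup>2 * (k\<^sup>2 * (sin \<theta>)\<^sup>2)) / charw \<theta>" by simp
      then show ?thesis by (simp add: add_divide_distrib)
    qed
    note w = this
    have "gapx \<theta> = -1 + 2 * c0\<^sup>2 * (1 / charw \<theta>)" by (simp add: gapx_def)
    also have "\<dots> = 2 * c0\<^sup>2 - 1 + 2 * c0\<^sup>2 * (s0\<^sup>2 * (k\<^sup>2 * (sin \<theta>)\<^sup>2) / charw \<theta>)"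
      unfolding w by (simp add: distrib_left)
    finally have "gapx \<theta> * (1 / ell_delta k \<theta>) = (2 * c0\<^sup>2 - 1) * (1 / ell_delta k \<theta>)
        + 2 * c0\<^sup>2 * (s0\<^sup>2 * (k\<^sup>2 * (sin \<theta>)\<^sup>2) / charw \<theta>) * (1 / ell_delta k \<theta>)"
      by (simp only: distrib_right)
    then show ?thesis by (simp add: mult_ac)
  qed
  ultimately show ?thesis
    using ellK_pos[OF k] by (simp add: crit_def zbar_def distrib_right)
qed

lemma gap_condition: "integral {alpha0<..<beta0} (\<lambda>x. (x - crit) / sqrt \<bar>branch_poly alpha0 beta0 x\<bar>) = 0"
proof -
  have "((\<lambda>\<theta>. crit * (1 / ell_delta k \<theta>)) has_integral crit * ellK k) {0..pi / 2}"
    unfolding ellK_eq incF_def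
    by (intro has_integral_mult_right integrable_integral integrable_continuous_interval continuous_intros continuous_on_ell_delta[OF k])
      (auto simp: ell_delta_neq_0[OF k])
  from has_integral_diff[OF gapx_mean this]
  have "((\<lambda>\<theta>. (gapx \<theta> - crit) * (1 / ell_delta k \<theta>)) has_integral 0) {0..pi / 2}"
    by (simp only: left_diff_distrib) simp
  then show ?thesis unfolding gap_integral by (simp add: integral_unique)
qed

lemma crit_bounds: "alpha0 \<le> crit" "crit \<le> beta0"
proof -
  have g: "alpha0 \<le> gapx \<theta>" "gapx \<theta> \<le> beta0" if "\<theta> \<in> {0..pi / 2}" for \<theta>
  proof -
    have "(sin \<theta>)\<^sup>2 \<le> 1" by (simp add: abs_square_le_1)
    then have "k\<^sup>2 * s0\<^sup>2 * (sin \<theta>)\<^sup>2 \<le> k\<^sup>2 * s0\<^sup>2 * 1" by (intro mult_left_mono) auto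
    then have "d0\<^sup>2 \<le> charw \<theta>" "charw \<theta> \<le> 1" by (auto simp: charw_def sq0)
    then have "2 * c0\<^sup>2 / 1 \<le> 2 * c0\<^sup>2 / charw \<theta>" "2 * c0\<^sup>2 / charw \<theta> \<le> 2 * c0\<^sup>2 / d0\<^sup>2"
      using pos0 charw_pos[of \<theta>] by (intro divide_left_mono; simp)+
    then show "alpha0 \<le> gapx \<theta>" "gapx \<theta> \<le> beta0" using sq0(1) by (auto simp: gapx_def alpha0_eq beta0_eq)
  qed
  have K: "((\<lambda>\<theta>. m * (1 / ell_delta k \<theta>)) has_integral m * ellK k) {0..pi / 2}" for m
    unfolding ellK_eq incF_def
    by (intro has_integral_mult_right integrable_integral integrable_continuous_interval continuous_intros continuous_on_ell_delta[OF k])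
      (auto simp: ell_delta_neq_0[OF k])
  have nn: "0 \<le> 1 / ell_delta k \<theta>" for \<theta> using ell_delta_pos[OF k, of \<theta>] by simp
  have "alpha0 * ellK k \<le> crit * ellK k"
    by (rule has_integral_le[OF K gapx_mean]) (use g nn in \<open>auto intro!: mult_right_mono simp del: times_divide_eq_right\<close>)
  then show "alpha0 \<le> crit" using ellK_pos[OF k] by simp
  have "crit * ellK k \<le> beta0 * ellK k"
    by (rule has_integral_le[OF gapx_mean K]) (use g nn in \<open>auto intro!: mult_right_mono simp del: times_divide_eq_right\<close>)
  then show "crit \<le> beta0" using ellK_pos[OF k] by simp
qed

section \<open>The integral to the left of -1\<close>

definition "leftT \<theta> = s0\<^sup>2 - (sin \<theta>)\<^sup>2"
text \<open>Here \<open>- leftx \<theta>\<close> runs from -1 to minus infinity as \<theta> goes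
  from 0 to \<phi>. As values of \<open>sin^2 \<theta>\<close>, the points 0, 1, 1/k^2 and infinity
  go to -1, 1, \<beta> and \<alpha>, and the pole sits at \<open>sin^2 \<phi>\<close>. The sign is
  reversed to have an increasing substitution.\<close>

definition "leftx \<theta> = 1 + 2 * c0\<^sup>2 * (sin \<theta>)\<^sup>2 / leftT \<theta>"

text \<open>In this form \<open>2 * s0 * c0 / leftT \<theta>\<close> is the sum of the cotangents of
  \<phi> - \<theta> and \<phi> + \<theta>, which has a logarithmic antiderivative.\<close>

lemma leftT_eq: "leftT \<theta> = sin (\<phi> + \<theta>) * sin (\<phi> - \<theta>)"
proof -
  have "sin (\<phi> + \<theta>) * sin (\<phi> - \<theta>) = (sin \<phi>)\<^sup>2 * (cos \<theta>)\<^sup>2 - (cos \<phi>)\<^sup>2 * (sin \<theta>)\<^sup>2"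
    by (simp add: sin_add sin_diff power2_eq_square algebra_simps)
  then show ?thesis by (simp add: leftT_def s0_def cos_squared_eq algebra_simps)
qed

lemma leftT_pos:
  assumes "0 \<le> \<theta>" "\<theta> < \<phi>"
  shows "sin (\<phi> + \<theta>) > 0" "sin (\<phi> - \<theta>) > 0" "leftT \<theta> > 0"
proof -
  show *: "sin (\<phi> + \<theta>) > 0" "sin (\<phi> - \<theta>) > 0" using assms \<phi> by (auto intro!: sin_gt_zero)
  show "leftT \<theta> > 0" unfolding leftT_eq using * by simp
qed

lemma leftx_deriv:
  assumes "0 \<le> \<theta>" "\<theta> < \<phi>"
  shows "(leftx has_real_derivative 4 * c0\<^sup>2 * s0\<^sup>2 * sin \<theta> * cos \<theta> / (leftT \<theta>)\<^sup>2) (at \<theta>)"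
proof -
  have T: "(leftT has_real_derivative - (2 * sin \<theta> * cos \<theta>)) (at \<theta>)"
    unfolding leftT_def[abs_def] by (auto intro!: derivative_eq_intros)
  have ne: "leftT \<theta> \<noteq> 0" using leftT_pos[OF assms] by simp
  have "(leftx has_real_derivative (2 * c0\<^sup>2 * (2 * sin \<theta> * cos \<theta>) * leftT \<theta> - 2 * c0\<^sup>2 * (sin \<theta>)\<^sup>2 * (- (2 * sin \<theta> * cos \<theta>))) / (leftT \<theta> * leftT \<theta>)) (at \<theta>)"
    unfolding leftx_def[abs_def] using T ne by (auto intro!: derivative_eq_intros)
  moreover have "2 * c0\<^sup>2 * (2 * sin \<theta> * cos \<theta>) * leftT \<theta> - 2 * c0\<^sup>2 * (sin \<theta>)\<^sup>2 * (- (2 * sin \<theta> * cos \<theta>)) = 4 * c0\<^sup>2 * s0\<^sup>2 * sin \<theta> * cos \<theta>"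
    by (simp add: leftT_def algebra_simps)
  ultimately show ?thesis by (simp add: power2_eq_square)
qed

text \<open>The substituted force has a pole at \<theta> = \<phi>, the preimage of infinity. The
  elementary integrand for \<open>k = 0\<close> carries this pole and is split off; the correction
  \<open>ellq\<close> is regular, and \<open>zbar\<close> adds an integrand of the first
  kind.\<close>

lemma leftx_force:
  assumes \<theta>: "0 < \<theta>" "\<theta> < \<phi>"
  shows "4 * c0\<^sup>2 * s0\<^sup>2 * sin \<theta> * cos \<theta> / (leftT \<theta>)\<^sup>2 *
     ((- leftx \<theta> - crit) / sqrt \<bar>branch_poly alpha0 beta0 (- leftx \<theta>)\<bar>)
    = - (2 * s0 * c0 / leftT \<theta> - ellq k \<phi> \<theta>) - 2 * s0 * c0 * d0 * zbar * (1 / ell_delta k \<theta>)"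
proof -
  define S where "S = sin \<theta>"
  define C where "C = cos \<theta>"
  define D where "D = ell_delta k \<theta>"
  define T where "T = leftT \<theta>"
  have pos: "S > 0" "C > 0" "D > 0" "T > 0"
    using assms \<phi> incr_pos[of \<theta>] ell_delta_pos[OF k, of \<theta>] leftT_pos[of \<theta>] by (auto simp: S_def C_def D_def T_def)
  have sq: "C\<^sup>2 = 1 - S\<^sup>2" "D\<^sup>2 = 1 - k\<^sup>2 * S\<^sup>2" "T = s0\<^sup>2 - S\<^sup>2"
    by (simp_all add: S_def C_def D_def T_def leftT_def ell_delta_sq[OF k] cos_squared_eq)
  have x: "leftx \<theta> = 1 + 2 * c0\<^sup>2 * S\<^sup>2 / T" by (simp add: leftx_def S_def T_def)
  have f1: "- leftx \<theta> + 1 = - (2 * c0\<^sup>2 * S\<^sup>2 / T)" by (simp add: x)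
  have f2: "- leftx \<theta> - alpha0 = - (2 * s0\<^sup>2 * c0\<^sup>2 / T)"
  proof -
    have "- leftx \<theta> - alpha0 = - (2 * c0\<^sup>2 + 2 * c0\<^sup>2 * S\<^sup>2 / T)" using sq0(1) by (simp add: x alpha0_eq)
    also have "\<dots> = - (2 * c0\<^sup>2 * (T + S\<^sup>2) / T)" using pos by (simp add: field_simps)
    also have "T + S\<^sup>2 = s0\<^sup>2" by (simp add: sq)
    finally show ?thesis by (simp add: mult_ac)
  qed
  have f3: "- leftx \<theta> - beta0 = - (2 * c0\<^sup>2 * s0\<^sup>2 * D\<^sup>2 / (d0\<^sup>2 * T))"
  proof -
    have "- leftx \<theta> - beta0 = - (2 * c0\<^sup>2 / d0\<^sup>2 + 2 * c0\<^sup>2 * S\<^sup>2 / T)" by (simp add: x beta0_eq)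
    also have "\<dots> = - (2 * c0\<^sup>2 * (T + d0\<^sup>2 * S\<^sup>2) / (d0\<^sup>2 * T))" using pos pos0 by (simp add: field_simps)
    also have "T + d0\<^sup>2 * S\<^sup>2 = s0\<^sup>2 * D\<^sup>2" unfolding sq0 sq by (simp add: algebra_simps)
    finally show ?thesis by (simp add: mult_ac)
  qed
  have f4: "- leftx \<theta> - 1 = - (2 * s0\<^sup>2 * C\<^sup>2 / T)"
  proof -
    have "- leftx \<theta> - 1 = - (2 * (T + c0\<^sup>2 * S\<^sup>2) / T)" using pos by (simp add: x field_simps)
    also have "T + c0\<^sup>2 * S\<^sup>2 = s0\<^sup>2 * C\<^sup>2" unfolding sq0 sq by (simp add: algebra_simps)
    finally show ?thesis by (simp add: mult_ac)
  qed
  have "\<bar>branch_poly alpha0 beta0 (- leftx \<theta>)\<bar> = (4 * c0 ^ 3 * s0 ^ 3 * S * C * D / (d0 * T\<^sup>2))\<^sup>2"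
    unfolding branch_poly_def f1 f2 f3 f4 using pos pos0 k
    by (simp add: abs_mult power_divide power_mult_distrib) (simp add: field_simps eval_nat_numeral)
  then have rt: "sqrt \<bar>branch_poly alpha0 beta0 (- leftx \<theta>)\<bar> = 4 * c0 ^ 3 * s0 ^ 3 * S * C * D / (d0 * T\<^sup>2)"
    by (rule sqrt_abs_eq) (use pos pos0 in simp)
  have num: "- leftx \<theta> - crit = - (2 * c0\<^sup>2 * s0\<^sup>2) * (1 / T + zbar)"
  proof -
    have "- leftx \<theta> - crit = - (2 * c0\<^sup>2 * S\<^sup>2 / T + 2 * c0\<^sup>2) - 2 * c0\<^sup>2 * s0\<^sup>2 * zbar" by (simp add: x crit_def)
    also have "2 * c0\<^sup>2 * S\<^sup>2 / T + 2 * c0\<^sup>2 = 2 * c0\<^sup>2 * (T + S\<^sup>2) / T" using pos by (simp add: field_simps)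
    also have "T + S\<^sup>2 = s0\<^sup>2" by (simp add: sq)
    finally show ?thesis by (simp add: algebra_simps)
  qed
  have "4 * c0\<^sup>2 * s0\<^sup>2 * S * C / T\<^sup>2 * ((- leftx \<theta> - crit) / sqrt \<bar>branch_poly alpha0 beta0 (- leftx \<theta>)\<bar>)
     = d0 / (s0 * c0) * (- leftx \<theta> - crit) * (1 / D)"
    unfolding rt using pos pos0 by (simp add: field_simps eval_nat_numeral)
  also have "\<dots> = - (2 * s0 * c0 * d0 / (T * D)) - 2 * s0 * c0 * d0 * zbar * (1 / D)"
    unfolding num using pos pos0 by (simp add: field_simps power2_eq_square)
  also have "2 * s0 * c0 * d0 / (T * D) = 2 * s0 * c0 / T - ellq k \<phi> \<theta>"
  proof -
    have "ellq k \<phi> \<theta> = 2 * k\<^sup>2 * s0 * c0 / (D * (D + d0))"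
      by (simp add: ellq_def s0_def c0_def D_def d0_def)
    also have "\<dots> = 2 * s0 * c0 * (k\<^sup>2 * T) / (T * D * (D + d0))"
    proof -
      have "2 * \<kappa> * s * c / (D * e) = 2 * s * c * (\<kappa> * T) / (T * D * e)" for \<kappa> s c e :: real
        using pos by (simp add: divide_simps)
      then show ?thesis .
    qed
    also have "k\<^sup>2 * T = (D - d0) * (D + d0)"
    proof -
      have "(D - d0) * (D + d0) = D\<^sup>2 - d0\<^sup>2" by (simp add: power2_eq_square algebra_simps)
      then show ?thesis unfolding sq0 sq by (simp add: algebra_simps)
    qed
    also have "2 * s0 * c0 * ((D - d0) * (D + d0)) / (T * D * (D + d0)) = 2 * s0 * c0 * (D - d0) / (T * D)"
      using pos pos0 by (simp add: divide_simps)
    also have "\<dots> = 2 * s0 * c0 / T - 2 * s0 * c0 * d0 / (T * D)"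
      using pos by (simp add: field_simps)
    finally show ?thesis by simp
  qed
  finally show ?thesis by (simp add: S_def C_def D_def T_def)
qed

text \<open>As \<theta> tends to \<phi>, only \<open>ln (sin (\<phi> - \<theta>))\<close> diverges;
  it will cancel against \<open>ln (Z + 1)\<close> for \<open>Z = leftx \<theta>\<close>.\<close>

lemma left_integral:
  assumes \<theta>: "0 < \<theta>" "\<theta> < \<phi>"
  shows "integral {- leftx \<theta><..<-1} (\<lambda>x. (x - crit) / sqrt \<bar>branch_poly alpha0 beta0 x\<bar>)
    = ln (sin (\<phi> - \<theta>)) - ln (sin (\<phi> + \<theta>)) + integral {0..\<theta>} (ellq k \<phi>) - 2 * s0 * c0 * d0 * zbar * incF k \<theta>"
proof -
  let ?f = "\<lambda>x. (x - crit) / sqrt \<bar>branch_poly alpha0 beta0 x\<bar>"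
  let ?H = "\<lambda>\<theta>. - (2 * s0 * c0 / leftT \<theta> - ellq k \<phi> \<theta>) - 2 * s0 * c0 * d0 * zbar * (1 / ell_delta k \<theta>)"
  have T: "leftT x \<noteq> 0" if "x \<in> {0..\<theta>}" for x using leftT_pos(3)[of x] that \<theta> by auto
  have contT: "continuous_on A leftT" for A unfolding leftT_def[abs_def] by (intro continuous_intros)
  have "integral {leftx 0<..<leftx \<theta>} (\<lambda>x. ?f (- x)) = integral {0..\<theta>} ?H"
  proof (rule integral_image_Ioo)
    show "continuous_on {0..\<theta>} leftx"
      unfolding leftx_def[abs_def] using T by (intro continuous_intros contT) auto
    show "(leftx has_real_derivative 4 * c0\<^sup>2 * s0\<^sup>2 * sin x * cos x / (leftT x)\<^sup>2) (at x)"
      if "x \<in> {0<..<\<theta>}" for x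
      using that \<theta> by (intro leftx_deriv) auto
    show "4 * c0\<^sup>2 * s0\<^sup>2 * sin x * cos x / (leftT x)\<^sup>2 * ?f (- leftx x) = ?H x"
      if "x \<in> {0<..<\<theta>}" for x
      by (rule leftx_force) (use that \<theta> in auto)
    show "0 < 4 * c0\<^sup>2 * s0\<^sup>2 * sin x * cos x / (leftT x)\<^sup>2" if "x \<in> {0<..<\<theta>}" for x
      using incr_pos[of x] pos0 that \<theta> \<phi> T[of x] by auto
    show "continuous_on {0..\<theta>} ?H"
      using T by (intro continuous_intros contT continuous_on_ellq[OF k] continuous_on_ell_delta[OF k])
        (auto simp: ell_delta_neq_0[OF k])
  qed (fact \<theta>(1))
  moreover have "leftx 0 = 1" by (simp add: leftx_def)
  moreover have "integral {- leftx \<theta><..<-1} ?f = integral {1<..<leftx \<theta>} (\<lambda>x. ?f (- x))"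
    using Henstock_Kurzweil_Integration.integral_reflect_real[of "leftx \<theta>" 1 "\<lambda>x. ?f (- x)"] by (simp add: integral_open_interval_real)
  moreover have "(?H has_integral (ln (sin (\<phi> - \<theta>)) - ln (sin (\<phi> + \<theta>)) - (ln (sin (\<phi> - 0)) - ln (sin (\<phi> + 0))))
      + integral {0..\<theta>} (ellq k \<phi>) - 2 * s0 * c0 * d0 * zbar * incF k \<theta>) {0..\<theta>}"
  proof -
    have "((\<lambda>x. - (2 * s0 * c0 / leftT x)) has_integral
       (ln (sin (\<phi> - \<theta>)) - ln (sin (\<phi> + \<theta>)) - (ln (sin (\<phi> - 0)) - ln (sin (\<phi> + 0))))) {0..\<theta>}"
    proof (rule fundamental_theorem_of_calculus)
      fix x assume x: "x \<in> {0..\<theta>}"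
      then have p: "sin (\<phi> + x) > 0" "sin (\<phi> - x) > 0" using leftT_pos[of x] \<theta> by auto
      have "((\<lambda>x. ln (sin (\<phi> - x)) - ln (sin (\<phi> + x))) has_real_derivative
          - (cos (\<phi> - x) / sin (\<phi> - x)) - cos (\<phi> + x) / sin (\<phi> + x)) (at x within {0..\<theta>})"
        using p by (auto intro!: derivative_eq_intros)
      moreover have "- (cos (\<phi> - x) / sin (\<phi> - x)) - cos (\<phi> + x) / sin (\<phi> + x) = - (2 * s0 * c0 / leftT x)"
      proof -
        have "cos (\<phi> - x) * sin (\<phi> + x) + cos (\<phi> + x) * sin (\<phi> - x) = 2 * s0 * c0"
        proof -
          have "cos (\<phi> - x) * sin (\<phi> + x) + cos (\<phi> + x) * sin (\<phi> - x) = sin ((\<phi> - x) + (\<phi> + x))"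
            by (simp only: sin_add[of "\<phi> - x" "\<phi> + x"]) (simp add: mult_ac)
          also have "\<dots> = 2 * s0 * c0" using sin_double[of \<phi>] by (simp add: s0_def c0_def)
          finally show ?thesis .
        qed
        moreover have "- (a / b) - a' / b' = - ((a * b' + a' * b) / (b' * b))" if "b > 0" "b' > 0" for a b a' b' :: real
          using that by (simp add: divide_simps)
        ultimately show ?thesis unfolding leftT_eq using p by (simp only:)
      qed
      ultimately show "((\<lambda>x. ln (sin (\<phi> - x)) - ln (sin (\<phi> + x))) has_vector_derivative - (2 * s0 * c0 / leftT x)) (at x within {0..\<theta>})"
        by (simp add: has_real_derivative_iff_has_vector_derivative)
    qed (use \<theta> in simp)
    moreover have "(ellq k \<phi> has_integral integral {0..\<theta>} (ellq k \<phi>)) {0..\<theta>}"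
      by (intro integrable_integral integrable_continuous_interval continuous_on_ellq[OF k] continuous_intros)
    moreover have "((\<lambda>x. 2 * s0 * c0 * d0 * zbar * (1 / ell_delta k x)) has_integral 2 * s0 * c0 * d0 * zbar * incF k \<theta>) {0..\<theta>}"
      unfolding incF_def
      by (intro has_integral_mult_right integrable_integral integrable_continuous_interval continuous_intros continuous_on_ell_delta[OF k])
        (auto simp: ell_delta_neq_0[OF k])
    ultimately have "((\<lambda>x. - (2 * s0 * c0 / leftT x) + ellq k \<phi> x - 2 * s0 * c0 * d0 * zbar * (1 / ell_delta k x)) has_integral
      (ln (sin (\<phi> - \<theta>)) - ln (sin (\<phi> + \<theta>)) - (ln (sin (\<phi> - 0)) - ln (sin (\<phi> + 0)))) + integral {0..\<theta>} (ellq k \<phi>) - 2 * s0 * c0 * d0 * zbar * incF k \<theta>) {0..\<theta>}"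
      by (intro has_integral_diff has_integral_add)
    then show ?thesis by simp
  qed
  ultimately show ?thesis by (simp add: integral_unique)
qed

lemma ln_log_cap_le_elliptic:
  "ln (log_cap (two_intervals alpha0 beta0)) \<le>
     ln (1 / 2) - 2 * incF k \<phi> * (sin \<phi> * cos \<phi> * ell_delta k \<phi> * ellP k \<phi> / ellK k) + ellQ k \<phi>"
proof -
  \<comment> \<open>The bound for \<open>Z = leftx \<theta>\<close> after
    \<open>ln (sin (\<phi> - \<theta>))\<close> has cancelled. It is continuous up to \<theta> =
    \<phi>, so the limit of infinite \<open>Z\<close> is a mere evaluation.\<close>
  define R where "R \<theta> = ln (2 * s0\<^sup>2 * (cos \<theta>)\<^sup>2) - 2 * ln (sin (\<phi> + \<theta>)) + integral {0..\<theta>} (ellq k \<phi>)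
    - 2 * s0 * c0 * d0 * zbar * incF k \<theta>" for \<theta>
  have le: "ln (log_cap (two_intervals alpha0 beta0)) \<le> R \<theta>" if \<theta>: "0 < \<theta>" "\<theta> < \<phi>" for \<theta>
  proof -
    have p: "sin (\<phi> + \<theta>) > 0" "sin (\<phi> - \<theta>) > 0" "leftT \<theta> > 0" using leftT_pos[of \<theta>] \<theta> by auto
    have cs: "cos \<theta> > 0" "sin \<theta> > 0" using incr_pos[of \<theta>] \<theta> \<phi> by auto
    have "leftx \<theta> > 1" using p cs pos0 by (simp add: leftx_def)
    from ln_log_cap_le_period[OF endpoints0 crit_bounds this gap_condition]
    have "ln (log_cap (two_intervals alpha0 beta0)) \<le> ln (leftx \<theta> + 1) + (ln (sin (\<phi> - \<theta>)) - ln (sin (\<phi> + \<theta>))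
       + integral {0..\<theta>} (ellq k \<phi>) - 2 * s0 * c0 * d0 * zbar * incF k \<theta>)"
      unfolding left_integral[OF \<theta>] .
    moreover have "leftx \<theta> + 1 = 2 * s0\<^sup>2 * (cos \<theta>)\<^sup>2 / (sin (\<phi> + \<theta>) * sin (\<phi> - \<theta>))"
    proof -
      have "leftx \<theta> + 1 = 2 * (leftT \<theta> + c0\<^sup>2 * (sin \<theta>)\<^sup>2) / leftT \<theta>" using p by (simp add: leftx_def field_simps)
      also have "leftT \<theta> + c0\<^sup>2 * (sin \<theta>)\<^sup>2 = s0\<^sup>2 * (cos \<theta>)\<^sup>2"
        unfolding sq0 leftT_def cos_squared_eq by (simp add: algebra_simps)
      finally show ?thesis by (simp add: leftT_eq)
    qed
    then have "ln (leftx \<theta> + 1) = ln (2 * s0\<^sup>2 * (cos \<theta>)\<^sup>2) - (ln (sin (\<phi> + \<theta>)) + ln (sin (\<phi> - \<theta>)))"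
      using p cs pos0 by (simp add: ln_div ln_mult_pos)
    ultimately show ?thesis by (simp add: R_def)
  qed
  have "continuous_on {\<phi> / 2..\<phi>} R"
  proof -
    have c1: "continuous_on {0..\<phi>} (\<lambda>\<theta>. integral {0..\<theta>} (ellq k \<phi>))"
      by (intro indefinite_integral_continuous_1 integrable_continuous_interval continuous_on_ellq[OF k] continuous_intros)
    have c2: "continuous_on {0..\<phi>} (incF k)"
      using incF_deriv[OF k] by (intro DERIV_continuous_on) auto
    have "cos x > 0" "sin (\<phi> + x) > 0" if "x \<in> {\<phi> / 2..\<phi>}" for x
      using that \<phi> by (auto intro!: cos_gt_zero_pi sin_gt_zero)
    then have "2 * s0\<^sup>2 * (cos x)\<^sup>2 \<noteq> 0" "sin (\<phi> + x) \<noteq> 0" if "x \<in> {\<phi> / 2..\<phi>}" for x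
      using pos0 that by fastforce+
    then show ?thesis
      unfolding R_def[abs_def] using \<phi>
      by (intro continuous_intros continuous_on_subset[OF c1] continuous_on_subset[OF c2]) auto
  qed
  then have "(R \<longlongrightarrow> R \<phi>) (at \<phi> within {\<phi> / 2..\<phi>})"
    using \<phi> by (auto simp: continuous_on_def)
  then have "(R \<longlongrightarrow> R \<phi>) (at_left \<phi>)"
    using \<phi> by (simp add: at_within_Icc_at_left)
  moreover have "\<forall>\<^sub>F \<theta> in at_left \<phi>. ln (log_cap (two_intervals alpha0 beta0)) \<le> R \<theta>"
    using eventually_at_left_real[OF \<phi>(1)] by eventually_elim (use le in auto)
  ultimately have "ln (log_cap (two_intervals alpha0 beta0)) \<le> R \<phi>"
    by (intro tendsto_lowerbound) auto
  also have "R \<phi> = ln (1 / 2) - 2 * incF k \<phi> * (sin \<phi> * cos \<phi> * ell_delta k \<phi> * ellP k \<phi> / ellK k) + ellQ k \<phi>"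
  proof -
    \<comment> \<open>Origin of the factor 1/2 in the bound: at \<theta> = \<phi> the elementary
      terms no longer depend on \<phi>.\<close>
    have "ln (2 * s0\<^sup>2 * c0\<^sup>2) - 2 * ln (2 * s0 * c0) = ln (1 / 2)"
    proof -
      have "2 * s0\<^sup>2 * c0\<^sup>2 = (2 * s0 * c0)\<^sup>2 * (1 / 2)" by (simp add: power2_eq_square)
      then have "ln (2 * s0\<^sup>2 * c0\<^sup>2) = ln ((2 * s0 * c0)\<^sup>2) + ln (1 / 2)"
        by (simp only:) (rule ln_mult_pos, use pos0 in auto)
      then show ?thesis using pos0 by (simp add: ln_realpow)
    qed
    moreover have "sin (\<phi> + \<phi>) = 2 * s0 * c0" using sin_double[of \<phi>] by (simp add: s0_def c0_def)
    ultimately show ?thesis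
      by (simp add: R_def ellQ_def s0_def c0_def d0_def zbar_def mult_ac)
  qed
  finally show ?thesis .
qed

end

section \<open>The bound\<close>

lemma log_cap_two_intervals_ge:
  assumes "-1 < \<alpha>"
  shows "(1 + \<alpha>) / 4 \<le> log_cap (two_intervals \<alpha> \<beta>)"
  using log_cap_ge_interval[OF compact_two_intervals assms left_interval_subset_two_intervals, of \<beta>]
  by simp

lemma log_cap_le_amplitude:
  assumes k: "0 < k" "k < 1" and \<phi>: "0 < \<phi>" "\<phi> < pi / 2"
  shows "log_cap (two_intervals (gap_left \<phi>) (gap_right k \<phi>)) \<le>
    1 / 2 * (ell_delta k \<phi>)\<^sup>2 * exp (2 * (ellE k / ellK k - (1 - k\<^sup>2)) * (ln ((1 + sin \<phi>) / cos \<phi>))\<^sup>2)"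
proof -
  let ?X = "2 * (ellE k / ellK k - (1 - k\<^sup>2)) * (ln ((1 + sin \<phi>) / cos \<phi>))\<^sup>2"
  note ab = endpoints0[OF k \<phi>]
  have "log_cap (two_intervals (gap_left \<phi>) (gap_right k \<phi>)) > 0"
    by (rule less_le_trans[OF _ log_cap_two_intervals_ge[OF ab(1)]]) (use ab(1) in simp)
  then have "log_cap (two_intervals (gap_left \<phi>) (gap_right k \<phi>)) = exp (ln (log_cap (two_intervals (gap_left \<phi>) (gap_right k \<phi>))))"
    by simp
  also have "\<dots> \<le> exp (ln (1 / 2) + 2 * ln (ell_delta k \<phi>) + ?X)"
    unfolding exp_le_cancel_iff
    using ln_log_cap_le_elliptic[OF k \<phi>] elliptic_estimate[OF k less_imp_le[OF \<phi>(1)] \<phi>(2)] by (rule order.trans)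
  also have "\<dots> = exp (ln (1 / 2)) * (exp (ln (ell_delta k \<phi>)))\<^sup>2 * exp ?X"
    by (simp only: exp_add exp_double)
  also have "\<dots> = 1 / 2 * (ell_delta k \<phi>)\<^sup>2 * exp ?X"
    using ell_delta_pos[OF k, of \<phi>] by simp
  finally show ?thesis .
qed

section \<open>Jacobi functions and the parameters\<close>

lemma
  assumes k: "0 < k" "k < 1" and u: "0 < u" "u < ellK k"
  shows jacobi_am_bounds: "0 < jacobi_am u k" "jacobi_am u k < pi / 2"
    and incF_jacobi_am: "incF k (jacobi_am u k) = u"
proof -
  have F: "ellF \<phi> k = incF k \<phi>" if "0 \<le> \<phi>" for \<phi>
    using that by (simp add: ellF_def incF_def ell_delta_def)
  \<comment> \<open>The definite description in \<open>jacobi_am\<close> ranges over all reals: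
    negative candidates are excluded by sign, and nonnegative ones are distinguished by the growth
    of \<open>incF\<close>, whose slope is at least 1.\<close>
  have neg: "ellF \<phi> k \<le> 0" if "\<phi> < 0" for \<phi>
  proof -
    have "0 \<le> integral {\<phi>..0} (\<lambda>\<theta>. 1 / ell_delta k \<theta>)"
      using ell_delta_pos[OF k]
      by (intro integral_nonneg integrable_continuous_interval continuous_intros continuous_on_ell_delta[OF k])
        (auto simp: less_imp_le less_imp_neq[symmetric])
    then show ?thesis using that by (simp add: ellF_def ell_delta_def)
  qed
  have "continuous_on {0..pi / 2} (incF k)"
    by (rule DERIV_continuous_on[OF incF_deriv[OF k]])
  then obtain \<phi> where \<phi>: "0 \<le> \<phi>" "\<phi> \<le> pi / 2" "incF k \<phi> = u"
    using IVT'[of "incF k" 0 u "pi / 2"] u incF_0[OF k] by (auto simp: ellK_eq)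
  have "\<phi> \<noteq> 0" using \<phi> u incF_0[OF k] by auto
  have "\<phi> \<noteq> pi / 2" using \<phi>(3) u(2) unfolding ellK_eq by blast
  have "jacobi_am u k = \<phi>"
    unfolding jacobi_am_def
  proof (rule the_equality)
    show "ellF \<phi> k = u" using \<phi> F by simp
    fix \<psi> assume "ellF \<psi> k = u"
    then have "\<psi> \<ge> 0" using neg[of \<psi>] u by force
    then have "incF k \<psi> = incF k \<phi>" using F \<open>ellF \<psi> k = u\<close> \<phi> by simp
    then show "\<psi> = \<phi>"
      using incF_diff_ge[OF k \<open>\<psi> \<ge> 0\<close>, of \<phi>] incF_diff_ge[OF k \<phi>(1), of \<psi>] by linarith
  qed
  then show "0 < jacobi_am u k" "jacobi_am u k < pi / 2" "incF k (jacobi_am u k) = u"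
    using \<phi> \<open>\<phi> \<noteq> 0\<close> \<open>\<phi> \<noteq> pi / 2\<close> by auto
qed

lemma jacobi_dn_eq: "jacobi_dn u k = ell_delta k (jacobi_am u k)"
  by (simp add: jacobi_dn_def jacobi_sn_def ell_delta_def)

lemma alpha_of_eq: "alpha_of k l = gap_left (jacobi_am (l * ellK k) k)"
  by (simp add: alpha_of_def gap_left_def jacobi_sn_def)

lemma beta_of_eq: "beta_of k l = gap_right k (jacobi_am (l * ellK k) k)"
  by (simp add: beta_of_def gap_right_def jacobi_cn_def jacobi_dn_eq)

lemma cap_bound_eq:
  assumes "0 < k" "k < 1"
  shows "cap_bound k l = (let \<phi> = jacobi_am (l * ellK k) k in 1 / 2 * (ell_delta k \<phi>)\<^sup>2 *
    exp (2 * (ellE k / ellK k - (1 - k\<^sup>2)) * (ln ((1 + sin \<phi>) / cos \<phi>))\<^sup>2))"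
  using k2[OF assms] by (simp add: cap_bound_def Let_def jacobi_dn_eq jacobi_sn_def jacobi_cn_def)

lemma log_cap_le_cap_bound:
  assumes k: "0 < k" "k < 1" and l: "0 < l" "l < 1"
  shows "log_cap (two_intervals (alpha_of k l) (beta_of k l)) \<le> cap_bound k l"
proof -
  have "0 < l * ellK k" "l * ellK k < ellK k" using l ellK_pos[OF k] by auto
  note am = jacobi_am_bounds[OF k this]
  show ?thesis
    using log_cap_le_amplitude[OF k am] by (simp add: alpha_of_eq beta_of_eq cap_bound_eq[OF k] Let_def)
qed

text \<open>The two defining relations give \<open>cn^2 = (1 + \<alpha>) / 2\<close> and
  \<open>dn^2 = (1 + \<alpha>) / (1 + \<beta>)\<close>, whose quotient recovers \<beta>. This
  reduces the theorem to endpoints given by the parameters.\<close>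

lemma endpoints_eq_of_params:
  assumes ab: "-1 < \<alpha>" "\<alpha> < \<beta>" "\<beta> < 1"
    and k: "0 < k" "k < 1" "k\<^sup>2 = 2 * (\<beta> - \<alpha>) / ((1 - \<alpha>) * (1 + \<beta>))"
    and l: "0 < l" "l < 1" "(jacobi_sn (l * ellK k) k)\<^sup>2 = (1 - \<alpha>) / 2"
  shows "alpha_of k l = \<alpha>" "beta_of k l = \<beta>"
proof -
  show "alpha_of k l = \<alpha>" using l(3) by (simp add: alpha_of_def)
  have cn2: "(jacobi_cn (l * ellK k) k)\<^sup>2 = (1 + \<alpha>) / 2"
    using l(3) by (simp add: jacobi_cn_def jacobi_sn_def cos_squared_eq field_simps)
  have "(jacobi_dn (l * ellK k) k)\<^sup>2 = 1 - k\<^sup>2 * ((1 - \<alpha>) / 2)"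
    using ell_delta_sq[OF k(1,2)] l(3) by (simp add: jacobi_dn_eq jacobi_sn_def)
  also have "k\<^sup>2 * ((1 - \<alpha>) / 2) = (\<beta> - \<alpha>) / (1 + \<beta>)"
  proof -
    have "2 * b / (a * c) * (a / 2) = b / c" if "a \<noteq> 0" for a b c :: real using that by simp
    from this[of "1 - \<alpha>" "\<beta> - \<alpha>" "1 + \<beta>"] show ?thesis using ab unfolding k(3) by (simp only: right_minus_eq)
  qed
  also have "1 - (\<beta> - \<alpha>) / (1 + \<beta>) = (1 + \<alpha>) / (1 + \<beta>)" using ab by (simp add: field_simps)
  finally have dn2: "(jacobi_dn (l * ellK k) k)\<^sup>2 = (1 + \<alpha>) / (1 + \<beta>)" .
  show "beta_of k l = \<beta>" unfolding beta_of_def cn2 dn2 using ab by simp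
qed

text \<open>The amplitude lies between 0 and its argument, since \<open>incF\<close> has slope at
  least 1.\<close>

lemma jacobi_am_tendsto_0:
  assumes k: "0 < k" "k < 1"
  shows "((\<lambda>l. jacobi_am (l * ellK k) k) \<longlongrightarrow> 0) (at_right 0)"
proof (rule tendsto_sandwich[of "\<lambda>_. 0" _ _ "\<lambda>l. l * ellK k"])
  have bounds: "0 \<le> jacobi_am (l * ellK k) k \<and> jacobi_am (l * ellK k) k \<le> l * ellK k" if "l \<in> {0<..<1}" for l
  proof -
    have "0 < l * ellK k" "l * ellK k < ellK k" using that ellK_pos[OF k] by auto
    note am = jacobi_am_bounds(1)[OF k this] incF_jacobi_am[OF k this]
    then show ?thesis using incF_diff_ge[OF k order.refl, of "jacobi_am (l * ellK k) k"] incF_0[OF k] by simp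
  qed
  have "\<forall>\<^sub>F l in at_right 0. l \<in> {0<..<1::real}" by (rule eventually_at_right_real) simp
  then show "\<forall>\<^sub>F l in at_right 0. 0 \<le> jacobi_am (l * ellK k) k"
    "\<forall>\<^sub>F l in at_right 0. jacobi_am (l * ellK k) k \<le> l * ellK k"
    by (rule eventually_mono, use bounds in blast)+
  have "((\<lambda>l. l * ellK k) \<longlongrightarrow> 0 * ellK k) (at_right 0)" by (intro tendsto_intros)
  then show "((\<lambda>l. l * ellK k) \<longlongrightarrow> 0) (at_right 0)" by simp
qed simp

lemma cap_bound_tendsto:
  assumes k: "0 < k" "k < 1"
  shows "(cap_bound k \<longlongrightarrow> 1 / 2) (at_right 0)"
proof -
  have "((\<lambda>l. let \<phi> = jacobi_am (l * ellK k) k in 1 / 2 * (sqrt (1 - k\<^sup>2 * (sin \<phi>)\<^sup>2))\<^sup>2 *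
      exp (2 * (ellE k / ellK k - (1 - k\<^sup>2)) * (ln ((1 + sin \<phi>) / cos \<phi>))\<^sup>2)) \<longlongrightarrow>
    1 / 2 * (sqrt (1 - k\<^sup>2 * (sin 0)\<^sup>2))\<^sup>2 *
      exp (2 * (ellE k / ellK k - (1 - k\<^sup>2)) * (ln ((1 + sin 0) / cos 0))\<^sup>2)) (at_right 0)"
    unfolding Let_def by (intro tendsto_intros jacobi_am_tendsto_0[OF k]) auto
  then show ?thesis
    by (simp add: cap_bound_eq[OF k, abs_def] ell_delta_def)
qed

lemma log_cap_tendsto:
  assumes k: "0 < k" "k < 1"
  shows "((\<lambda>l. log_cap (two_intervals (alpha_of k l) (beta_of k l))) \<longlongrightarrow> 1 / 2) (at_right 0)"
proof (rule tendsto_sandwich[OF _ _ _ cap_bound_tendsto[OF k]])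
  have ev: "\<forall>\<^sub>F l in at_right 0. l \<in> {0<..<1::real}" by (rule eventually_at_right_real) simp
  show "\<forall>\<^sub>F l in at_right 0. (1 + alpha_of k l) / 4 \<le> log_cap (two_intervals (alpha_of k l) (beta_of k l))"
    using ev
  proof eventually_elim
    case (elim l)
    then have "0 < l * ellK k" "l * ellK k < ellK k" using ellK_pos[OF k] by auto
    note am = jacobi_am_bounds[OF k this]
    show ?case unfolding alpha_of_eq beta_of_eq
      by (rule log_cap_two_intervals_ge[OF endpoints0(1)[OF k am]])
  qed
  show "\<forall>\<^sub>F l in at_right 0. log_cap (two_intervals (alpha_of k l) (beta_of k l)) \<le> cap_bound k l"
    using ev by eventually_elim (use log_cap_le_cap_bound[OF k] in auto)
  have "((\<lambda>l. (1 + (1 - 2 * (sin (jacobi_am (l * ellK k) k))\<^sup>2)) / 4) \<longlongrightarrow> (1 + (1 - 2 * (sin 0)\<^sup>2)) / 4) (at_right 0)"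
    by (intro tendsto_intros jacobi_am_tendsto_0[OF k]) auto
  then show "((\<lambda>l. (1 + alpha_of k l) / 4) \<longlongrightarrow> 1 / 2) (at_right 0)"
    by (simp add: alpha_of_def jacobi_sn_def)
qed

theorem theorem4:
  "(\<forall>\<alpha> \<beta> k l :: real.
      -1 < \<alpha> \<and> \<alpha> < \<beta> \<and> \<beta> < 1 \<and>
      0 < k \<and> k < 1 \<and> k\<^sup>2 = 2 * (\<beta> - \<alpha>) / ((1 - \<alpha>) * (1 + \<beta>)) \<and>
      0 < l \<and> l < 1 \<and> (jacobi_sn (l * ellK k) k)\<^sup>2 = (1 - \<alpha>) / 2
      \<longrightarrow> log_cap (two_intervals \<alpha> \<beta>) \<le> cap_bound k l)
   \<and>
   (\<forall>k :: real. 0 < k \<and> k < 1 \<longrightarrow>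
      (\<exists>c :: real.
         ((\<lambda>l. log_cap (two_intervals (alpha_of k l) (beta_of k l))) \<longlongrightarrow> c) (at_right 0) \<and>
         ((\<lambda>l. cap_bound k l) \<longlongrightarrow> c) (at_right 0)))"
proof (intro conjI allI impI)
  fix \<alpha> \<beta> k l :: real
  assume *: "-1 < \<alpha> \<and> \<alpha> < \<beta> \<and> \<beta> < 1 \<and>
      0 < k \<and> k < 1 \<and> k\<^sup>2 = 2 * (\<beta> - \<alpha>) / ((1 - \<alpha>) * (1 + \<beta>)) \<and>
      0 < l \<and> l < 1 \<and> (jacobi_sn (l * ellK k) k)\<^sup>2 = (1 - \<alpha>) / 2"
  then have "alpha_of k l = \<alpha>" "beta_of k l = \<beta>"
    using endpoints_eq_of_params[of \<alpha> \<beta> k l] by blast+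
  then show "log_cap (two_intervals \<alpha> \<beta>) \<le> cap_bound k l"
    using log_cap_le_cap_bound[of k l] * by simp
next
  fix k :: real
  assume "0 < k \<and> k < 1"
  then show "\<exists>c. ((\<lambda>l. log_cap (two_intervals (alpha_of k l) (beta_of k l))) \<longlongrightarrow> c) (at_right 0) \<and>
         ((\<lambda>l. cap_bound k l) \<longlongrightarrow> c) (at_right 0)"
    using log_cap_tendsto[of k] cap_bound_tendsto[of k] by blast
qed

end
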